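(* Let $q\ge2$ be an integer and let $G,H$ be groups such that $\mathcal{W}(G,\gamma_{q-1}(G),\gamma_q(G))$ and $\mathcal{W}(H,\gamma_{q-1}(H),\gamma_q(H))$ are finite dimensional. Let $\varphi\colon G\to H$ be a homomorphism and $T\colon\mathcal{W}(H,\gamma_{q-1}(H),\gamma_q(H))\to\mathcal{W}(G,\gamma_{q-1}(G),\gamma_q(G))$, $[\nu]\mapsto[\nu\circ\varphi|_{\gamma_q(G)}]$, the induced linear map. Assume $T$ is not surjective and let $t=\dim_{\mathbb{R}}\operatorname{Coker}(T)\in\mathbb{N}$. Then there exists $X\subseteq\gamma_{q+1}(G)$ such that: (1) $(X,d_{\mathrm{scl}_{G,\gamma_q(G)}})$ is isomorphic to $(\mathbb{Z}^t,\|\cdot\|_1)$ as a coarse group; in particular $X$ is not $d_{\mathrm{scl}_{G,\gamma_q(G)}}$-bounded; (2) $X$ is $d_{\mathrm{scl}_{G,\gamma_{q-1}(G)}}$-bounded; (3) $\varphi(X)$ is $d_{\mathrm{scl}_{H,\gamma_q(H)}}$-bounded.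
   Context: $\gamma_1(G)=G$, $\gamma_{k+1}(G)=[G,\gamma_k(G)]$; $[G,\gamma_q(G)]=\gamma_{q+1}(G)$. For $N\trianglelefteq G$: $\mathrm{cl}_{G,N}$ is word length on $[G,N]$ w.r.t. simple commutators $[g,x]$ ($g\in G,x\in N$), $\mathrm{scl}_{G,N}(y)=\lim_n\mathrm{cl}_{G,N}(y^n)/n$, $d_{\mathrm{scl}_{G,N}}(y_1,y_2)=\mathrm{scl}_{G,N}(y_1^{-1}y_2)$; a set is $d$-bounded if its $d$-diameter is finite. For normal $L\geqslant N$: $\mathcal{W}(G,L,N)=\mathrm{Q}(N)^G/(\mathrm{H}^1(N)^G+\{\psi|_N:\psi\in\mathrm{Q}(L)^G\})$, with $\mathrm{Q}(N)^G$ the homogeneous quasimorphisms on $N$ invariant under $G$-conjugation and $\mathrm{H}^1(N)^G$ the $G$-invariant homomorphisms. A subset $X\subseteq\gamma_{q+1}(G)$ is isomorphic to $(\mathbb{Z}^t,\|\cdot\|_1)$ as a coarse group if there is a controlled pre-coarse homomorphism $\Psi\colon\mathbb{Z}^t\to\gamma_{q+1}(G)$ with image $X$ and a map $\Phi\colon X\to\mathbb{Z}^t$, the restriction of a pre-coarse homomorphism $\gamma_{q+1}(G)\to\mathbb{Z}^t$ and controlled on $(X,d_{\mathrm{scl}_{G,\gamma_q(G)}})$, such that $\Phi\circ\Psi$ and $\Psi\circ\Phi$ are at bounded distance from the identities (pre-coarse homomorphism: $\sup d(\alpha(ab),\alpha(a)\alpha(b))<\infty$). *)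

theory Defs
  imports Complex_Main "HOL-Algebra.Generated_Groups"
begin

definition commutator :: "('a,'b) monoid_scheme \<Rightarrow> 'a \<Rightarrow> 'a \<Rightarrow> 'a" where
  "commutator G g x = g \<otimes>\<^bsub>G\<^esub> x \<otimes>\<^bsub>G\<^esub> inv\<^bsub>G\<^esub> g \<otimes>\<^bsub>G\<^esub> inv\<^bsub>G\<^esub> x"

definition simple_comms :: "('a,'b) monoid_scheme \<Rightarrow> 'a set \<Rightarrow> 'a set \<Rightarrow> 'a set" where
  "simple_comms G A B = {commutator G g x | g x. g \<in> A \<and> x \<in> B}"

definition comm_subgroup :: "('a,'b) monoid_scheme \<Rightarrow> 'a set \<Rightarrow> 'a set \<Rightarrow> 'a set" where
  "comm_subgroup G A B = generate G (simple_comms G A B)"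

primrec lcs :: "('a,'b) monoid_scheme \<Rightarrow> nat \<Rightarrow> 'a set" where
  "lcs G 0 = carrier G"
| "lcs G (Suc k) = comm_subgroup G (carrier G) (lcs G k)"

text \<open>gamma G k is the paper's gamma_k(G): gamma_1(G) = G, gamma_{k+1}(G) = [G, gamma_k(G)]
  (with the harmless convention gamma_0(G) = G).\<close>
definition gamma :: "('a,'b) monoid_scheme \<Rightarrow> nat \<Rightarrow> 'a set" where
  "gamma G k = lcs G (k - 1)"

text \<open>cl_{G,N}(y): word length of y in [G,N] w.r.t. the simple commutators [g,x], g in G, x in N
  (this set is closed under inverses when N is normal).\<close>
definition cl :: "('a,'b) monoid_scheme \<Rightarrow> 'a set \<Rightarrow> 'a \<Rightarrow> nat" where
  "cl G N y = (LEAST n. \<exists>ws. length ws = n \<and> set ws \<subseteq> simple_comms G (carrier G) N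
                              \<and> y = foldr (\<otimes>\<^bsub>G\<^esub>) ws \<one>\<^bsub>G\<^esub>)"

definition scl :: "('a,'b) monoid_scheme \<Rightarrow> 'a set \<Rightarrow> 'a \<Rightarrow> real" where
  "scl G N y = lim (\<lambda>n. real (cl G N (y [^]\<^bsub>G\<^esub> n)) / real n)"

definition d_scl :: "('a,'b) monoid_scheme \<Rightarrow> 'a set \<Rightarrow> 'a \<Rightarrow> 'a \<Rightarrow> real" where
  "d_scl G N y1 y2 = scl G N (inv\<^bsub>G\<^esub> y1 \<otimes>\<^bsub>G\<^esub> y2)"

definition d_scl_bounded :: "('a,'b) monoid_scheme \<Rightarrow> 'a set \<Rightarrow> 'a set \<Rightarrow> bool" where
  "d_scl_bounded G N X \<longleftrightarrow> (\<exists>C. \<forall>x\<in>X. \<forall>y\<in>X. d_scl G N x y \<le> C)"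

text \<open>Real-valued functions on N are represented as functions on the whole group that vanish
  outside N.\<close>

definition quasimorphism_on :: "('a,'b) monoid_scheme \<Rightarrow> 'a set \<Rightarrow> ('a \<Rightarrow> real) \<Rightarrow> bool" where
  "quasimorphism_on G N f \<longleftrightarrow>
     (\<exists>D. \<forall>x\<in>N. \<forall>y\<in>N. \<bar>f (x \<otimes>\<^bsub>G\<^esub> y) - f x - f y\<bar> \<le> D)"

definition homogeneous_on :: "('a,'b) monoid_scheme \<Rightarrow> 'a set \<Rightarrow> ('a \<Rightarrow> real) \<Rightarrow> bool" where
  "homogeneous_on G N f \<longleftrightarrow> (\<forall>x\<in>N. \<forall>n::nat. f (x [^]\<^bsub>G\<^esub> n) = real n * f x)"

definition G_invariant_on :: "('a,'b) monoid_scheme \<Rightarrow> 'a set \<Rightarrow> ('a \<Rightarrow> real) \<Rightarrow> bool" where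
  "G_invariant_on G N f \<longleftrightarrow>
     (\<forall>g\<in>carrier G. \<forall>x\<in>N. f (g \<otimes>\<^bsub>G\<^esub> x \<otimes>\<^bsub>G\<^esub> inv\<^bsub>G\<^esub> g) = f x)"

definition supported_on :: "'a set \<Rightarrow> ('a \<Rightarrow> real) \<Rightarrow> bool" where
  "supported_on N f \<longleftrightarrow> (\<forall>x. x \<notin> N \<longrightarrow> f x = 0)"

definition QG :: "('a,'b) monoid_scheme \<Rightarrow> 'a set \<Rightarrow> ('a \<Rightarrow> real) set" where
  "QG G N = {f. supported_on N f \<and> quasimorphism_on G N f \<and> homogeneous_on G N f
                \<and> G_invariant_on G N f}"

definition H1G :: "('a,'b) monoid_scheme \<Rightarrow> 'a set \<Rightarrow> ('a \<Rightarrow> real) set" where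
  "H1G G N = {f. supported_on N f \<and> (\<forall>x\<in>N. \<forall>y\<in>N. f (x \<otimes>\<^bsub>G\<^esub> y) = f x + f y)
                \<and> G_invariant_on G N f}"

definition restr :: "'a set \<Rightarrow> ('a \<Rightarrow> real) \<Rightarrow> 'a \<Rightarrow> real" where
  "restr N f = (\<lambda>x. if x \<in> N then f x else 0)"

definition set_sum :: "('a \<Rightarrow> real) set \<Rightarrow> ('a \<Rightarrow> real) set \<Rightarrow> ('a \<Rightarrow> real) set" where
  "set_sum U V = {(\<lambda>x. f x + g x) | f g. f \<in> U \<and> g \<in> V}"

text \<open>The subspace H^1(N)^G + {psi|_N : psi in Q(L)^G} of Q(N)^G;
  W(G,L,N) is the quotient of QG G N by this subspace.\<close>
definition W_denom :: "('a,'b) monoid_scheme \<Rightarrow> 'a set \<Rightarrow> 'a set \<Rightarrow> ('a \<Rightarrow> real) set" where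
  "W_denom G L N = set_sum (H1G G N) (restr N ` QG G L)"

definition rspan :: "('a \<Rightarrow> real) set \<Rightarrow> ('a \<Rightarrow> real) set" where
  "rspan S = {(\<lambda>x. \<Sum>s\<in>F. c s * s x) | F c. finite F \<and> F \<subseteq> S}"

text \<open>quot_dim V U t: the real vector space V/U (U a subspace of V) has dimension t,
  i.e. there are t vectors of V whose classes form a basis of V/U.\<close>
definition quot_dim :: "('a \<Rightarrow> real) set \<Rightarrow> ('a \<Rightarrow> real) set \<Rightarrow> nat \<Rightarrow> bool" where
  "quot_dim V U t \<longleftrightarrow>
     (\<exists>B. finite B \<and> card B = t \<and> B \<subseteq> V \<and> V \<subseteq> rspan (B \<union> U)
          \<and> (\<forall>c. (\<lambda>x. \<Sum>b\<in>B. c b * b x) \<in> U \<longrightarrow> (\<forall>b\<in>B. c b = 0)))"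

definition quot_fin_dim :: "('a \<Rightarrow> real) set \<Rightarrow> ('a \<Rightarrow> real) set \<Rightarrow> bool" where
  "quot_fin_dim V U \<longleftrightarrow> (\<exists>t. quot_dim V U t)"

definition W_fin_dim :: "('a,'b) monoid_scheme \<Rightarrow> 'a set \<Rightarrow> 'a set \<Rightarrow> bool" where
  "W_fin_dim G L N \<longleftrightarrow> quot_fin_dim (QG G N) (W_denom G L N)"

definition T_image_reps ::
  "('a,'b) monoid_scheme \<Rightarrow> ('c,'d) monoid_scheme \<Rightarrow> ('a \<Rightarrow> 'c) \<Rightarrow> 'a set \<Rightarrow> 'c set
     \<Rightarrow> ('a \<Rightarrow> real) set" where
  "T_image_reps G H \<phi> N M = {restr N (\<nu> \<circ> \<phi>) | \<nu>. \<nu> \<in> QG H M}"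

text \<open>Coker(T) = W(G,L,N) / T(W(H,..)) = Q(N)^G / (W_denom + T-image representatives).\<close>
definition coker_denom ::
  "('a,'b) monoid_scheme \<Rightarrow> ('c,'d) monoid_scheme \<Rightarrow> ('a \<Rightarrow> 'c) \<Rightarrow> nat \<Rightarrow> ('a \<Rightarrow> real) set" where
  "coker_denom G H \<phi> q =
     set_sum (W_denom G (gamma G (q - 1)) (gamma G q)) (T_image_reps G H \<phi> (gamma G q) (gamma H q))"

definition T_surjective ::
  "('a,'b) monoid_scheme \<Rightarrow> ('c,'d) monoid_scheme \<Rightarrow> ('a \<Rightarrow> 'c) \<Rightarrow> nat \<Rightarrow> bool" where
  "T_surjective G H \<phi> q \<longleftrightarrow> QG G (gamma G q) \<subseteq> coker_denom G H \<phi> q"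

definition dim_coker_T ::
  "('a,'b) monoid_scheme \<Rightarrow> ('c,'d) monoid_scheme \<Rightarrow> ('a \<Rightarrow> 'c) \<Rightarrow> nat \<Rightarrow> nat \<Rightarrow> bool" where
  "dim_coker_T G H \<phi> q t \<longleftrightarrow> quot_dim (QG G (gamma G q)) (coker_denom G H \<phi> q) t"

definition Zt :: "nat \<Rightarrow> (nat \<Rightarrow> int) set" where
  "Zt t = {v. \<forall>i\<ge>t. v i = 0}"

definition l1 :: "nat \<Rightarrow> (nat \<Rightarrow> int) \<Rightarrow> real" where
  "l1 t v = (\<Sum>i<t. real_of_int \<bar>v i\<bar>)"

definition vadd :: "(nat \<Rightarrow> int) \<Rightarrow> (nat \<Rightarrow> int) \<Rightarrow> nat \<Rightarrow> int" where
  "vadd u v = (\<lambda>i. u i + v i)"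

definition vsub :: "(nat \<Rightarrow> int) \<Rightarrow> (nat \<Rightarrow> int) \<Rightarrow> nat \<Rightarrow> int" where
  "vsub u v = (\<lambda>i. u i - v i)"

definition coarse_iso_Zt ::
  "('a,'b) monoid_scheme \<Rightarrow> 'a set \<Rightarrow> 'a set \<Rightarrow> 'a set \<Rightarrow> nat \<Rightarrow> bool" where
  "coarse_iso_Zt G N M X t \<longleftrightarrow>
    (\<exists>\<Psi> \<Phi>.
       \<comment> \<open>Psi: Z^t \<rightarrow> M with image X, a controlled pre-coarse homomorphism\<close>
       (\<forall>v\<in>Zt t. \<Psi> v \<in> M) \<and> \<Psi> ` Zt t = X
     \<and> (\<exists>C. \<forall>u\<in>Zt t. \<forall>v\<in>Zt t. d_scl G N (\<Psi> (vadd u v)) (\<Psi> u \<otimes>\<^bsub>G\<^esub> \<Psi> v) \<le> C)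
     \<and> (\<forall>r. \<exists>R. \<forall>u\<in>Zt t. \<forall>v\<in>Zt t. l1 t (vsub u v) \<le> r \<longrightarrow> d_scl G N (\<Psi> u) (\<Psi> v) \<le> R)
       \<comment> \<open>Phi: M \<rightarrow> Z^t a pre-coarse homomorphism, controlled on (X, d_scl)\<close>
     \<and> (\<forall>a\<in>M. \<Phi> a \<in> Zt t)
     \<and> (\<exists>C. \<forall>a\<in>M. \<forall>b\<in>M. l1 t (vsub (\<Phi> (a \<otimes>\<^bsub>G\<^esub> b)) (vadd (\<Phi> a) (\<Phi> b))) \<le> C)
     \<and> (\<forall>r. \<exists>R. \<forall>x\<in>X. \<forall>y\<in>X. d_scl G N x y \<le> r \<longrightarrow> l1 t (vsub (\<Phi> x) (\<Phi> y)) \<le> R)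
       \<comment> \<open>mutually coarse inverse\<close>
     \<and> (\<exists>C. \<forall>v\<in>Zt t. l1 t (vsub (\<Phi> (\<Psi> v)) v) \<le> C)
     \<and> (\<exists>C. \<forall>x\<in>X. d_scl G N (\<Psi> (\<Phi> x)) x \<le> C))"

end

(* A simple commutator [g, x^n] with x in L is a single (G,L)-commutator, while modulo elements of
   bounded (G,N)-commutator length, N = [G,L], it depends additively on n. Hence if
   r = ((g_1,x_1), ..., (g_k,x_k)) is a relator, i.e. [g_1,x_1]...[g_k,x_k] = 1, the elements
   [g_1,x_1^n]...[g_k,x_k^n] form a coarse homomorphism from Z to [G,N] that is bounded for scl_{G,L}.
   Each nu in Q(N)^G has a slope along it, linear in nu. If all slopes of nu vanish, sending
   [g_1,x_1]...[g_k,x_k] to the corresponding slope defines h in H^1(N)^G with nu - h bounded on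
   commutators [g,x], and then nu - h extends to L; so nu lies in H^1(N)^G + Q(L)^G|_N. Finite
   dimensional duality therefore gives real combinations of relators which are dual to a basis of
   Coker(T) and on which all pullbacks from H have slope zero. Rounding their multiples to integers
   yields X. Boundedness of the image of X in H follows from Bavard duality.

   Bavard duality and the extension to L come from one Hahn-Banach argument, applied to the abelian
   group of sequences in the subgroup modulo those of bounded commutator length. *)
theory Submission
  imports Defs
begin

text \<open>The relator condition is used twice. It puts [g_1,x_1^n]...[g_k,x_k^n] into [G,N] with
  length at most linear in |n|: the value at n is the n-th power of the value 1 at exponent 1, up to
  a bounded error per step. It also makes a unit change of the exponent cheap, so that rounding real
  coefficients costs a bounded amount. Finite dimension of W(H) reduces the vanishing of slopes on
  all pullbacks to finitely many linear conditions. The obstacle in the duality is that x -> (m ->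
  x^m) is additive only up to sequences whose commutator length grows linearly in m. Growth rates
  are finite on sequences of linear length in [G,N], whereas the functional must also take values on
  powers of elements of N outside [G,N]. Hence the Hahn-Banach theorem dominates on a subgroup but
  extends to the whole group. Homogeneity and invariance of the resulting function are exact,
  because (x^n)^m = (x^m)^n, and because conjugation by g changes the sequence of powers only by a
  bounded one.\<close>

context group begin

lemma inv_cancel_left: "x \<in> carrier G \<Longrightarrow> y \<in> carrier G \<Longrightarrow> inv x \<otimes> (x \<otimes> y) = y"
  by (simp flip: m_assoc)

lemma cancel_inv_left: "x \<in> carrier G \<Longrightarrow> y \<in> carrier G \<Longrightarrow> x \<otimes> (inv x \<otimes> y) = y"
  by (simp flip: m_assoc)

lemmas word_simps = m_assoc inv_mult_group inv_cancel_left cancel_inv_left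

end

section \<open>Products of simple commutators\<close>

text \<open>Recursive form of the words counted by \<open>cl\<close>. Exactly \<open>k\<close>
  factors are required, but since the identity is itself a simple commutator, padding makes this the
  same as at most \<open>k\<close> (\<open>B_mono\<close>).\<close>

primrec comm_words :: "('a,'b) monoid_scheme \<Rightarrow> 'a set \<Rightarrow> nat \<Rightarrow> 'a set" where
  "comm_words G N 0 = {\<one>\<^bsub>G\<^esub>}"
| "comm_words G N (Suc k) =
     {c \<otimes>\<^bsub>G\<^esub> w | c w. c \<in> simple_comms G (carrier G) N \<and> w \<in> comm_words G N k}"

lemma comm_words_iff_list:
  "y \<in> comm_words G N n \<longleftrightarrow>
     (\<exists>ws. length ws = n \<and> set ws \<subseteq> simple_comms G (carrier G) N \<and> y = foldr (\<otimes>\<^bsub>G\<^esub>) ws \<one>\<^bsub>G\<^esub>)"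
proof (induction n arbitrary: y)
  case (Suc n)
  show ?case
  proof
    assume "y \<in> comm_words G N (Suc n)"
    then obtain c w where c: "y = c \<otimes>\<^bsub>G\<^esub> w" "c \<in> simple_comms G (carrier G) N" "w \<in> comm_words G N n"
      by auto
    with Suc.IH obtain ws where "length ws = n" "set ws \<subseteq> simple_comms G (carrier G) N"
      "w = foldr (\<otimes>\<^bsub>G\<^esub>) ws \<one>\<^bsub>G\<^esub>" by blast
    with c show "\<exists>ws. length ws = Suc n \<and> set ws \<subseteq> simple_comms G (carrier G) N
        \<and> y = foldr (\<otimes>\<^bsub>G\<^esub>) ws \<one>\<^bsub>G\<^esub>"
      by (intro exI[of _ "c # ws"]) auto
  next
    assume "\<exists>ws. length ws = Suc n \<and> set ws \<subseteq> simple_comms G (carrier G) N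
        \<and> y = foldr (\<otimes>\<^bsub>G\<^esub>) ws \<one>\<^bsub>G\<^esub>"
    then obtain ws where ws: "length ws = Suc n" "set ws \<subseteq> simple_comms G (carrier G) N"
      "y = foldr (\<otimes>\<^bsub>G\<^esub>) ws \<one>\<^bsub>G\<^esub>" by blast
    then obtain c ws' where "ws = c # ws'" by (cases ws) auto
    with ws show "y \<in> comm_words G N (Suc n)"
      using Suc.IH[of "foldr (\<otimes>\<^bsub>G\<^esub>) ws' \<one>\<^bsub>G\<^esub>"] by auto
  qed
qed auto

lemma cl_eq_Least: "cl G N y = (LEAST n. y \<in> comm_words G N n)"
  unfolding cl_def comm_words_iff_list ..

lemma cl_le: "y \<in> comm_words G N k \<Longrightarrow> cl G N y \<le> k"
  unfolding cl_eq_Least by (rule Least_le)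

locale normal_words = normal N G for N and G (structure)
begin

abbreviation "B \<equiv> comm_words G N"

lemma N_carrier: "x \<in> N \<Longrightarrow> x \<in> carrier G"
  using subset by blast

lemma N_conj: "g \<in> carrier G \<Longrightarrow> x \<in> N \<Longrightarrow> g \<otimes> x \<otimes> inv g \<in> N"
  by (rule inv_op_closed2)

lemma commutator_mem: "g \<in> carrier G \<Longrightarrow> x \<in> N \<Longrightarrow> commutator G g x \<in> N"
  unfolding commutator_def using N_conj by blast

lemma simple_comms_subset: "c \<in> simple_comms G (carrier G) N \<Longrightarrow> c \<in> N"
  unfolding simple_comms_def using commutator_mem by blast

lemma simple_comms_conj:
  assumes "c \<in> simple_comms G (carrier G) N" "h \<in> carrier G"
  shows "h \<otimes> c \<otimes> inv h \<in> simple_comms G (carrier G) N"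
proof -
  obtain g x where gx: "g \<in> carrier G" "x \<in> N" and c: "c = commutator G g x"
    using assms(1) unfolding simple_comms_def by blast
  have "h \<otimes> c \<otimes> inv h = commutator G (h \<otimes> g \<otimes> inv h) (h \<otimes> x \<otimes> inv h)"
    using assms(2) gx N_carrier[of x] unfolding c commutator_def by (simp add: word_simps)
  then show ?thesis
    unfolding simple_comms_def using assms(2) gx N_conj by blast
qed

lemma inv_commutator:
  assumes "g \<in> carrier G" "x \<in> carrier G"
  shows "inv (commutator G g x) = commutator G (inv g) (g \<otimes> x \<otimes> inv g)"
  using assms unfolding commutator_def by (simp add: word_simps)

lemma simple_comms_inv:
  assumes "c \<in> simple_comms G (carrier G) N"
  shows "inv c \<in> simple_comms G (carrier G) N"
proof -
  obtain g x where gx: "g \<in> carrier G" "x \<in> N" and c: "c = commutator G g x"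
    using assms(1) unfolding simple_comms_def by blast
  show ?thesis
    unfolding c inv_commutator[OF gx(1) N_carrier[OF gx(2)]] simple_comms_def using gx N_conj by blast
qed

lemma one_simple_comm: "\<one> \<in> simple_comms G (carrier G) N"
proof -
  have "\<one> = commutator G \<one> \<one>" by (simp add: commutator_def)
  then show ?thesis unfolding simple_comms_def using subgroup.one_closed[OF is_subgroup] by blast
qed

lemma B_subset: "w \<in> B k \<Longrightarrow> w \<in> N"
  by (induction k arbitrary: w) (auto dest: simple_comms_subset)

lemma B_carrier: "w \<in> B k \<Longrightarrow> w \<in> carrier G"
  using B_subset N_carrier by blast

lemma B_one: "\<one> \<in> B k"
proof (induction k)
  case (Suc k)
  have "\<one> = \<one> \<otimes> \<one>" by simp
  with Suc show ?case using one_simple_comm unfolding comm_words.simps by blast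
qed simp

lemma B_mult: "w \<in> B k \<Longrightarrow> w' \<in> B l \<Longrightarrow> w \<otimes> w' \<in> B (k + l)"
proof (induction k arbitrary: w)
  case 0
  then show ?case using B_carrier[of w' l] by simp
next
  case (Suc k)
  then obtain c v where cv: "w = c \<otimes> v" "c \<in> simple_comms G (carrier G) N" "v \<in> B k" by auto
  then have "w \<otimes> w' = c \<otimes> (v \<otimes> w')"
    using simple_comms_subset[OF cv(2)] B_carrier[OF cv(3)] B_carrier[OF Suc.prems(2)] N_carrier
    by (simp add: m_assoc)
  then show ?case using cv Suc by auto
qed

lemma B_mono: "w \<in> B k \<Longrightarrow> k \<le> l \<Longrightarrow> w \<in> B l"
  using B_mult[of w k "\<one>" "l - k"] B_one B_carrier[of w k] by simp

lemma B_simple: "c \<in> simple_comms G (carrier G) N \<Longrightarrow> c \<in> B (Suc 0)"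
  using simple_comms_subset[of c] N_carrier by (auto intro!: exI[of _ c])

lemma B_commutator: "g \<in> carrier G \<Longrightarrow> x \<in> N \<Longrightarrow> commutator G g x \<in> B (Suc 0)"
  by (rule B_simple) (auto simp: simple_comms_def)

lemma B_conj: "w \<in> B k \<Longrightarrow> h \<in> carrier G \<Longrightarrow> h \<otimes> w \<otimes> inv h \<in> B k"
proof (induction k arbitrary: w)
  case (Suc k)
  then obtain c v where cv: "w = c \<otimes> v" "c \<in> simple_comms G (carrier G) N" "v \<in> B k" by auto
  then have "h \<otimes> w \<otimes> inv h = (h \<otimes> c \<otimes> inv h) \<otimes> (h \<otimes> v \<otimes> inv h)"
    using simple_comms_subset[OF cv(2)] B_carrier[OF cv(3)] Suc.prems(2) N_carrier
    by (simp add: word_simps)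
  then show ?case using simple_comms_conj[OF cv(2) Suc.prems(2)] Suc.IH[OF cv(3) Suc.prems(2)] by auto
qed simp

lemma B_inv: "w \<in> B k \<Longrightarrow> inv w \<in> B k"
proof (induction k arbitrary: w)
  case (Suc k)
  then obtain c v where cv: "w = c \<otimes> v" "c \<in> simple_comms G (carrier G) N" "v \<in> B k" by auto
  then have "inv w = inv v \<otimes> inv c"
    using simple_comms_subset[OF cv(2)] B_carrier[OF cv(3)] N_carrier by (simp add: inv_mult_group)
  then show ?case using B_mult[OF Suc.IH[OF cv(3)] B_simple[OF simple_comms_inv[OF cv(2)]]] by simp
qed simp

lemma B_pow: "w \<in> B k \<Longrightarrow> w [^] (n::nat) \<in> B (k * n)"
proof (induction n)
  case (Suc n)
  then show ?case using B_mult[of "w [^] n" "k * n" w k] by (simp add: add.commute)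
qed simp

section \<open>The subgroup [G,N]\<close>

abbreviation "GN \<equiv> comm_subgroup G (carrier G) N"

lemma GN_iff: "y \<in> GN \<longleftrightarrow> (\<exists>k. y \<in> B k)"
proof
  assume "y \<in> GN"
  then show "\<exists>k. y \<in> B k"
    unfolding comm_subgroup_def
  proof (induction rule: generate.induct)
    case one then show ?case using B_one by blast
  next
    case (incl h) then show ?case using B_simple by blast
  next
    case (inv h) then show ?case using B_simple B_inv by blast
  next
    case (eng h1 h2) then show ?case using B_mult by blast
  qed
next
  have "y \<in> B k \<Longrightarrow> y \<in> GN" for k
    unfolding comm_subgroup_def
  proof (induction k arbitrary: y)
    case (Suc k)
    then show ?case by (auto intro: generate.eng generate.incl)
  qed (auto intro: generate.one)
  then show "\<exists>k. y \<in> B k \<Longrightarrow> y \<in> GN" by blast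
qed

lemma B_GN: "y \<in> B k \<Longrightarrow> y \<in> GN"
  using GN_iff by blast

lemma GN_subset: "y \<in> GN \<Longrightarrow> y \<in> N"
  using GN_iff B_subset by blast

lemma GN_carrier: "y \<in> GN \<Longrightarrow> y \<in> carrier G"
  using GN_subset N_carrier by blast

lemma GN_normal: "GN \<lhd> G"
  unfolding normal_inv_iff
proof
  show "subgroup GN G"
    unfolding comm_subgroup_def
    by (rule generate_is_subgroup) (use simple_comms_subset N_carrier in blast)
  show "\<forall>x\<in>carrier G. \<forall>h\<in>GN. x \<otimes> h \<otimes> inv x \<in> GN"
    using GN_iff B_conj by blast
qed

lemma GN_subgroup: "subgroup GN G"
  using GN_normal by (simp add: normal_inv_iff)

lemma B_cl: "y \<in> GN \<Longrightarrow> y \<in> B (cl G N y)"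
  unfolding cl_eq_Least using GN_iff LeastI by metis

lemma cl_mult: "a \<in> GN \<Longrightarrow> b \<in> GN \<Longrightarrow> cl G N (a \<otimes> b) \<le> cl G N a + cl G N b"
  by (intro cl_le B_mult B_cl)

text \<open>Modulo elements of bounded commutator length, \<open>N\<close> is abelian and \<open>G\<close> acts trivially on it.\<close>

definition apx :: "nat \<Rightarrow> 'a \<Rightarrow> 'a \<Rightarrow> bool" where
  "apx k a b \<longleftrightarrow> a \<in> N \<and> b \<in> N \<and> inv b \<otimes> a \<in> B k"

lemma apx_mono: "apx k a b \<Longrightarrow> k \<le> l \<Longrightarrow> apx l a b"
  unfolding apx_def by (blast intro: B_mono)

lemma apx_refl: "a \<in> N \<Longrightarrow> apx k a a"
  unfolding apx_def using B_one N_carrier by simp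

lemma apx_sym: "apx k a b \<Longrightarrow> apx k b a"
  unfolding apx_def using B_inv[of "inv b \<otimes> a" k] N_carrier by (simp add: inv_mult_group)

lemma apx_trans:
  assumes "apx k a b" "apx l b c"
  shows "apx (k + l) a c"
proof -
  have "inv c \<otimes> a = (inv c \<otimes> b) \<otimes> (inv b \<otimes> a)"
    using assms N_carrier unfolding apx_def by (simp add: word_simps)
  then show ?thesis
    using assms B_mult[of "inv c \<otimes> b" l "inv b \<otimes> a" k] unfolding apx_def by (simp add: add.commute)
qed

text \<open>Conjugation invariance of \<open>B k\<close> lets the error of the first factor move
  past the second one without growing.\<close>

lemma apx_mult:
  assumes "apx k a b" "apx l c d"
  shows "apx (k + l) (a \<otimes> c) (b \<otimes> d)"
proof -
  have in_carrier: "a \<in> carrier G" "b \<in> carrier G" "c \<in> carrier G" "d \<in> carrier G"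
    using assms N_carrier unfolding apx_def by auto
  have "inv d \<otimes> (inv b \<otimes> a) \<otimes> inv (inv d) \<in> B k"
    using assms in_carrier unfolding apx_def by (intro B_conj) auto
  then have "(inv d \<otimes> (inv b \<otimes> a) \<otimes> inv (inv d)) \<otimes> (inv d \<otimes> c) \<in> B (k + l)"
    using assms unfolding apx_def by (intro B_mult) auto
  moreover have "inv (b \<otimes> d) \<otimes> (a \<otimes> c) = (inv d \<otimes> (inv b \<otimes> a) \<otimes> inv (inv d)) \<otimes> (inv d \<otimes> c)"
    using in_carrier by (simp add: word_simps)
  ultimately show ?thesis
    using assms unfolding apx_def by auto
qed

lemma apx_conj:
  assumes "g \<in> carrier G" "a \<in> N"
  shows "apx 1 (g \<otimes> a \<otimes> inv g) a"
proof -
  have "inv a \<otimes> (g \<otimes> a \<otimes> inv g) = inv a \<otimes> commutator G g a \<otimes> inv (inv a)"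
    using assms N_carrier unfolding commutator_def by (simp add: word_simps)
  moreover have "\<dots> \<in> B (Suc 0)"
    by (rule B_conj) (use assms B_commutator N_carrier in auto)
  ultimately show ?thesis
    using assms N_conj unfolding apx_def by simp
qed

text \<open>The two products are conjugate, so this is an instance of
  \<open>apx_conj\<close>.\<close>

lemma apx_commute:
  assumes "a \<in> N" "b \<in> N"
  shows "apx 1 (a \<otimes> b) (b \<otimes> a)"
proof -
  have "inv b \<otimes> (b \<otimes> a) \<otimes> inv (inv b) = a \<otimes> b"
    using assms N_carrier by (simp add: word_simps)
  then show ?thesis
    using apx_conj[of "inv b" "b \<otimes> a"] assms N_carrier by simp
qed

lemma apx_one_iff: "apx k a \<one> \<longleftrightarrow> a \<in> B k"
  unfolding apx_def using B_subset N_carrier by auto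

lemma apx_mult4:
  assumes "a \<in> N" "b \<in> N" "c \<in> N" "d \<in> N"
  shows "apx 1 ((a \<otimes> b) \<otimes> (c \<otimes> d)) ((a \<otimes> c) \<otimes> (b \<otimes> d))"
proof -
  have "apx (0 + 1 + 0) (a \<otimes> (b \<otimes> c) \<otimes> d) (a \<otimes> (c \<otimes> b) \<otimes> d)"
    using assms by (intro apx_mult apx_refl apx_commute)
  then show ?thesis using assms N_carrier by (simp add: m_assoc)
qed

lemma N_pow: "x \<in> N \<Longrightarrow> x [^] (n::nat) \<in> N"
  by (induction n) auto

text \<open>Each further power costs one interchange of factors. The resulting rate of one
  commutator per unit of \<open>m\<close> becomes the defect of the quasimorphisms built from
  sequences.\<close>

lemma apx_pow_mult:
  assumes "x \<in> N" "y \<in> N"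
  shows "apx m (x [^] (m::nat) \<otimes> y [^] m) ((x \<otimes> y) [^] m)"
proof (induction m)
  case 0 then show ?case by (simp add: apx_refl)
next
  case (Suc m)
  have "apx 1 ((x [^] m \<otimes> x) \<otimes> (y [^] m \<otimes> y)) ((x [^] m \<otimes> y [^] m) \<otimes> (x \<otimes> y))"
    using assms N_pow by (intro apx_mult4) auto
  moreover have "apx (m + 0) ((x [^] m \<otimes> y [^] m) \<otimes> (x \<otimes> y)) ((x \<otimes> y) [^] m \<otimes> (x \<otimes> y))"
    using assms by (intro apx_mult Suc apx_refl) auto
  ultimately show ?case
    using apx_trans by fastforce
qed

end

section \<open>Invariant quasimorphisms and stable commutator length\<close>

text \<open>Fekete's lemma: divide \<open>n\<close> with remainder by a \<open>k\<close> at which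
  the quotient is nearly minimal. The finitely many remainders contribute a constant, which
  disappears after division by \<open>n\<close>.\<close>

lemma subadditive_limit:
  fixes a :: "nat \<Rightarrow> real"
  assumes subadd: "\<And>m n. a (m + n) \<le> a m + a n" and nonneg: "\<And>n. 0 \<le> a n"
  shows "convergent (\<lambda>n. a n / real n)"
proof -
  define L where "L = (INF n\<in>{1..}. a n / real n)"
  have bdd: "bdd_below ((\<lambda>n. a n / real n) ` {1..})"
    using nonneg by (intro bdd_belowI2[of _ 0]) simp
  have mult: "a (q * k + r) \<le> real q * a k + a r" for q k r
  proof (induction q)
    case (Suc q)
    have "a (Suc q * k + r) \<le> a k + a (q * k + r)"
      using subadd[of k "q * k + r"] by (simp add: add.assoc)
    with Suc show ?case by (simp add: algebra_simps)
  qed simp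
  have "(\<lambda>n. a n / real n) \<longlonglongrightarrow> L"
  proof (rule LIMSEQ_I)
    fix e :: real assume "e > 0"
    then have "\<exists>k\<in>{1..}. a k / real k < L + e / 2"
      using cINF_less_iff[OF _ bdd, of "L + e / 2"] unfolding L_def by auto
    then obtain k where k: "k \<ge> 1" "a k / real k < L + e / 2" by auto
    define M where "M = (\<Sum>r<k. a r)"
    have M: "a r \<le> M" if "r < k" for r
      unfolding M_def using that nonneg by (intro member_le_sum) auto
    obtain n0 :: nat where n0: "real n0 > 2 * M / e" using reals_Archimedean2 by blast
    show "\<exists>no. \<forall>n\<ge>no. norm (a n / real n - L) < e"
    proof (intro exI allI impI)
      fix n assume n: "n \<ge> Suc n0"
      have "L \<le> a n / real n"
        unfolding L_def using bdd n by (intro cINF_lower) auto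
      have "a n \<le> real (n div k) * a k + a (n mod k)"
        using mult[of "n div k" k "n mod k"] by simp
      also have "\<dots> \<le> (real n / real k) * a k + M"
        using k nonneg[of k] M[of "n mod k"] of_nat_div_le_of_nat[of n k]
        by (intro add_mono mult_right_mono) auto
      finally have "a n / real n \<le> ((real n / real k) * a k + M) / real n"
        by (intro divide_right_mono) auto
      also have "\<dots> = a k / real k + M / real n"
        using n k by (simp add: field_simps)
      also have "M / real n < e / 2"
      proof -
        have "2 * M / e < real n" using n0 n by linarith
        then show ?thesis using \<open>e > 0\<close> n by (simp add: field_simps)
      qed
      finally have "a n / real n < L + e" using k by simp
      with \<open>L \<le> a n / real n\<close> \<open>e > 0\<close> show "norm (a n / real n - L) < e" by simp
    qed
  qed
  then show ?thesis by (rule convergentI)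
qed

text \<open>\<open>quasimorphism_on\<close> hides its constant; the duality needs one bound valid
  for all quasimorphisms of defect at most 1, so the constant is made explicit.\<close>

definition defect_le :: "('a,'b) monoid_scheme \<Rightarrow> 'a set \<Rightarrow> real \<Rightarrow> ('a \<Rightarrow> real) \<Rightarrow> bool" where
  "defect_le G N D f \<longleftrightarrow> (\<forall>x\<in>N. \<forall>y\<in>N. \<bar>f (x \<otimes>\<^bsub>G\<^esub> y) - f x - f y\<bar> \<le> D)"

lemma QG_defect: "\<nu> \<in> QG G N \<Longrightarrow> \<exists>D. defect_le G N D \<nu>"
  unfolding QG_def quasimorphism_on_def defect_le_def by blast

lemma QG_pow: "\<nu> \<in> QG G N \<Longrightarrow> x \<in> N \<Longrightarrow> \<nu> (x [^]\<^bsub>G\<^esub> (n::nat)) = real n * \<nu> x"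
  unfolding QG_def homogeneous_on_def by blast

lemma QG_conj:
  "\<nu> \<in> QG G N \<Longrightarrow> g \<in> carrier G \<Longrightarrow> x \<in> N \<Longrightarrow> \<nu> (g \<otimes>\<^bsub>G\<^esub> x \<otimes>\<^bsub>G\<^esub> inv\<^bsub>G\<^esub> g) = \<nu> x"
  unfolding QG_def G_invariant_on_def by blast

lemma QG_outside: "\<nu> \<in> QG G N \<Longrightarrow> x \<notin> N \<Longrightarrow> \<nu> x = 0"
  unfolding QG_def supported_on_def by blast

lemma bounded_multiples_zero:
  fixes a b :: real
  assumes "\<And>n::nat. real n * \<bar>a\<bar> \<le> b"
  shows "a = 0"
proof (rule ccontr)
  assume "a \<noteq> 0"
  then obtain n :: nat where "b < real n * \<bar>a\<bar>"
    using reals_Archimedean3[of "\<bar>a\<bar>"] by auto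
  with assms[of n] show False by simp
qed

lemma le_of_affine_bounds:
  fixes a b E :: real
  assumes "\<And>n::nat. real n * a \<le> b * real n + E"
  shows "a \<le> b"
proof (rule ccontr)
  assume "\<not> a \<le> b"
  then obtain n :: nat where "E < real n * (a - b)"
    using reals_Archimedean3[of "a - b"] by auto
  with assms[of n] show False by (simp add: algebra_simps)
qed

context normal_words
begin

lemma defect_nonneg: "defect_le G N D \<nu> \<Longrightarrow> 0 \<le> D"
  using one_closed abs_ge_zero order_trans unfolding defect_le_def by (metis subgroup.one_closed[OF is_subgroup])

lemma QG_one: "\<nu> \<in> QG G N \<Longrightarrow> \<nu> \<one> = 0"
  using QG_pow[of \<nu> G N \<one> 0] by simp

text \<open>Homogeneity is stated for natural exponents only. The value at the inverse follows from
  the defect at the products of \<open>x [^] n\<close> and \<open>inv x [^] n\<close>, all equal to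
  1, as \<open>n\<close> grows.\<close>

lemma QG_inv:
  assumes "\<nu> \<in> QG G N" "x \<in> N"
  shows "\<nu> (inv x) = - \<nu> x"
proof -
  obtain D where D: "defect_le G N D \<nu>" using QG_defect[OF assms(1)] by blast
  have "real n * \<bar>\<nu> (inv x) + \<nu> x\<bar> \<le> D" for n :: nat
  proof -
    have "\<bar>\<nu> (x [^] n \<otimes> inv x [^] n) - \<nu> (x [^] n) - \<nu> (inv x [^] n)\<bar> \<le> D"
      using D assms N_pow unfolding defect_le_def by auto
    moreover have "x [^] n \<otimes> inv x [^] n = \<one>"
      using assms N_carrier by (simp add: nat_pow_inv)
    ultimately have "\<bar>- (real n * (\<nu> (inv x) + \<nu> x))\<bar> \<le> D"
      using QG_pow[OF assms(1)] QG_one[OF assms(1)] assms by (simp add: algebra_simps)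
    then have "\<bar>real n * (\<nu> (inv x) + \<nu> x)\<bar> \<le> D" by simp
    then show ?thesis by (simp add: abs_mult)
  qed
  then have "\<nu> (inv x) + \<nu> x = 0" by (rule bounded_multiples_zero)
  then show ?thesis by simp
qed

text \<open>A commutator is the product of a conjugate of \<open>x\<close> and \<open>inv x\<close>,
  whose values cancel, so only one defect remains.\<close>

lemma QG_commutator:
  assumes "\<nu> \<in> QG G N" "defect_le G N D \<nu>" "g \<in> carrier G" "x \<in> N"
  shows "\<bar>\<nu> (commutator G g x)\<bar> \<le> D"
proof -
  have "\<bar>\<nu> (g \<otimes> x \<otimes> inv g \<otimes> inv x) - \<nu> (g \<otimes> x \<otimes> inv g) - \<nu> (inv x)\<bar> \<le> D"
    using assms N_conj unfolding defect_le_def by blast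
  then show ?thesis
    using QG_conj[OF assms(1,3,4)] QG_inv[OF assms(1,4)] unfolding commutator_def by simp
qed

text \<open>Every factor costs \<open>D\<close> for its own value and \<open>D\<close> for the
  multiplication.\<close>

lemma QG_B:
  assumes "\<nu> \<in> QG G N" "defect_le G N D \<nu>" "w \<in> B k"
  shows "\<bar>\<nu> w\<bar> \<le> 2 * real k * D"
  using assms(3)
proof (induction k arbitrary: w)
  case 0 then show ?case using QG_one[OF assms(1)] by simp
next
  case (Suc k)
  then obtain c v where cv: "w = c \<otimes> v" "c \<in> simple_comms G (carrier G) N" "v \<in> B k" by auto
  have "\<bar>\<nu> (c \<otimes> v) - \<nu> c - \<nu> v\<bar> \<le> D"
    using assms(2) cv simple_comms_subset B_subset unfolding defect_le_def by blast
  moreover have "\<bar>\<nu> c\<bar> \<le> D"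
    using cv(2) QG_commutator[OF assms(1,2)] unfolding simple_comms_def by blast
  ultimately show ?case using Suc.IH[OF cv(3)] cv(1) by (simp add: algebra_simps)
qed

lemma QG_apx:
  assumes "\<nu> \<in> QG G N" "defect_le G N D \<nu>" "apx k a b"
  shows "\<bar>\<nu> a - \<nu> b\<bar> \<le> (2 * real k + 1) * D"
proof -
  have ab: "a \<in> N" "b \<in> N" and w: "inv b \<otimes> a \<in> B k" using assms(3) unfolding apx_def by auto
  have "\<bar>\<nu> (b \<otimes> (inv b \<otimes> a)) - \<nu> b - \<nu> (inv b \<otimes> a)\<bar> \<le> D"
    using assms(2) ab unfolding defect_le_def by blast
  moreover have "b \<otimes> (inv b \<otimes> a) = a"
    using ab N_carrier by (simp add: word_simps)
  ultimately show ?thesis using QG_B[OF assms(1,2) w] by (simp add: algebra_simps)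
qed

section \<open>Stable commutator length as a limit\<close>

lemma cl_commutator: "g \<in> carrier G \<Longrightarrow> x \<in> N \<Longrightarrow> cl G N (commutator G g x) \<le> 1"
  using cl_le[OF B_commutator] by simp

lemma GN_pow: "y \<in> GN \<Longrightarrow> y [^] (n::nat) \<in> GN"
  using GN_iff B_pow by blast

lemma scl_limit:
  assumes "y \<in> GN"
  shows "(\<lambda>n. real (cl G N (y [^] n)) / real n) \<longlonglongrightarrow> scl G N y"
proof -
  have "cl G N (y [^] (m + n)) \<le> cl G N (y [^] m) + cl G N (y [^] n)" for m n :: nat
    using cl_mult[OF GN_pow[OF assms, of m] GN_pow[OF assms, of n]] assms GN_carrier
    by (simp add: nat_pow_mult)
  then have "convergent (\<lambda>n. real (cl G N (y [^] n)) / real n)"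
    by (intro subadditive_limit) (auto simp flip: of_nat_add)
  then show ?thesis unfolding scl_def by (simp add: convergent_LIMSEQ_iff)
qed

lemma scl_le:
  assumes "y \<in> GN" and bound: "\<And>n::nat. real (cl G N (y [^] n)) \<le> r * real n + E"
  shows "scl G N y \<le> r"
proof -
  have "(\<lambda>n. r + E * inverse (real n)) \<longlonglongrightarrow> r + E * 0"
    by (intro tendsto_intros lim_inverse_n)
  then have "(\<lambda>n. r + E / real n) \<longlonglongrightarrow> r" by (simp add: divide_inverse)
  moreover have "real (cl G N (y [^] n)) / real n \<le> r + E / real n" if "n \<ge> 1" for n
    using bound[of n] that by (simp add: field_simps)
  ultimately show ?thesis using scl_limit[OF assms(1)] by (blast intro: LIMSEQ_le)
qed

lemma scl_le_B:
  assumes "y \<in> B k"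
  shows "scl G N y \<le> real k"
proof (rule scl_le[where E = 0])
  show "y \<in> GN" using assms B_GN by blast
  show "real (cl G N (y [^] n)) \<le> real k * real n + 0" for n :: nat
    using cl_le[OF B_pow[OF assms, of n]] by (simp flip: of_nat_mult)
qed

text \<open>The elementary half of Bavard duality: evaluate on powers and divide by the
  exponent.\<close>

lemma scl_ge_QG:
  assumes "\<nu> \<in> QG G N" "defect_le G N D \<nu>" "y \<in> GN"
  shows "\<bar>\<nu> y\<bar> \<le> 2 * D * scl G N y"
proof -
  have "(\<lambda>n. 2 * D * (real (cl G N (y [^] n)) / real n)) \<longlonglongrightarrow> 2 * D * scl G N y"
    by (intro tendsto_intros scl_limit assms)
  moreover have "\<bar>\<nu> y\<bar> \<le> 2 * D * (real (cl G N (y [^] n)) / real n)" if "n \<ge> 1" for n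
  proof -
    have "real n * \<bar>\<nu> y\<bar> = \<bar>\<nu> (y [^] n)\<bar>"
      using QG_pow[OF assms(1) GN_subset[OF assms(3)]] by (simp add: abs_mult)
    also have "\<dots> \<le> 2 * real (cl G N (y [^] n)) * D"
      by (intro QG_B assms B_cl GN_pow)
    finally show ?thesis using that by (simp add: field_simps)
  qed
  ultimately show ?thesis by (blast intro: LIMSEQ_le_const)
qed

lemma d_scl_le_apx:
  assumes "apx k a b"
  shows "d_scl G N a b \<le> real k"
  using apx_sym[OF assms] scl_le_B unfolding d_scl_def apx_def by blast

lemma QG_diff_le_d_scl:
  assumes "\<nu> \<in> QG G N" "defect_le G N D \<nu>" "x \<in> GN" "y \<in> GN"
  shows "\<bar>\<nu> x - \<nu> y\<bar> \<le> 2 * D * d_scl G N x y + D"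
proof -
  have "inv x \<otimes> y \<in> GN"
    using assms(3,4) GN_subgroup by (simp add: subgroup.m_closed subgroup.m_inv_closed)
  then have "\<bar>\<nu> (inv x \<otimes> y)\<bar> \<le> 2 * D * d_scl G N x y"
    unfolding d_scl_def by (intro scl_ge_QG assms)
  moreover have "\<bar>\<nu> (x \<otimes> (inv x \<otimes> y)) - \<nu> x - \<nu> (inv x \<otimes> y)\<bar> \<le> D"
    using assms(2) GN_subset[OF assms(3)] GN_subset[OF assms(4)] unfolding defect_le_def by blast
  moreover have "x \<otimes> (inv x \<otimes> y) = y"
    using assms(3,4) GN_carrier by (simp add: word_simps)
  ultimately show ?thesis by simp
qed

end

section \<open>A Hahn-Banach theorem for groups\<close>

text \<open>Serves both as the choice of value in a one-step Hahn-Banach extension and as the choice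
  of the slope of a quasi-additive map on the integers.\<close>

lemma real_between:
  fixes Lo Up :: "real set"
  assumes "\<And>l u. l \<in> Lo \<Longrightarrow> u \<in> Up \<Longrightarrow> l \<le> u" and "Lo = {} \<longleftrightarrow> Up = {}"
  obtains s where "\<And>l. l \<in> Lo \<Longrightarrow> l \<le> s" "\<And>u. u \<in> Up \<Longrightarrow> s \<le> u"
proof (cases "Lo = {}")
  case False
  with assms obtain u where "u \<in> Up" by blast
  then have "bdd_above Lo" using assms(1) by (meson bdd_aboveI)
  show ?thesis
  proof (rule that[of "Sup Lo"])
    show "l \<le> Sup Lo" if "l \<in> Lo" for l
      using cSup_upper[OF that \<open>bdd_above Lo\<close>] .
    show "Sup Lo \<le> v" if "v \<in> Up" for v
      using False assms(1) that by (intro cSup_least) auto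
  qed
qed (use assms in auto)

text \<open>In the application \<open>S\<close> consists of the sequences in \<open>N\<close>,
  \<open>A\<close> of those of linear and \<open>Z\<close> of those of bounded commutator length.
  \<open>P\<close> is a growth rate, meaningful on \<open>A\<close> only, which is why sublinearity
  and domination refer to \<open>A\<close> while the functional is wanted on all of
  \<open>S\<close>.\<close>

locale dominated_extension = group S for S (structure) +
  fixes A Z :: "'a set" and P :: "'a \<Rightarrow> real"
  assumes A_subgroup: "subgroup A S" and Z_subgroup: "subgroup Z S" and Z_subset: "Z \<subseteq> A"
    and comm_Z: "\<lbrakk>x \<in> carrier S; y \<in> carrier S\<rbrakk> \<Longrightarrow> x \<otimes> y \<otimes> inv x \<otimes> inv y \<in> Z"
    and P_mult: "\<lbrakk>a \<in> A; b \<in> A\<rbrakk> \<Longrightarrow> P (a \<otimes> b) \<le> P a + P b"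
    and P_Z: "z \<in> Z \<Longrightarrow> P z \<le> 0"
begin

text \<open>Partial homomorphisms dominated by \<open>P\<close> are represented by their graphs. All of them contain
  \<open>Z \<times> {0}\<close>, so they are homomorphisms on a subgroup of the abelian group \<open>S/Z\<close>.\<close>

definition dominated :: "('a \<times> real) set \<Rightarrow> bool" where
  "dominated \<Gamma> \<longleftrightarrow>
     (\<forall>a r. (a, r) \<in> \<Gamma> \<longrightarrow> a \<in> carrier S \<and> (inv a, - r) \<in> \<Gamma> \<and> (a \<in> A \<longrightarrow> r \<le> P a))
     \<and> (\<forall>a r b s. (a, r) \<in> \<Gamma> \<longrightarrow> (b, s) \<in> \<Gamma> \<longrightarrow> (a \<otimes> b, r + s) \<in> \<Gamma>)
     \<and> (\<forall>z\<in>Z. (z, 0) \<in> \<Gamma>)"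

lemma dominatedD:
  assumes "dominated \<Gamma>" "(a, r) \<in> \<Gamma>"
  shows "a \<in> carrier S" "(inv a, - r) \<in> \<Gamma>" "a \<in> A \<Longrightarrow> r \<le> P a"
    and "(b, s) \<in> \<Gamma> \<Longrightarrow> (a \<otimes> b, r + s) \<in> \<Gamma>"
  using assms unfolding dominated_def by blast+

lemma dominated_Z: "dominated \<Gamma> \<Longrightarrow> z \<in> Z \<Longrightarrow> (z, 0) \<in> \<Gamma>"
  unfolding dominated_def by blast

lemma Z_carrier: "z \<in> Z \<Longrightarrow> z \<in> carrier S"
  using Z_subgroup by (rule subgroup.mem_carrier)

lemma P_one: "P \<one> = 0"
proof -
  have "\<one> \<in> A" using A_subgroup by (rule subgroup.one_closed)
  then have "0 \<le> P \<one>" using P_mult[of \<one> \<one>] by simp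
  with P_Z[OF subgroup.one_closed[OF Z_subgroup]] show ?thesis by simp
qed

lemma P_pow: "x \<in> A \<Longrightarrow> P (x [^] (n::nat)) \<le> real n * P x"
proof (induction n)
  case 0 then show ?case by (simp add: P_one)
next
  case (Suc n)
  have "x [^] n \<in> A"
    using Suc.prems A_subgroup by (induction n) (auto intro: subgroup.one_closed subgroup.m_closed)
  with Suc P_mult[of "x [^] n" x] show ?case by (simp add: algebra_simps)
qed

lemma A_pow: "x \<in> A \<Longrightarrow> x [^] (n::nat) \<in> A"
  using A_subgroup by (induction n) (auto intro: subgroup.one_closed subgroup.m_closed)

text \<open>Single-valuedness need not be built into \<open>dominated\<close>: two values at one
  point put their difference at the identity, where \<open>P\<close> vanishes.\<close>

lemma dominated_unique:
  assumes "dominated \<Gamma>" "(a, r) \<in> \<Gamma>" "(a, s) \<in> \<Gamma>"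
  shows "r = s"
proof -
  have "r' \<le> s'" if "(a, r') \<in> \<Gamma>" "(a, s') \<in> \<Gamma>" for r' s'
  proof -
    have "(a \<otimes> inv a, r' + - s') \<in> \<Gamma>"
      using dominatedD[OF assms(1)] that by blast
    then have "(\<one>, r' - s') \<in> \<Gamma>"
      using dominatedD(1)[OF assms(1) that(1)] by simp
    then have "r' - s' \<le> P \<one>"
      using dominatedD(3)[OF assms(1)] subgroup.one_closed[OF A_subgroup] by blast
    then show ?thesis by (simp add: P_one)
  qed
  with assms(2,3) show ?thesis by (meson order_antisym)
qed

lemma dominated_trivial: "dominated (Z \<times> {0})"
  unfolding dominated_def
proof (intro conjI allI impI ballI)
  fix a b :: 'a and r s :: real
  assume "(a, r) \<in> Z \<times> {0}"
  then have a: "a \<in> Z" "r = 0" by auto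
  show "a \<in> carrier S" using a Z_carrier by blast
  show "(inv a, - r) \<in> Z \<times> {0}" using a subgroup.m_inv_closed[OF Z_subgroup] by simp
  show "(a \<otimes> b, r + s) \<in> Z \<times> {0}" if "(b, s) \<in> Z \<times> {0}"
    using a that subgroup.m_closed[OF Z_subgroup] by auto
  \<comment> \<open>On \<open>Z\<close> the function \<open>P\<close> is assumed nonpositive;
    subadditivity applied to an element of \<open>Z\<close> and its inverse gives nonnegativity, as
    domination of the value 0 demands.\<close>
  have "P \<one> \<le> P a + P (inv a)"
    using P_mult[of a "inv a"] a Z_subset Z_carrier[of a] subgroup.m_inv_closed[OF Z_subgroup] by auto
  then show "r \<le> P a" if "a \<in> A"
    using a P_one P_Z[of "inv a"] subgroup.m_inv_closed[OF Z_subgroup] by force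
qed auto

text \<open>The exponent \<open>k\<close> is kept as a parameter because \<open>x\<close> may have
  several such representations; the combination of \<open>r\<close> and \<open>k\<close> depends on
  \<open>x\<close> alone only after a suitable value at \<open>z\<close> has been chosen.\<close>

definition adjoin :: "('a \<times> real) set \<Rightarrow> 'a \<Rightarrow> 'a \<Rightarrow> real \<Rightarrow> int \<Rightarrow> bool" where
  "adjoin \<Gamma> z x r k \<longleftrightarrow> (\<exists>a. (a, r) \<in> \<Gamma> \<and> x = a \<otimes> z [^] k)"

context
  fixes \<Gamma> z
  assumes \<Gamma>: "dominated \<Gamma>" and z: "z \<in> carrier S"
begin

lemma adjoin_carrier: "adjoin \<Gamma> z x r k \<Longrightarrow> x \<in> carrier S"
  using dominatedD(1)[OF \<Gamma>] z unfolding adjoin_def by auto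

lemma adjoin_zero: "adjoin \<Gamma> z x r 0 \<longleftrightarrow> (x, r) \<in> \<Gamma>"
  using dominatedD(1)[OF \<Gamma>] unfolding adjoin_def by auto

lemma adjoin_mult:
  assumes "adjoin \<Gamma> z x r k" "adjoin \<Gamma> z x' r' k'"
  shows "adjoin \<Gamma> z (x \<otimes> x') (r + r') (k + k')"
proof -
  obtain a b where a: "(a, r) \<in> \<Gamma>" "x = a \<otimes> z [^] k" and b: "(b, r') \<in> \<Gamma>" "x' = b \<otimes> z [^] k'"
    using assms unfolding adjoin_def by blast
  have c: "a \<in> carrier S" "b \<in> carrier S" using a b dominatedD(1)[OF \<Gamma>] by auto
  \<comment> \<open>The price of moving the power of \<open>z\<close> past \<open>b\<close>. It lies
    in \<open>Z\<close>, so it can be absorbed into the domain of \<open>\<Gamma>\<close> with value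
    0.\<close>
  define \<zeta> where "\<zeta> = inv b \<otimes> z [^] k \<otimes> inv (inv b) \<otimes> inv (z [^] k)"
  have "\<zeta> \<in> Z" unfolding \<zeta>_def using c z by (intro comm_Z) auto
  then have "(a \<otimes> (b \<otimes> \<zeta>), r + (r' + 0)) \<in> \<Gamma>"
    using a b dominatedD(4)[OF \<Gamma>] dominated_Z[OF \<Gamma>] by blast
  moreover have "x \<otimes> x' = (a \<otimes> (b \<otimes> \<zeta>)) \<otimes> z [^] (k + k')"
    using c z unfolding a b \<zeta>_def by (simp add: word_simps int_pow_mult)
  ultimately show ?thesis unfolding adjoin_def by auto
qed

lemma adjoin_inv:
  assumes "adjoin \<Gamma> z x r k"
  shows "adjoin \<Gamma> z (inv x) (- r) (- k)"
proof -
  obtain a where a: "(a, r) \<in> \<Gamma>" "x = a \<otimes> z [^] k" using assms unfolding adjoin_def by blast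
  have "(\<one>, 0) \<in> \<Gamma>" using dominated_Z[OF \<Gamma>] subgroup.one_closed[OF Z_subgroup] by blast
  then have "adjoin \<Gamma> z (\<one> \<otimes> z [^] (- k)) 0 (- k)" unfolding adjoin_def by blast
  moreover have "adjoin \<Gamma> z (inv a) (- r) 0"
    using dominatedD(2)[OF \<Gamma> a(1)] by (simp add: adjoin_zero)
  ultimately have "adjoin \<Gamma> z ((\<one> \<otimes> z [^] (- k)) \<otimes> inv a) (0 + - r) (- k + 0)"
    by (rule adjoin_mult)
  moreover have "inv x = (\<one> \<otimes> z [^] (- k)) \<otimes> inv a"
    using a z dominatedD(1)[OF \<Gamma> a(1)] by (simp add: inv_mult_group int_pow_neg)
  ultimately show ?thesis by simp
qed

lemma adjoin_pow:
  "adjoin \<Gamma> z x r k \<Longrightarrow> adjoin \<Gamma> z (x [^] (n::nat)) (real n * r) (int n * k)"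
proof (induction n)
  case 0
  then show ?case
    using dominated_Z[OF \<Gamma>] subgroup.one_closed[OF Z_subgroup] by (simp add: adjoin_zero)
next
  case (Suc n)
  then have "adjoin \<Gamma> z (x [^] n \<otimes> x) (real n * r + r) (int n * k + k)"
    by (intro adjoin_mult) auto
  then show ?case by (simp add: algebra_simps)
qed

lemma exists_dominated_value:
  obtains s where "\<And>x r k. adjoin \<Gamma> z x r k \<Longrightarrow> x \<in> A \<Longrightarrow> r + real_of_int k * s \<le> P x"
proof -
  define Up where "Up = {(P x - r) / real n | x r n. adjoin \<Gamma> z x r (int n) \<and> x \<in> A \<and> n > 0}"
  define Lo where "Lo = {(r - P x) / real n | x r n. adjoin \<Gamma> z x r (- int n) \<and> x \<in> A \<and> n > 0}"
  have "l \<le> u" if l: "l \<in> Lo" and u: "u \<in> Up" for l u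
  proof -
    obtain x r m where x: "l = (r - P x) / real m" "adjoin \<Gamma> z x r (- int m)" "x \<in> A" "m > 0"
      using l unfolding Lo_def by blast
    obtain y s n where y: "u = (P y - s) / real n" "adjoin \<Gamma> z y s (int n)" "y \<in> A" "n > 0"
      using u unfolding Up_def by blast
    have "adjoin \<Gamma> z (x [^] n \<otimes> y [^] m) (real n * r + real m * s) (int n * (- int m) + int m * int n)"
      by (intro adjoin_mult adjoin_pow x y)
    then have "(x [^] n \<otimes> y [^] m, real n * r + real m * s) \<in> \<Gamma>"
      by (simp add: adjoin_zero)
    then have "real n * r + real m * s \<le> P (x [^] n \<otimes> y [^] m)"
      using dominatedD(3)[OF \<Gamma>] A_pow x y subgroup.m_closed[OF A_subgroup] by blast
    also have "\<dots> \<le> real n * P x + real m * P y"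
      using P_mult[OF A_pow[OF x(3)] A_pow[OF y(3)]] P_pow[OF x(3)] P_pow[OF y(3)]
      by (meson add_mono order_trans)
    finally show ?thesis unfolding x(1) y(1) using x(4) y(4) by (simp add: field_simps)
  qed
  \<comment> \<open>Both sets may be empty, as the elements obtained by adjoining \<open>z\<close>
    need not meet \<open>A\<close>. Inversion exchanges the two kinds of constraints, so one set
    cannot be empty alone.\<close>
  moreover have "Lo = {} \<longleftrightarrow> Up = {}"
  proof -
    have "Lo \<noteq> {}" if "u \<in> Up" for u
    proof -
      obtain x r n where "adjoin \<Gamma> z x r (int n)" "x \<in> A" "n > 0"
        using \<open>u \<in> Up\<close> unfolding Up_def by blast
      then have "(- r - P (inv x)) / real n \<in> Lo"
        using adjoin_inv subgroup.m_inv_closed[OF A_subgroup] unfolding Lo_def by blast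
      then show ?thesis by blast
    qed
    moreover have "Up \<noteq> {}" if "l \<in> Lo" for l
    proof -
      obtain x r n where x: "adjoin \<Gamma> z x r (- int n)" "x \<in> A" "n > 0"
        using \<open>l \<in> Lo\<close> unfolding Lo_def by blast
      then have "adjoin \<Gamma> z (inv x) (- r) (int n)" using adjoin_inv[OF x(1)] by simp
      then have "(P (inv x) - - r) / real n \<in> Up"
        using x subgroup.m_inv_closed[OF A_subgroup] unfolding Up_def by blast
      then show ?thesis by blast
    qed
    ultimately show ?thesis by blast
  qed
  ultimately obtain s where s: "\<And>l. l \<in> Lo \<Longrightarrow> l \<le> s" "\<And>u. u \<in> Up \<Longrightarrow> s \<le> u"
    using real_between by metis
  show ?thesis
  proof (rule that[of s])
    fix x r k assume x: "adjoin \<Gamma> z x r k" "x \<in> A"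
    consider "k = 0" | n where "k = int n" "n > 0" | n where "k = - int n" "n > 0"
      by (cases k rule: int_cases2) auto
    then show "r + real_of_int k * s \<le> P x"
    proof cases
      case 1
      then show ?thesis using x adjoin_zero dominatedD(3)[OF \<Gamma>] by auto
    next
      case 2
      then have "(P x - r) / real n \<in> Up" using x unfolding Up_def by blast
      then have "s \<le> (P x - r) / real n" by (rule s(2))
      then show ?thesis using 2 by (simp add: field_simps)
    next
      case 3
      then have "(r - P x) / real n \<in> Lo" using x unfolding Lo_def by blast
      then have "(r - P x) / real n \<le> s" by (rule s(1))
      then show ?thesis using 3 by (simp add: field_simps)
    qed
  qed
qed

lemma dominated_adjoin:
  assumes s: "\<And>x r k. adjoin \<Gamma> z x r k \<Longrightarrow> x \<in> A \<Longrightarrow> r + real_of_int k * s \<le> P x"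
  obtains \<Gamma>' where "dominated \<Gamma>'" "\<Gamma> \<subseteq> \<Gamma>'" "(z, s) \<in> \<Gamma>'"
proof
  let ?\<Gamma>' = "{(x, r + real_of_int k * s) | x r k. adjoin \<Gamma> z x r k}"
  show "\<Gamma> \<subseteq> ?\<Gamma>'"
    using adjoin_zero by force
  have "(\<one>, 0) \<in> \<Gamma>" using dominated_Z[OF \<Gamma>] subgroup.one_closed[OF Z_subgroup] by blast
  then have "adjoin \<Gamma> z z 0 1" unfolding adjoin_def using z by (intro exI[of _ \<one>]) simp
  then show "(z, s) \<in> ?\<Gamma>'" by force
  show "dominated ?\<Gamma>'"
    unfolding dominated_def
  proof (intro conjI allI impI ballI)
    fix x t assume "(x, t) \<in> ?\<Gamma>'"
    then obtain r k where x: "adjoin \<Gamma> z x r k" "t = r + real_of_int k * s" by blast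
    show "x \<in> carrier S" using x adjoin_carrier by blast
    have "- t = - r + real_of_int (- k) * s" using x by simp
    then show "(inv x, - t) \<in> ?\<Gamma>'" using adjoin_inv[OF x(1)] by blast
    show "t \<le> P x" if "x \<in> A" using s x that by blast
    show "(x \<otimes> y, t + t') \<in> ?\<Gamma>'" if "(y, t') \<in> ?\<Gamma>'" for y t'
    proof -
      obtain r' k' where y: "adjoin \<Gamma> z y r' k'" "t' = r' + real_of_int k' * s" using \<open>(y, t') \<in> ?\<Gamma>'\<close> by blast
      have "t + t' = (r + r') + real_of_int (k + k') * s" using x y by (simp add: algebra_simps)
      then show ?thesis using adjoin_mult[OF x(1) y(1)] by blast
    qed
  next
    fix \<zeta> assume "\<zeta> \<in> Z"
    then show "(\<zeta>, 0) \<in> ?\<Gamma>'" using dominated_Z[OF \<Gamma>] \<open>\<Gamma> \<subseteq> ?\<Gamma>'\<close> by blast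
  qed
qed

end

text \<open>Zorn's lemma on dominated graphs: in a maximal one every element has a value, since a
  missing one could be adjoined.\<close>

lemma dominated_total:
  assumes "dominated \<Gamma>"
  obtains F where "\<And>a r. (a, r) \<in> \<Gamma> \<Longrightarrow> F a = r"
    and "\<And>a b. \<lbrakk>a \<in> carrier S; b \<in> carrier S\<rbrakk> \<Longrightarrow> F (a \<otimes> b) = F a + (F b :: real)"
    and "\<And>a. a \<in> A \<Longrightarrow> F a \<le> P a"
proof -
  define \<A> where "\<A> = {\<Delta>. dominated \<Delta> \<and> \<Gamma> \<subseteq> \<Delta>}"
  have "\<exists>M\<in>\<A>. \<forall>X\<in>\<A>. M \<subseteq> X \<longrightarrow> X = M"
  proof (rule subset_Zorn_nonempty)
    show "\<A> \<noteq> {}" using assms unfolding \<A>_def by blast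
    fix \<C> assume C: "\<C> \<noteq> {}" "subset.chain \<A> \<C>"
    then have dom: "dominated \<Delta>" "\<Gamma> \<subseteq> \<Delta>" if "\<Delta> \<in> \<C>" for \<Delta>
      using that unfolding \<A>_def subset.chain_def by auto
    have "dominated (\<Union>\<C>)"
      unfolding dominated_def
    proof (intro conjI allI impI ballI)
      fix a r assume "(a, r) \<in> \<Union>\<C>"
      then obtain \<Delta> where \<Delta>: "\<Delta> \<in> \<C>" "(a, r) \<in> \<Delta>" by blast
      note D = dominatedD[OF dom(1)[OF \<Delta>(1)] \<Delta>(2)]
      show "a \<in> carrier S" using D by blast
      show "(inv a, - r) \<in> \<Union>\<C>" using D \<Delta> by blast
      show "r \<le> P a" if "a \<in> A" using D that by blast
      show "(a \<otimes> b, r + s) \<in> \<Union>\<C>" if bs: "(b, s) \<in> \<Union>\<C>" for b s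
      proof -
        obtain \<Delta>' where \<Delta>': "\<Delta>' \<in> \<C>" "(b, s) \<in> \<Delta>'" using bs by blast
        have "\<Delta> \<subseteq> \<Delta>' \<or> \<Delta>' \<subseteq> \<Delta>"
          using C(2) \<Delta>(1) \<Delta>'(1) unfolding subset.chain_def by blast
        then obtain \<Delta>'' where "\<Delta>'' \<in> \<C>" "(a, r) \<in> \<Delta>''" "(b, s) \<in> \<Delta>''"
          using \<Delta> \<Delta>' by blast
        then show ?thesis using dominatedD(4)[OF dom(1)] by blast
      qed
    next
      fix z assume "z \<in> Z"
      then show "(z, 0) \<in> \<Union>\<C>" using C(1) dom(1) dominated_Z by blast
    qed
    then show "\<Union>\<C> \<in> \<A>" using C(1) dom(2) unfolding \<A>_def by blast
  qed
  then obtain M where "M \<in> \<A>" and M_max: "\<forall>X\<in>\<A>. M \<subseteq> X \<longrightarrow> X = M" by blast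
  then have M: "dominated M" "\<Gamma> \<subseteq> M" unfolding \<A>_def by auto
  have max: "X = M" if "dominated X" "M \<subseteq> X" for X
    using M_max M(2) that unfolding \<A>_def by blast
  have total: "\<exists>r. (z, r) \<in> M" if z: "z \<in> carrier S" for z
  proof -
    obtain s where "\<And>x r k. adjoin M z x r k \<Longrightarrow> x \<in> A \<Longrightarrow> r + real_of_int k * s \<le> P x"
      using exists_dominated_value[OF M(1) z] by metis
    then obtain M' where "dominated M'" "M \<subseteq> M'" "(z, s) \<in> M'"
      using dominated_adjoin[OF M(1) z] by metis
    with max[of M'] show ?thesis by blast
  qed
  define F where "F a = (THE r. (a, r) \<in> M)" for a
  have F_eq: "F a = r" if "(a, r) \<in> M" for a r
    unfolding F_def using that dominated_unique[OF M(1)] by blast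
  have F_mem: "(a, F a) \<in> M" if "a \<in> carrier S" for a
    using total[OF that] F_eq by auto
  show ?thesis
  proof (rule that[of F])
    show "F a = r" if "(a, r) \<in> \<Gamma>" for a r using that F_eq M(2) by blast
    show "F (a \<otimes> b) = F a + F b" if "a \<in> carrier S" "b \<in> carrier S" for a b
      using F_eq dominatedD(4)[OF M(1) F_mem[OF that(1)] F_mem[OF that(2)]] by blast
    show "F a \<le> P a" if "a \<in> A" for a
      using dominatedD(3)[OF M(1) F_mem] that subgroup.mem_carrier[OF A_subgroup] by blast
  qed
qed

lemma P_mult_Z: "\<zeta> \<in> Z \<Longrightarrow> a \<in> A \<Longrightarrow> P a \<le> P (\<zeta> \<otimes> a)"
proof -
  assume \<zeta>: "\<zeta> \<in> Z" and a: "a \<in> A"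
  have "inv \<zeta> \<in> Z" "\<zeta> \<otimes> a \<in> A"
    using \<zeta> a Z_subset subgroup.m_inv_closed[OF Z_subgroup] subgroup.m_closed[OF A_subgroup] by auto
  then have "P (inv \<zeta> \<otimes> (\<zeta> \<otimes> a)) \<le> P (inv \<zeta>) + P (\<zeta> \<otimes> a)"
    using Z_subset by (intro P_mult) auto
  moreover have "inv \<zeta> \<otimes> (\<zeta> \<otimes> a) = a"
    using \<zeta> a Z_carrier subgroup.mem_carrier[OF A_subgroup] by (simp add: word_simps)
  ultimately show ?thesis using P_Z[OF \<open>inv \<zeta> \<in> Z\<close>] by simp
qed

text \<open>The starting graph is the trivial one with \<open>z\<close> adjoined at value
  \<open>s\<close>; the hypothesis over all integers \<open>k\<close>, negative ones included, says
  that it is dominated.\<close>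

theorem hahn_banach:
  assumes z: "z \<in> A" and s: "\<And>k::int. real_of_int k * s \<le> P (z [^] k)"
  obtains F where "F z = s"
    and "\<And>a b. \<lbrakk>a \<in> carrier S; b \<in> carrier S\<rbrakk> \<Longrightarrow> F (a \<otimes> b) = F a + (F b :: real)"
    and "\<And>a. a \<in> A \<Longrightarrow> F a \<le> P a"
proof -
  have zc: "z \<in> carrier S" using z subgroup.mem_carrier[OF A_subgroup] by blast
  have "r + real_of_int k * s \<le> P x" if xrk: "adjoin (Z \<times> {0}) z x r k" for x r k
  proof -
    obtain \<zeta> where \<zeta>: "\<zeta> \<in> Z" "r = 0" "x = \<zeta> \<otimes> z [^] k"
      using xrk unfolding adjoin_def by blast
    have "P (z [^] k) \<le> P (\<zeta> \<otimes> z [^] k)"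
      by (intro P_mult_Z \<zeta> subgroup_int_pow_closed A_subgroup z)
    then show ?thesis using \<zeta> s[of k] by simp
  qed
  then obtain \<Gamma> where \<Gamma>: "dominated \<Gamma>" "(z, s) \<in> \<Gamma>"
    using dominated_adjoin[OF dominated_trivial zc] by metis
  then show ?thesis using dominated_total[OF \<Gamma>(1)] that by metis
qed

end

section \<open>Bavard duality and extension of quasimorphisms\<close>

definition seq_group :: "('a,'b) monoid_scheme \<Rightarrow> 'a set \<Rightarrow> (nat \<Rightarrow> 'a) monoid" where
  "seq_group G N = \<lparr>carrier = {a. \<forall>m. a m \<in> N}, mult = (\<lambda>a b m. a m \<otimes>\<^bsub>G\<^esub> b m), one = (\<lambda>m. \<one>\<^bsub>G\<^esub>)\<rparr>"

lemma seq_group_simps [simp]: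
  "a \<in> carrier (seq_group G N) \<longleftrightarrow> (\<forall>m. a m \<in> N)"
  "a \<otimes>\<^bsub>seq_group G N\<^esub> b = (\<lambda>m. a m \<otimes>\<^bsub>G\<^esub> b m)"
  "\<one>\<^bsub>seq_group G N\<^esub> = (\<lambda>m. \<one>\<^bsub>G\<^esub>)"
  unfolding seq_group_def by auto

definition growth_bound :: "('a \<Rightarrow> real) \<Rightarrow> (nat \<Rightarrow> 'a) \<Rightarrow> real \<Rightarrow> bool" where
  "growth_bound u a r \<longleftrightarrow> (\<exists>E. \<forall>m. u (a m) \<le> r * real m + E)"

text \<open>This is the upper limit of \<open>u (a m) / m\<close>, written so that additive
  constants drop out at once. \<open>Inf\<close> is meaningful on \<open>linear_seqs\<close>, where
  bounds exist and are bounded below.\<close>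

definition growth :: "('a \<Rightarrow> real) \<Rightarrow> (nat \<Rightarrow> 'a) \<Rightarrow> real" where
  "growth u a = Inf (Collect (growth_bound u a))"

section \<open>Sequences of linear and of bounded commutator length\<close>

context normal_words
begin

lemma group_seq_group: "group (seq_group G N)"
proof (rule groupI)
  fix x y assume "x \<in> carrier (seq_group G N)" "y \<in> carrier (seq_group G N)"
  then show "x \<otimes>\<^bsub>seq_group G N\<^esub> y \<in> carrier (seq_group G N)" by simp
next
  show "\<one>\<^bsub>seq_group G N\<^esub> \<in> carrier (seq_group G N)" by simp
next
  fix x y z assume "x \<in> carrier (seq_group G N)" "y \<in> carrier (seq_group G N)"
    "z \<in> carrier (seq_group G N)"
  then show "x \<otimes>\<^bsub>seq_group G N\<^esub> y \<otimes>\<^bsub>seq_group G N\<^esub> z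
      = x \<otimes>\<^bsub>seq_group G N\<^esub> (y \<otimes>\<^bsub>seq_group G N\<^esub> z)"
    using N_carrier by (simp add: m_assoc)
next
  fix x assume x: "x \<in> carrier (seq_group G N)"
  then show "\<one>\<^bsub>seq_group G N\<^esub> \<otimes>\<^bsub>seq_group G N\<^esub> x = x"
    using N_carrier by simp
  show "\<exists>y\<in>carrier (seq_group G N). y \<otimes>\<^bsub>seq_group G N\<^esub> x = \<one>\<^bsub>seq_group G N\<^esub>"
    using x N_carrier by (intro bexI[of _ "\<lambda>m. inv (x m)"]) auto
qed

lemma seq_group_inv:
  assumes "\<And>m. a m \<in> N"
  shows "inv\<^bsub>seq_group G N\<^esub> a = (\<lambda>m. inv (a m))"
  using assms N_carrier by (intro group.inv_equality[OF group_seq_group]) auto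

lemma seq_group_pow: "a [^]\<^bsub>seq_group G N\<^esub> (n::nat) = (\<lambda>m. a m [^] n)"
  by (induction n) (auto simp: nat_pow_def)

text \<open>The same \<open>k\<close> serves as rate and as offset; the offset leaves room for a
  nontrivial term at \<open>m = 0\<close> and makes bounded sequences linear.\<close>

definition linear_seqs :: "(nat \<Rightarrow> 'a) set" where
  "linear_seqs = {a. \<exists>k. \<forall>m. a m \<in> B (k * m + k)}"

definition bounded_seqs :: "(nat \<Rightarrow> 'a) set" where
  "bounded_seqs = {a. \<exists>k. \<forall>m. a m \<in> B k}"

lemma linear_seqs_subgroup: "subgroup linear_seqs (seq_group G N)"
proof (rule group.subgroupI[OF group_seq_group])
  show "linear_seqs \<subseteq> carrier (seq_group G N)"
    unfolding linear_seqs_def seq_group_def using B_subset by (simp, blast)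
  have "(\<lambda>m. \<one>) \<in> linear_seqs" unfolding linear_seqs_def using B_one by blast
  then show "linear_seqs \<noteq> {}" by blast
  fix a b assume a: "a \<in> linear_seqs" and b: "b \<in> linear_seqs"
  obtain k l where k: "\<And>m. a m \<in> B (k * m + k)" and l: "\<And>m. b m \<in> B (l * m + l)"
    using a b unfolding linear_seqs_def by auto
  have "\<And>m. a m \<in> N" using k B_subset by blast
  then show "inv\<^bsub>seq_group G N\<^esub> a \<in> linear_seqs"
    using B_inv[OF k] unfolding linear_seqs_def by (simp add: seq_group_inv, blast)
  have "a m \<otimes> b m \<in> B ((k + l) * m + (k + l))" for m
    using B_mult[OF k[of m] l[of m]] by (simp add: algebra_simps)
  then show "a \<otimes>\<^bsub>seq_group G N\<^esub> b \<in> linear_seqs"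
    unfolding linear_seqs_def by auto
qed

lemma bounded_seqs_subgroup: "subgroup bounded_seqs (seq_group G N)"
proof (rule group.subgroupI[OF group_seq_group])
  show "bounded_seqs \<subseteq> carrier (seq_group G N)"
    unfolding bounded_seqs_def seq_group_def using B_subset by (simp, blast)
  have "(\<lambda>m. \<one>) \<in> bounded_seqs" unfolding bounded_seqs_def using B_one by blast
  then show "bounded_seqs \<noteq> {}" by blast
  fix a b assume a: "a \<in> bounded_seqs" and b: "b \<in> bounded_seqs"
  obtain k l where k: "\<And>m. a m \<in> B k" and l: "\<And>m. b m \<in> B l"
    using a b unfolding bounded_seqs_def by auto
  have "\<And>m. a m \<in> N" using k B_subset by blast
  then show "inv\<^bsub>seq_group G N\<^esub> a \<in> bounded_seqs"
    using B_inv[OF k] unfolding bounded_seqs_def by (simp add: seq_group_inv, blast)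
  show "a \<otimes>\<^bsub>seq_group G N\<^esub> b \<in> bounded_seqs"
    using B_mult[OF k l] unfolding bounded_seqs_def by auto
qed

lemma bounded_subset_linear: "bounded_seqs \<subseteq> linear_seqs"
proof
  fix a assume "a \<in> bounded_seqs"
  then obtain k where "\<And>m. a m \<in> B k" unfolding bounded_seqs_def by auto
  then have "\<And>m. a m \<in> B (k * m + k)" by (rule B_mono) simp
  then show "a \<in> linear_seqs" unfolding linear_seqs_def by blast
qed

text \<open>Only upper bounds on \<open>u\<close> are assumed, so that two choices are possible:
  \<open>u = cl\<close> leads to Bavard duality, and a quasimorphism on [G,N] that is bounded above
  on commutators leads to its extension to \<open>N\<close>.\<close>

context
  fixes u :: "'a \<Rightarrow> real" and C D :: real
  assumes u_mult: "\<And>a b. \<lbrakk>a \<in> GN; b \<in> GN\<rbrakk> \<Longrightarrow> u (a \<otimes> b) \<le> u a + u b + D"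
    and u_comm: "\<And>g x. \<lbrakk>g \<in> carrier G; x \<in> N\<rbrakk> \<Longrightarrow> u (commutator G g x) \<le> C"
begin

lemma u_upper: "w \<in> B k \<Longrightarrow> u w \<le> real k * (C + D) + C"
proof (induction k arbitrary: w)
  case 0
  \<comment> \<open>The identity is a commutator, so \<open>C\<close> also bounds \<open>u\<close>
    there; this is the origin of the final summand \<open>C\<close>.\<close>
  have "\<one> = commutator G \<one> \<one>" by (simp add: commutator_def)
  then show ?case using u_comm[of \<one> \<one>] 0 by simp
next
  case (Suc k)
  then obtain c v where cv: "w = c \<otimes> v" "c \<in> simple_comms G (carrier G) N" "v \<in> B k" by auto
  have "u w \<le> u c + u v + D"
    unfolding cv(1) using cv B_GN B_simple by (intro u_mult) blast+
  moreover have "u c \<le> C" using cv(2) u_comm unfolding simple_comms_def by blast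
  ultimately show ?case using Suc.IH[OF cv(3)] by (simp add: algebra_simps)
qed

text \<open>The upper bound at the inverse word becomes a lower bound by subadditivity. It keeps
  growth rates from being minus infinity.\<close>

lemma u_lower:
  assumes "w \<in> B k"
  shows "u \<one> - D - C - real k * (C + D) \<le> u w"
proof -
  have "u (w \<otimes> inv w) \<le> u w + u (inv w) + D"
    using assms B_GN B_inv by (intro u_mult) blast+
  then show ?thesis using u_upper[OF B_inv[OF assms]] B_carrier[OF assms] by simp
qed

section \<open>Sublinearity of the growth rate\<close>

lemma growth_boundI: "(\<And>m. u (a m) \<le> r * real m + E) \<Longrightarrow> growth_bound u a r"
  unfolding growth_bound_def by blast

lemma growth_bound_ge:
  assumes "\<And>m. a m \<in> B (k * m + k)" "growth_bound u a r"
  shows "- (real k * (C + D)) \<le> r"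
proof -
  obtain E where E: "\<And>m. u (a m) \<le> r * real m + E" using assms(2) unfolding growth_bound_def by blast
  show ?thesis
  proof (rule le_of_affine_bounds)
    fix m :: nat
    show "real m * - (real k * (C + D)) \<le> r * real m + (E - u \<one> + D + C + real k * (C + D))"
      using u_lower[OF assms(1)[of m]] E[of m] by (simp add: algebra_simps)
  qed
qed

lemma growth_bdd_below:
  assumes "a \<in> linear_seqs"
  shows "bdd_below (Collect (growth_bound u a))"
proof -
  obtain k where "\<And>m. a m \<in> B (k * m + k)" using assms unfolding linear_seqs_def by blast
  then show ?thesis using growth_bound_ge by (intro bdd_belowI) auto
qed

lemma growth_bound_exists:
  assumes "a \<in> linear_seqs"
  shows "\<exists>r. growth_bound u a r"
proof -
  obtain k where k: "\<And>m. a m \<in> B (k * m + k)" using assms unfolding linear_seqs_def by blast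
  have "u (a m) \<le> (real k * (C + D)) * real m + (real k * (C + D) + C)" for m
    using u_upper[OF k[of m]] by (simp add: algebra_simps)
  then show ?thesis using growth_boundI by blast
qed

lemma growth_le: "a \<in> linear_seqs \<Longrightarrow> growth_bound u a r \<Longrightarrow> growth u a \<le> r"
  unfolding growth_def using growth_bdd_below by (intro cInf_lower) auto

lemma growth_ge:
  assumes "a \<in> linear_seqs" "\<And>r. growth_bound u a r \<Longrightarrow> s \<le> r"
  shows "s \<le> growth u a"
  unfolding growth_def using growth_bound_exists[OF assms(1)] assms(2) by (intro cInf_greatest) auto

lemma growth_mult:
  assumes a: "a \<in> linear_seqs" and b: "b \<in> linear_seqs"
  shows "growth u (a \<otimes>\<^bsub>seq_group G N\<^esub> b) \<le> growth u a + growth u b"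
proof -
  have GN: "a m \<in> GN" "b m \<in> GN" for m
    using a b B_GN unfolding linear_seqs_def by blast+
  have ab: "a \<otimes>\<^bsub>seq_group G N\<^esub> b \<in> linear_seqs"
    using subgroup.m_closed[OF linear_seqs_subgroup a b] .
  have "growth u (a \<otimes>\<^bsub>seq_group G N\<^esub> b) \<le> r + s"
    if r: "growth_bound u a r" and s: "growth_bound u b s" for r s
  proof -
    obtain E E' where E: "\<And>m. u (a m) \<le> r * real m + E" "\<And>m. u (b m) \<le> s * real m + E'"
      using r s unfolding growth_bound_def by blast
    have "u (a m \<otimes> b m) \<le> (r + s) * real m + (E + E' + D)" for m
      using u_mult[OF GN, of m m] E(1)[of m] E(2)[of m] by (simp add: algebra_simps)
    then have "growth_bound u (a \<otimes>\<^bsub>seq_group G N\<^esub> b) (r + s)"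
      by (intro growth_boundI) auto
    then show ?thesis by (rule growth_le[OF ab])
  qed
  then have "growth u (a \<otimes>\<^bsub>seq_group G N\<^esub> b) - s \<le> growth u a" if "growth_bound u b s" for s
    using that by (intro growth_ge a) (simp add: algebra_simps)
  then have "growth u (a \<otimes>\<^bsub>seq_group G N\<^esub> b) - growth u a \<le> growth u b"
    by (intro growth_ge b) (simp add: algebra_simps)
  then show ?thesis by simp
qed

lemma growth_bounded:
  assumes "a \<in> bounded_seqs"
  shows "growth u a \<le> 0"
proof -
  obtain k where k: "\<And>m. a m \<in> B k" using assms unfolding bounded_seqs_def by blast
  have "u (a m) \<le> 0 * real m + (real k * (C + D) + C)" for m
    using u_upper[OF k[of m]] by simp
  then show ?thesis using assms bounded_subset_linear by (blast intro: growth_le growth_boundI)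
qed

lemma dominated_extension_growth:
  "dominated_extension (seq_group G N) linear_seqs bounded_seqs (growth u)"
proof -
  show ?thesis
  proof (intro dominated_extension.intro dominated_extension_axioms.intro)
    show "group (seq_group G N)" by (rule group_seq_group)
    show "subgroup linear_seqs (seq_group G N)" by (rule linear_seqs_subgroup)
    show "subgroup bounded_seqs (seq_group G N)" by (rule bounded_seqs_subgroup)
    show "bounded_seqs \<subseteq> linear_seqs" by (rule bounded_subset_linear)
    fix x y assume xy: "x \<in> carrier (seq_group G N)" "y \<in> carrier (seq_group G N)"
    then have "x m \<otimes> y m \<otimes> inv (x m) \<otimes> inv (y m) \<in> B 1" for m
      using B_commutator[of "x m" "y m"] N_carrier unfolding commutator_def by simp
    then show "x \<otimes>\<^bsub>seq_group G N\<^esub> y \<otimes>\<^bsub>seq_group G N\<^esub> inv\<^bsub>seq_group G N\<^esub> x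
        \<otimes>\<^bsub>seq_group G N\<^esub> inv\<^bsub>seq_group G N\<^esub> y \<in> bounded_seqs"
      using xy by (auto simp: seq_group_inv bounded_seqs_def simp del: comm_words.simps)
  qed (fact growth_mult growth_bounded)+
qed

lemma pow_linear:
  assumes "y \<in> GN"
  shows "(\<lambda>m. y [^] m) \<in> linear_seqs"
proof -
  obtain j where "y \<in> B j" using assms GN_iff by blast
  then have "y [^] m \<in> B (j * m + j)" for m :: nat
    using B_mono[OF B_pow[of y j m], of "j * m + j"] by simp
  then show ?thesis unfolding linear_seqs_def by blast
qed

text \<open>Subadditivity gives only the opposite inequality. This one holds because, by division
  with remainder, the subsequence of exponents divisible by \<open>n\<close> already determines the
  growth along all powers of \<open>y\<close>. It is the domination hypothesis of
  \<open>hahn_banach\<close> for nonnegative exponents.\<close>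

lemma growth_pow_nat:
  assumes y: "y \<in> GN"
  shows "real n * growth u (\<lambda>m. y [^] m) \<le> growth u (\<lambda>m. (y [^] m) [^] n)"
proof -
  have lin: "(\<lambda>m. y [^] m) \<in> linear_seqs" using pow_linear[OF y] .
  have lin': "(\<lambda>m. (y [^] m) [^] n) \<in> linear_seqs"
    using pow_linear[OF GN_pow[OF y, of n]] GN_carrier[OF y] by (simp add: nat_pow_pow mult.commute)
  show ?thesis
  proof (cases "n = 0")
    case True
    have "0 \<le> r" if r: "growth_bound u (\<lambda>m::nat. \<one>) r" for r
    proof -
      obtain E where "\<And>m::nat. u \<one> \<le> r * real m + E"
        using r unfolding growth_bound_def by blast
      then have "real m * 0 \<le> r * real m + (E - u \<one>)" for m by (simp add: algebra_simps)
      then show ?thesis by (rule le_of_affine_bounds)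
    qed
    then show ?thesis using True lin' growth_ge by simp
  next
    case False
    have "growth u (\<lambda>m. y [^] m) \<le> r / real n" if r: "growth_bound u (\<lambda>m. (y [^] m) [^] n) r" for r
    proof -
      obtain E where E: "\<And>m. u ((y [^] m) [^] n) \<le> r * real m + E"
        using r unfolding growth_bound_def by blast
      define U where "U = Max ((\<lambda>j. u (y [^] j)) ` {..<n})"
      have U: "u (y [^] j) \<le> U" if "j < n" for j
        unfolding U_def using that by (intro Max_ge) auto
      \<comment> \<open>\<open>U\<close> bounds the finitely many remainder powers, and the absolute
        value of \<open>r\<close> pays for replacing the quotient \<open>q\<close> by
        \<open>M / n\<close>.\<close>
      have "u (y [^] M) \<le> (r / real n) * real M + (\<bar>r\<bar> + E + U + D)" for M
      proof -
        define q j where "q = M div n" and "j = M mod n"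
        have M: "M = q * n + j" "j < n" unfolding q_def j_def using False by auto
        have "y [^] M = (y [^] q) [^] n \<otimes> y [^] j"
          using GN_carrier[OF y] M by (simp add: nat_pow_pow nat_pow_mult)
        moreover have "u ((y [^] q) [^] n \<otimes> y [^] j) \<le> u ((y [^] q) [^] n) + u (y [^] j) + D"
          using GN_pow y by (intro u_mult) auto
        ultimately have "u (y [^] M) \<le> r * real q + E + U + D"
          using E[of q] U[OF M(2)] by simp
        moreover have "r * real q = (r / real n) * real M - r * (real j / real n)"
          using False by (simp add: M(1) field_simps)
        moreover have "- (r * (real j / real n)) \<le> \<bar>r\<bar>"
        proof -
          have "\<bar>r * (real j / real n)\<bar> \<le> \<bar>r\<bar> * 1"
            unfolding abs_mult using M(2) by (intro mult_left_mono) auto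
          then show ?thesis using abs_ge_minus_self[of "r * (real j / real n)"] by linarith
        qed
        ultimately show ?thesis by linarith
      qed
      then show ?thesis using growth_le[OF lin] growth_boundI by blast
    qed
    then have "real n * growth u (\<lambda>m. y [^] m) \<le> r" if "growth_bound u (\<lambda>m. (y [^] m) [^] n) r" for r
      using that False by (simp add: field_simps)
    then show ?thesis by (rule growth_ge[OF lin'])
  qed
qed

text \<open>The sequences modulo sequences of bounded commutator length form an abelian group, on which
  \<open>growth u\<close> is sublinear. A dominated homomorphism \<open>F\<close> on it yields the quasimorphism
  \<open>x \<mapsto> F (m \<mapsto> x^m)\<close>.\<close>

lemma exists_dominated_quasimorphism:
  assumes y: "y \<in> GN" and CD: "0 \<le> C" "0 \<le> D"
  obtains \<psi> where "\<psi> \<in> QG G N" "defect_le G N (C + D) \<psi>"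
    and "\<And>x r. x \<in> GN \<Longrightarrow> growth_bound u (\<lambda>m. x [^] m) r \<Longrightarrow> \<psi> x \<le> r"
    and "\<And>s. (\<And>r. growth_bound u (\<lambda>m. y [^] m) r \<Longrightarrow> s \<le> r) \<Longrightarrow> s \<le> \<psi> y"
proof -
  interpret S: dominated_extension "seq_group G N" linear_seqs bounded_seqs "growth u"
    by (rule dominated_extension_growth)
  let ?p = "\<lambda>x (m::nat). x [^] m"
  let ?s = "growth u (?p y)"
  have py: "?p y \<in> linear_seqs" using pow_linear[OF y] .
  have pyN: "\<And>m. ?p y m \<in> N" using y GN_subset N_pow by blast
  have "real_of_int k * ?s \<le> growth u (?p y [^]\<^bsub>seq_group G N\<^esub> k)" for k :: int
  proof (cases k rule: int_cases2)
    case (nonneg n)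
    then show ?thesis
      using growth_pow_nat[OF y, of n] by (simp add: int_pow_int seq_group_pow)
  next
    case (nonpos n)
    have c: "?p y \<in> carrier (seq_group G N)" using pyN by simp
    let ?q = "?p y [^]\<^bsub>seq_group G N\<^esub> n"
    have q: "?q \<in> linear_seqs" by (rule S.A_pow[OF py])
    then have qi: "inv\<^bsub>seq_group G N\<^esub> ?q \<in> linear_seqs"
      by (rule subgroup.m_inv_closed[OF linear_seqs_subgroup])
    \<comment> \<open>Negative exponents need only sublinearity: the growth of a power and that of
      its inverse have nonnegative sum, and the former is at most \<open>n\<close> times the growth
      of the powers of \<open>y\<close>.\<close>
    have "growth u (?q \<otimes>\<^bsub>seq_group G N\<^esub> inv\<^bsub>seq_group G N\<^esub> ?q)
        \<le> growth u ?q + growth u (inv\<^bsub>seq_group G N\<^esub> ?q)"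
      by (rule growth_mult[OF q qi])
    moreover have "?q \<otimes>\<^bsub>seq_group G N\<^esub> inv\<^bsub>seq_group G N\<^esub> ?q = \<one>\<^bsub>seq_group G N\<^esub>"
      by (intro S.r_inv S.nat_pow_closed c)
    ultimately have "0 \<le> growth u ?q + growth u (inv\<^bsub>seq_group G N\<^esub> ?q)"
      using S.P_one by simp
    moreover have "growth u ?q \<le> real n * ?s" by (rule S.P_pow[OF py])
    moreover have "?p y [^]\<^bsub>seq_group G N\<^esub> k = inv\<^bsub>seq_group G N\<^esub> ?q"
      using nonpos S.int_pow_neg_int[OF c] by simp
    ultimately show ?thesis using nonpos by simp
  qed
  then obtain F where Fy: "F (?p y) = ?s"
    and F_mult: "\<And>a b. \<lbrakk>a \<in> carrier (seq_group G N); b \<in> carrier (seq_group G N)\<rbrakk>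
        \<Longrightarrow> F (a \<otimes>\<^bsub>seq_group G N\<^esub> b) = F a + F b"
    and F_le: "\<And>a. a \<in> linear_seqs \<Longrightarrow> F a \<le> growth u a"
    using S.hahn_banach[OF py] by metis
  have F_mult': "F (\<lambda>m. a m \<otimes> b m) = F a + F b" if "\<And>m. a m \<in> N" "\<And>m. b m \<in> N" for a b
    using F_mult[of a b] that by simp
  have F_one: "F (\<lambda>m. \<one>) = 0" using F_mult'[of "\<lambda>m. \<one>" "\<lambda>m. \<one>"] by simp
  have F_inv: "F (\<lambda>m. inv (a m)) = - F a" if "\<And>m. a m \<in> N" for a
  proof -
    have "F (\<lambda>m. a m \<otimes> inv (a m)) = F a + F (\<lambda>m. inv (a m))"
      using that by (intro F_mult') auto
    moreover have "(\<lambda>m. a m \<otimes> inv (a m)) = (\<lambda>m. \<one>)" using that N_carrier by auto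
    ultimately show ?thesis using F_one by simp
  qed
  \<comment> \<open>Only the rate \<open>l\<close> of the error enters; the offset \<open>k\<close>
    is invisible to \<open>F\<close>. Rate 0 therefore yields equality.\<close>
  have F_linear: "\<bar>F a - F b\<bar> \<le> real l * (C + D)"
    if ab: "\<And>m. apx (l * m + k) (a m) (b m)" for a b k l
  proof -
    have one_side: "F a - F b \<le> real l * (C + D)" if ab: "\<And>m. apx (l * m + k) (a m) (b m)" for a b
    proof -
      let ?d = "\<lambda>m. inv (b m) \<otimes> a m"
      have abN: "\<And>m. a m \<in> N" "\<And>m. b m \<in> N" and d: "\<And>m. ?d m \<in> B (l * m + k)"
        using ab unfolding apx_def by auto
      have "\<And>m. ?d m \<in> B ((l + k) * m + (l + k))"
        by (rule B_mono[OF d]) (simp add: algebra_simps)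
      then have lin: "?d \<in> linear_seqs" unfolding linear_seqs_def by blast
      have "u (?d m) \<le> (real l * (C + D)) * real m + (real k * (C + D) + C)" for m
        using u_upper[OF d[of m]] by (simp add: algebra_simps)
      then have "F ?d \<le> real l * (C + D)"
        using F_le[OF lin] growth_le[OF lin] growth_boundI by (meson order_trans)
      moreover have "F ?d = F (\<lambda>m. inv (b m)) + F a"
        using abN by (intro F_mult') auto
      ultimately show ?thesis using F_inv[of b] abN by simp
    qed
    show ?thesis using one_side[of a b] one_side[of b a] ab apx_sym by (auto simp: abs_le_iff)
  qed
  have F_pow: "F (\<lambda>m. a m [^] n) = real n * F a" if "\<And>m. a m \<in> N" for a and n :: nat
  proof (induction n)
    case 0 then show ?case using F_one by simp
  next
    case (Suc n)
    have "F (\<lambda>m. a m [^] n \<otimes> a m) = F (\<lambda>m. a m [^] n) + F a"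
      using that N_pow by (intro F_mult') auto
    with Suc show ?case by (simp add: algebra_simps)
  qed
  define \<psi> where "\<psi> x = (if x \<in> N then F (?p x) else 0)" for x
  have defect: "\<bar>\<psi> (x \<otimes> x') - \<psi> x - \<psi> x'\<bar> \<le> C + D" if "x \<in> N" "x' \<in> N" for x x'
  proof -
    \<comment> \<open>The two sequences differ by \<open>m\<close> commutators at index
      \<open>m\<close>, that is, by rate 1.\<close>
    have "\<bar>F (\<lambda>m. x [^] m \<otimes> x' [^] m) - F (\<lambda>m. (x \<otimes> x') [^] m)\<bar> \<le> real 1 * (C + D)"
      using apx_pow_mult[OF that] by (intro F_linear[where k = 0]) simp
    moreover have "F (\<lambda>m. x [^] m \<otimes> x' [^] m) = F (?p x) + F (?p x')"
      using that N_pow by (intro F_mult') auto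
    ultimately show ?thesis using that unfolding \<psi>_def by (simp add: abs_le_iff)
  qed
  show ?thesis
  proof (rule that[of \<psi>])
    show "defect_le G N (C + D) \<psi>" unfolding defect_le_def using defect by blast
    have "\<psi> (x [^] n) = real n * \<psi> x" if x: "x \<in> N" for x and n :: nat
    proof -
      have "F (\<lambda>m. (x [^] n) [^] m) = F (\<lambda>m. (x [^] m) [^] n)"
        using N_carrier[OF x] by (simp add: nat_pow_pow mult.commute)
      then show ?thesis using F_pow[of "?p x"] x N_pow unfolding \<psi>_def by simp
    qed
    moreover have "\<psi> (g \<otimes> x \<otimes> inv g) = \<psi> x" if g: "g \<in> carrier G" and x: "x \<in> N" for g x
    proof -
      have pow: "(g \<otimes> x \<otimes> inv g) [^] m = g \<otimes> x [^] m \<otimes> inv g" for m :: nat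
        by (induction m) (use g N_carrier[OF x] in \<open>simp_all add: word_simps\<close>)
      \<comment> \<open>Conjugation costs one commutator at every index, so the rate is 0 and
        invariance is exact.\<close>
      have "\<bar>F (?p (g \<otimes> x \<otimes> inv g)) - F (?p x)\<bar> \<le> real 0 * (C + D)"
        unfolding pow using apx_conj[OF g N_pow[OF x]] by (intro F_linear[where k = 1]) simp
      then show ?thesis using g x N_conj unfolding \<psi>_def by simp
    qed
    moreover have "\<psi> x = 0" if "x \<notin> N" for x using that unfolding \<psi>_def by simp
    ultimately show "\<psi> \<in> QG G N"
      using defect
      unfolding QG_def supported_on_def quasimorphism_on_def homogeneous_on_def G_invariant_on_def
      by (intro CollectI conjI exI[of _ "C + D"] allI impI ballI) assumption+
    show "\<psi> x \<le> r" if "x \<in> GN" "growth_bound u (\<lambda>m. x [^] m) r" for x r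
      using order_trans[OF F_le[OF pow_linear[OF that(1)]] growth_le[OF pow_linear that(2)]]
        that(1) GN_subset[OF that(1)] unfolding \<psi>_def by simp
    show "s \<le> \<psi> y" if "\<And>r. growth_bound u (\<lambda>m. y [^] m) r \<Longrightarrow> s \<le> r" for s
      using growth_ge[OF py that] Fy y GN_subset unfolding \<psi>_def by simp
  qed
qed

end

text \<open>The hard half of Bavard duality: take \<open>u = cl\<close>, with \<open>C = 1\<close>
  and \<open>D = 0\<close>, so that every growth bound for the powers of \<open>y\<close> bounds
  \<open>scl\<close>. Together with \<open>scl_ge_QG\<close> this leaves a factor 2 between the two
  sides, harmless where only boundedness is at stake.\<close>

theorem bavard:
  assumes y: "y \<in> GN"
  obtains \<psi> where "\<psi> \<in> QG G N" "defect_le G N 1 \<psi>" "scl G N y \<le> \<psi> y"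
proof -
  have "real (cl G N (a \<otimes> b)) \<le> real (cl G N a) + real (cl G N b) + 0" if "a \<in> GN" "b \<in> GN" for a b
    using cl_mult[OF that] by linarith
  moreover have "real (cl G N (commutator G g x)) \<le> 1" if "g \<in> carrier G" "x \<in> N" for g x
    using cl_commutator[OF that] by simp
  ultimately obtain \<psi> where \<psi>: "\<psi> \<in> QG G N" "defect_le G N (1 + 0) \<psi>"
    and max: "\<And>s. (\<And>r. growth_bound (\<lambda>w. real (cl G N w)) (\<lambda>m. y [^] m) r \<Longrightarrow> s \<le> r) \<Longrightarrow> s \<le> \<psi> y"
    using exists_dominated_quasimorphism[of "\<lambda>w. real (cl G N w)" 0 1 y] y by (metis zero_le_one order_refl)
  have "scl G N y \<le> \<psi> y"
    by (rule max) (use scl_le[OF y] in \<open>auto simp: growth_bound_def\<close>)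
  then show ?thesis using that \<psi> by simp
qed

text \<open>Take \<open>u = \<nu>\<close>. By homogeneity its growth along the powers of
  \<open>x\<close> is \<open>\<nu> x\<close>, so domination reads
  \<open>\<psi> x \<le> \<nu> x\<close> on [G,N].\<close>

theorem extend_quasimorphism:
  assumes \<nu>: "\<nu> \<in> QG G GN" and bound: "\<And>g x. \<lbrakk>g \<in> carrier G; x \<in> N\<rbrakk> \<Longrightarrow> \<nu> (commutator G g x) \<le> C"
  obtains \<psi> where "\<psi> \<in> QG G N" "\<And>x. x \<in> GN \<Longrightarrow> \<psi> x = \<nu> x"
proof -
  interpret M: normal_words GN G
    unfolding normal_words_def by (rule GN_normal)
  obtain D where D: "defect_le G GN D \<nu>" using QG_defect[OF \<nu>] by blast
  have "\<nu> (a \<otimes> b) \<le> \<nu> a + \<nu> b + D" if "a \<in> GN" "b \<in> GN" for a b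
    using D that unfolding defect_le_def by (fastforce simp: abs_le_iff)
  moreover have "\<nu> (commutator G g x) \<le> max C 0" if "g \<in> carrier G" "x \<in> N" for g x
    using bound[OF that] by simp
  moreover have "\<one> \<in> GN" using GN_iff B_one by blast
  ultimately obtain \<psi> where \<psi>: "\<psi> \<in> QG G N"
    and le: "\<And>x r. x \<in> GN \<Longrightarrow> growth_bound \<nu> (\<lambda>m. x [^] m) r \<Longrightarrow> \<psi> x \<le> r"
    using exists_dominated_quasimorphism[of \<nu> D "max C 0" \<one>] M.defect_nonneg[OF D]
    by (metis max.cobounded2)
  have "growth_bound \<nu> (\<lambda>m. x [^] m) (\<nu> x)" if "x \<in> GN" for x
    unfolding growth_bound_def using QG_pow[OF \<nu> that] by (intro exI[of _ 0]) (simp add: mult.commute)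
  then have le': "\<psi> x \<le> \<nu> x" if "x \<in> GN" for x using le that by blast
  \<comment> \<open>Domination at the inverse gives the reverse inequality, both functions being
    odd.\<close>
  have "\<nu> x \<le> \<psi> x" if x: "x \<in> GN" for x
    using le'[of "inv x"] QG_inv[OF \<psi> GN_subset[OF x]] M.QG_inv[OF \<nu> x]
      subgroup.m_inv_closed[OF GN_subgroup x] by simp
  with le' show ?thesis using that \<psi> by (meson order_antisym)
qed

end

text \<open>The slope is found as a number separating two families of quotients, which are compared
  by evaluating \<open>a\<close> at a product in two ways; no limit is taken. The bound is
  \<open>2 * D\<close> for nonnegative arguments, and reflection to negative ones adds another
  \<open>2 * D\<close>.\<close>

lemma quasi_additive_int:
  fixes a :: "int \<Rightarrow> real"
  assumes add: "\<And>n m. \<bar>a (n + m) - a n - a m\<bar> \<le> D"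
  obtains c where "\<And>n. \<bar>a n - real_of_int n * c\<bar> \<le> 4 * D"
proof -
  have D: "0 \<le> D" using add[of 0 0] abs_ge_zero order_trans by blast
  have zero: "\<bar>a 0\<bar> \<le> D" using add[of 0 0] by simp
  have mult: "\<bar>a (int k * n) - real k * a n\<bar> \<le> (real k + 1) * D" for k n
  proof (induction k)
    case (Suc k)
    have "\<bar>a (int k * n + n) - a (int k * n) - a n\<bar> \<le> D" by (rule add)
    with Suc show ?case by (simp add: algebra_simps abs_le_iff)
  qed (use zero in simp)
  define Lo where "Lo = (\<lambda>n. (a (int n) - 2 * D) / real n) ` {1..}"
  define Up where "Up = (\<lambda>n. (a (int n) + 2 * D) / real n) ` {1..}"
  have cross: "(a (int n) - 2 * D) / real n \<le> (a (int m) + 2 * D) / real m"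
    if nm: "n \<ge> 1" "m \<ge> 1" for n m
  proof -
    have "\<bar>a (int m * int n) - real m * a (int n)\<bar> \<le> (real m + 1) * D"
      and "\<bar>a (int n * int m) - real n * a (int m)\<bar> \<le> (real n + 1) * D"
      by (rule mult)+
    then have "real m * a (int n) - real n * a (int m) \<le> (real m + 1) * D + (real n + 1) * D"
      by (simp add: mult.commute abs_le_iff)
    also have "\<dots> \<le> real m * (2 * D) + real n * (2 * D)"
      using mult_right_mono[OF _ D, of "real m + 1" "real m * 2"]
        mult_right_mono[OF _ D, of "real n + 1" "real n * 2"] nm by simp
    finally show ?thesis using nm by (simp add: field_simps)
  qed
  obtain c where c: "\<And>l. l \<in> Lo \<Longrightarrow> l \<le> c" "\<And>u. u \<in> Up \<Longrightarrow> c \<le> u"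
  proof (rule real_between[of Lo Up])
    show "l \<le> u" if "l \<in> Lo" "u \<in> Up" for l u
      using that cross unfolding Lo_def Up_def by auto
    show "Lo = {} \<longleftrightarrow> Up = {}" unfolding Lo_def Up_def by simp
  qed auto
  have nonneg_bound: "\<bar>a (int n) - real n * c\<bar> \<le> 2 * D" for n
  proof (cases "n = 0")
    case True then show ?thesis using zero D by simp
  next
    case False
    then have "(a (int n) - 2 * D) / real n \<le> c" "c \<le> (a (int n) + 2 * D) / real n"
      using c unfolding Lo_def Up_def by auto
    then show ?thesis using False by (simp add: field_simps abs_le_iff)
  qed
  show ?thesis
  proof (rule that[of c])
    fix n :: int
    show "\<bar>a n - real_of_int n * c\<bar> \<le> 4 * D"
    proof (cases n rule: int_cases2)
      case (nonneg m)
      then show ?thesis using nonneg_bound[of m] D by simp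
    next
      case (nonpos m)
      then show ?thesis using nonneg_bound[of m] add[of "int m" "- int m"] zero by (simp add: abs_le_iff)
    qed
  qed
qed

section \<open>Relators and slopes\<close>

primrec rel_word :: "('a,'b) monoid_scheme \<Rightarrow> ('a \<times> 'a) list \<Rightarrow> int \<Rightarrow> 'a" where
  "rel_word G [] n = \<one>\<^bsub>G\<^esub>"
| "rel_word G (p # r) n = commutator G (fst p) (snd p [^]\<^bsub>G\<^esub> n) \<otimes>\<^bsub>G\<^esub> rel_word G r n"

definition relators :: "('a,'b) monoid_scheme \<Rightarrow> 'a set \<Rightarrow> ('a \<times> 'a) list set" where
  "relators G L = {r. set r \<subseteq> carrier G \<times> L \<and> rel_word G r 1 = \<one>\<^bsub>G\<^esub>}"

text \<open>Kept as a relation next to \<open>slope\<close>, since it passes to sums and pullbacks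
  without any prior knowledge that a slope exists.\<close>

definition has_slope :: "('a,'b) monoid_scheme \<Rightarrow> ('a \<Rightarrow> real) \<Rightarrow> ('a \<times> 'a) list \<Rightarrow> real \<Rightarrow> bool" where
  "has_slope G \<nu> r c \<longleftrightarrow> (\<exists>D. \<forall>n. \<bar>\<nu> (rel_word G r n) - real_of_int n * c\<bar> \<le> D)"

definition slope :: "('a,'b) monoid_scheme \<Rightarrow> ('a \<Rightarrow> real) \<Rightarrow> ('a \<times> 'a) list \<Rightarrow> real" where
  "slope G \<nu> r = (THE c. has_slope G \<nu> r c)"

lemma has_slopeI: "(\<And>n. \<bar>\<nu> (rel_word G r n) - real_of_int n * c\<bar> \<le> D) \<Longrightarrow> has_slope G \<nu> r c"
  unfolding has_slope_def by blast

lemma slope_eq: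
  assumes "has_slope G \<nu> r c"
  shows "slope G \<nu> r = c"
  unfolding slope_def
proof (rule the_equality)
  fix c' assume "has_slope G \<nu> r c'"
  with assms obtain D D' where D: "\<And>n. \<bar>\<nu> (rel_word G r n) - real_of_int n * c\<bar> \<le> D"
    "\<And>n. \<bar>\<nu> (rel_word G r n) - real_of_int n * c'\<bar> \<le> D'"
    unfolding has_slope_def by blast
  have "real n * \<bar>c' - c\<bar> \<le> D + D'" for n :: nat
  proof -
    have "\<bar>real n * (c' - c)\<bar> \<le> D + D'"
      using D[of "int n"] by (simp add: algebra_simps)
    then show ?thesis by (simp add: abs_mult)
  qed
  then have "c' - c = 0" by (rule bounded_multiples_zero)
  then show "c' = c" by simp
qed (fact assms)

text \<open>The slopes \<open>m s\<close> are data and not given by \<open>slope\<close>, so that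
  summands may enter whose slope is known without membership in \<open>QG\<close>.\<close>

lemma has_slope_sum:
  assumes "\<And>s. s \<in> F \<Longrightarrow> has_slope G (f s) r (m s)"
  shows "has_slope G (\<lambda>x. \<Sum>s\<in>F. c s * f s x) r (\<Sum>s\<in>F. c s * m s)"
proof -
  obtain D where D: "\<And>s n. s \<in> F \<Longrightarrow> \<bar>f s (rel_word G r n) - real_of_int n * m s\<bar> \<le> D s"
    using assms unfolding has_slope_def by metis
  show ?thesis
  proof (rule has_slopeI)
    fix n
    have "\<bar>(\<Sum>s\<in>F. c s * f s (rel_word G r n)) - real_of_int n * (\<Sum>s\<in>F. c s * m s)\<bar>
        = \<bar>\<Sum>s\<in>F. c s * (f s (rel_word G r n) - real_of_int n * m s)\<bar>"
      by (simp add: sum_distrib_left sum_subtractf algebra_simps)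
    also have "\<dots> \<le> (\<Sum>s\<in>F. \<bar>c s * (f s (rel_word G r n) - real_of_int n * m s)\<bar>)"
      by (rule sum_abs)
    also have "\<dots> \<le> (\<Sum>s\<in>F. \<bar>c s\<bar> * D s)"
      unfolding abs_mult using D by (intro sum_mono mult_left_mono) auto
    finally show "\<bar>(\<Sum>s\<in>F. c s * f s (rel_word G r n)) - real_of_int n * (\<Sum>s\<in>F. c s * m s)\<bar>
        \<le> (\<Sum>s\<in>F. \<bar>c s\<bar> * D s)" .
  qed
qed

lemma QG_lincomb:
  assumes F: "\<And>s. s \<in> F \<Longrightarrow> f s \<in> QG G N"
  shows "(\<lambda>x. \<Sum>s\<in>F. c s * f s x) \<in> QG G N"
proof -
  have "\<forall>s\<in>F. \<exists>D. defect_le G N D (f s)" using F QG_defect by blast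
  then obtain D where D: "\<And>s. s \<in> F \<Longrightarrow> defect_le G N (D s) (f s)" by metis
  have "\<bar>(\<Sum>s\<in>F. c s * f s (x \<otimes>\<^bsub>G\<^esub> y)) - (\<Sum>s\<in>F. c s * f s x) - (\<Sum>s\<in>F. c s * f s y)\<bar>
      \<le> (\<Sum>s\<in>F. \<bar>c s\<bar> * D s)" if xy: "x \<in> N" "y \<in> N" for x y
  proof -
    have "(\<Sum>s\<in>F. c s * f s (x \<otimes>\<^bsub>G\<^esub> y)) - (\<Sum>s\<in>F. c s * f s x) - (\<Sum>s\<in>F. c s * f s y)
        = (\<Sum>s\<in>F. c s * (f s (x \<otimes>\<^bsub>G\<^esub> y) - f s x - f s y))"
      by (simp add: sum_subtractf right_diff_distrib)
    also have "\<bar>\<dots>\<bar> \<le> (\<Sum>s\<in>F. \<bar>c s * (f s (x \<otimes>\<^bsub>G\<^esub> y) - f s x - f s y)\<bar>)"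
      by (rule sum_abs)
    also have "\<dots> \<le> (\<Sum>s\<in>F. \<bar>c s\<bar> * D s)"
      unfolding abs_mult using D xy unfolding defect_le_def by (intro sum_mono mult_left_mono) auto
    finally show ?thesis .
  qed
  moreover have "(\<Sum>s\<in>F. c s * f s (x [^]\<^bsub>G\<^esub> n)) = real n * (\<Sum>s\<in>F. c s * f s x)"
    if "x \<in> N" for x and n :: nat
    unfolding sum_distrib_left by (intro sum.cong refl) (use QG_pow[OF F that] in simp)
  moreover have "(\<Sum>s\<in>F. c s * f s (g \<otimes>\<^bsub>G\<^esub> x \<otimes>\<^bsub>G\<^esub> inv\<^bsub>G\<^esub> g)) = (\<Sum>s\<in>F. c s * f s x)"
    if "g \<in> carrier G" "x \<in> N" for g x
    by (intro sum.cong refl) (use QG_conj[OF F that] in simp)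
  moreover have "(\<Sum>s\<in>F. c s * f s x) = 0" if "x \<notin> N" for x
    by (intro sum.neutral ballI) (use QG_outside[OF F that] in simp)
  ultimately show ?thesis
    unfolding QG_def supported_on_def quasimorphism_on_def homogeneous_on_def G_invariant_on_def
    by (intro CollectI conjI exI[of _ "\<Sum>s\<in>F. \<bar>c s\<bar> * D s"] allI impI ballI) assumption+
qed

text \<open>Indexing by booleans keeps the two summands apart even when they coincide.\<close>

lemma QG_add: "\<mu> \<in> QG G N \<Longrightarrow> \<nu> \<in> QG G N \<Longrightarrow> (\<lambda>x. \<mu> x + c * \<nu> x) \<in> QG G N"
  using QG_lincomb[of "{True, False}" "\<lambda>i. if i then \<mu> else \<nu>" G N "\<lambda>i. if i then 1 else c"] by simp

lemma has_slope_add: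
  "has_slope G \<mu> r a \<Longrightarrow> has_slope G \<nu> r b \<Longrightarrow> has_slope G (\<lambda>x. \<mu> x + c * \<nu> x) r (a + c * b)"
  using has_slope_sum[of "{True, False}" G "\<lambda>i. if i then \<mu> else \<nu>" r "\<lambda>i. if i then a else b"
      "\<lambda>i. if i then 1 else c"] by simp

text \<open>\<open>L\<close>, \<open>N\<close> and \<open>N.GN\<close> stand for three consecutive
  terms of the lower central series, with indices q-1, q and q+1.\<close>

locale commutator_pair = group G + L: normal_words L G for L and G (structure)
begin

abbreviation "N \<equiv> comm_subgroup G (carrier G) L"

sublocale N: normal_words N G
  unfolding normal_words_def by (rule L.GN_normal)

section \<open>Commutators of powers and their slopes\<close>

lemma L_pow: "x \<in> L \<Longrightarrow> x [^] (n::int) \<in> L"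
  by (rule subgroup_int_pow_closed[OF L.is_subgroup])

lemma commutator_N: "g \<in> carrier G \<Longrightarrow> x \<in> L \<Longrightarrow> commutator G g x \<in> N"
  using L.B_commutator L.B_GN by blast

text \<open>[g, x^(n+m)] is exactly [g, x^n] times the conjugate of [g, x^m] by x^n; undoing the
  conjugation costs one commutator with an element of \<open>N\<close>.\<close>

lemma commutator_pow_add:
  assumes g: "g \<in> carrier G" and x: "x \<in> L"
  shows "N.apx 1 (commutator G g (x [^] (n + m :: int)))
    (commutator G g (x [^] n) \<otimes> commutator G g (x [^] m))"
proof -
  have xc: "x \<in> carrier G" using x L.N_carrier by blast
  have "commutator G g (x [^] (n + m))
      = commutator G g (x [^] n) \<otimes> (x [^] n \<otimes> commutator G g (x [^] m) \<otimes> inv (x [^] n))"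
    using g xc unfolding commutator_def by (simp add: int_pow_mult word_simps)
  moreover have "N.apx (0 + 1) \<dots> (commutator G g (x [^] n) \<otimes> commutator G g (x [^] m))"
    using g x xc by (intro N.apx_mult N.apx_refl N.apx_conj commutator_N L_pow) auto
  ultimately show ?thesis by simp
qed

lemma rel_word_N: "set r \<subseteq> carrier G \<times> L \<Longrightarrow> rel_word G r n \<in> N"
  by (induction r) (auto intro!: N.subgroup_axioms[THEN subgroup.m_closed]
      N.subgroup_axioms[THEN subgroup.one_closed] commutator_N L_pow)

lemma rel_word_carrier: "set r \<subseteq> carrier G \<times> L \<Longrightarrow> rel_word G r n \<in> carrier G"
  using rel_word_N N.N_carrier by blast

text \<open>The bound does not involve \<open>n\<close>; this is the source of boundedness with
  respect to \<open>L\<close>.\<close>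

lemma rel_word_B: "set r \<subseteq> carrier G \<times> L \<Longrightarrow> rel_word G r n \<in> L.B (length r)"
proof (induction r)
  case (Cons p r)
  then have "commutator G (fst p) (snd p [^] n) \<otimes> rel_word G r n \<in> L.B (Suc 0 + length r)"
    by (intro L.B_mult L.B_commutator L_pow) auto
  then show ?case by (simp only: rel_word.simps length_Cons plus_1_eq_Suc One_nat_def[symmetric])
qed simp

text \<open>Each pair costs one commutator for splitting its power and one for interchanging
  factors.\<close>

lemma rel_word_add:
  assumes "set r \<subseteq> carrier G \<times> L"
  shows "N.apx (2 * length r) (rel_word G r (n + m)) (rel_word G r n \<otimes> rel_word G r m)"
  using assms
proof (induction r)
  case Nil
  have "\<one> \<in> N" by simp
  then show ?case by (simp add: N.apx_refl)
next
  case (Cons p r)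
  then have p: "fst p \<in> carrier G" "snd p \<in> L" and r: "set r \<subseteq> carrier G \<times> L" by auto
  let ?c = "\<lambda>n. commutator G (fst p) (snd p [^] (n::int))"
  have c: "?c k \<in> N" for k using p by (intro commutator_N L_pow)
  have "N.apx (1 + 2 * length r + 1) (?c (n + m) \<otimes> rel_word G r (n + m))
      ((?c n \<otimes> rel_word G r n) \<otimes> (?c m \<otimes> rel_word G r m))"
    by (rule N.apx_trans[OF N.apx_mult[OF commutator_pow_add[OF p] Cons.IH[OF r]] N.apx_mult4])
      (intro c rel_word_N[OF r])+
  then show ?case by simp
qed

text \<open>The words are additive up to \<open>2 * length r\<close> commutators, so the values of
  \<open>\<nu>\<close> are additive up to \<open>(4 * length r + 2) * D\<close>;
  \<open>quasi_additive_int\<close> multiplies this by 4.\<close>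

lemma slope_bound:
  assumes \<nu>: "\<nu> \<in> QG G N" "defect_le G N D \<nu>" and r: "set r \<subseteq> carrier G \<times> L"
  shows "\<bar>\<nu> (rel_word G r n) - real_of_int n * slope G \<nu> r\<bar> \<le> (16 * real (length r) + 8) * D"
proof -
  let ?w = "rel_word G r"
  have "\<bar>\<nu> (?w (n + m)) - \<nu> (?w n) - \<nu> (?w m)\<bar> \<le> (4 * real (length r) + 2) * D" for n m
  proof -
    have "\<bar>\<nu> (?w (n + m)) - \<nu> (?w n \<otimes> ?w m)\<bar> \<le> (2 * real (2 * length r) + 1) * D"
      by (rule N.QG_apx[OF \<nu> rel_word_add[OF r]])
    moreover have "\<bar>\<nu> (?w n \<otimes> ?w m) - \<nu> (?w n) - \<nu> (?w m)\<bar> \<le> D"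
      using \<nu>(2) rel_word_N[OF r] unfolding defect_le_def by blast
    ultimately show ?thesis by (simp add: algebra_simps)
  qed
  then obtain c where c: "\<And>n. \<bar>\<nu> (?w n) - real_of_int n * c\<bar> \<le> 4 * ((4 * real (length r) + 2) * D)"
    using quasi_additive_int[of "\<lambda>n. \<nu> (?w n)"] by metis
  then have "slope G \<nu> r = c" by (intro slope_eq has_slopeI)
  with c[of n] show ?thesis by (simp add: algebra_simps)
qed

lemma has_slope:
  assumes "\<nu> \<in> QG G N" and "set r \<subseteq> carrier G \<times> L"
  shows "has_slope G \<nu> r (slope G \<nu> r)"
proof -
  obtain D where "defect_le G N D \<nu>" using QG_defect[OF assms(1)] by blast
  then show ?thesis using slope_bound[OF assms(1) _ assms(2)] by (intro has_slopeI)
qed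

lemma commutator_pow_carrier:
  "g \<in> carrier G \<Longrightarrow> x \<in> L \<Longrightarrow> commutator G g (x [^] (n::int)) \<in> carrier G"
  using commutator_N[OF _ L_pow] N.N_carrier by blast

lemma rel_word_append:
  assumes r: "set r \<subseteq> carrier G \<times> L" and r': "set r' \<subseteq> carrier G \<times> L"
  shows "rel_word G (r @ r') n = rel_word G r n \<otimes> rel_word G r' n"
  using r
proof (induction r)
  case Nil then show ?case using rel_word_carrier[OF r'] by simp
next
  case (Cons p r)
  then have "commutator G (fst p) (snd p [^] n) \<in> carrier G"
    by (intro commutator_pow_carrier) auto
  then show ?case using Cons rel_word_carrier[of r] rel_word_carrier[OF r'] by (simp add: m_assoc)
qed

lemma slope_append:
  assumes \<nu>: "\<nu> \<in> QG G N" and r: "set r \<subseteq> carrier G \<times> L" and r': "set r' \<subseteq> carrier G \<times> L"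
  shows "slope G \<nu> (r @ r') = slope G \<nu> r + slope G \<nu> r'"
proof -
  obtain D where D: "defect_le G N D \<nu>" using QG_defect[OF \<nu>] by blast
  obtain E E' where E: "\<And>n. \<bar>\<nu> (rel_word G r n) - real_of_int n * slope G \<nu> r\<bar> \<le> E"
    "\<And>n. \<bar>\<nu> (rel_word G r' n) - real_of_int n * slope G \<nu> r'\<bar> \<le> E'"
    using has_slope[OF \<nu> r] has_slope[OF \<nu> r'] unfolding has_slope_def by blast
  show ?thesis
  proof (intro slope_eq has_slopeI)
    fix n
    have "\<bar>\<nu> (rel_word G r n \<otimes> rel_word G r' n) - \<nu> (rel_word G r n) - \<nu> (rel_word G r' n)\<bar> \<le> D"
      using D rel_word_N[OF r] rel_word_N[OF r'] unfolding defect_le_def by blast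
    then show "\<bar>\<nu> (rel_word G (r @ r') n) - real_of_int n * (slope G \<nu> r + slope G \<nu> r')\<bar> \<le> D + E + E'"
      unfolding rel_word_append[OF r r'] using E[of n] by (simp add: algebra_simps)
  qed
qed

text \<open>The pairs are chosen so that the word is inverted at every exponent and not only at 1,
  since the second entry of each pair is a conjugate of \<open>x\<close>. \<open>conj_list\<close>
  has the same feature; slopes are therefore odd and conjugation invariant.\<close>

definition inv_list :: "('a \<times> 'a) list \<Rightarrow> ('a \<times> 'a) list" where
  "inv_list r = rev (map (\<lambda>(g, x). (inv g, g \<otimes> x \<otimes> inv g)) r)"

definition conj_list :: "'a \<Rightarrow> ('a \<times> 'a) list \<Rightarrow> ('a \<times> 'a) list" where
  "conj_list k r = map (\<lambda>(g, x). (k \<otimes> g \<otimes> inv k, k \<otimes> x \<otimes> inv k)) r"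

lemma int_pow_conj:
  assumes "g \<in> carrier G" "x \<in> carrier G"
  shows "(g \<otimes> x \<otimes> inv g) [^] (n::int) = g \<otimes> x [^] n \<otimes> inv g"
proof -
  have nat: "(g \<otimes> x \<otimes> inv g) [^] m = g \<otimes> x [^] m \<otimes> inv g" for m :: nat
    by (induction m) (use assms in \<open>simp_all add: word_simps\<close>)
  show ?thesis
  proof (cases n rule: int_cases2)
    case (nonneg m)
    then show ?thesis using nat by (simp add: int_pow_int)
  next
    case (nonpos m)
    then show ?thesis using nat assms by (simp add: int_pow_neg_int word_simps)
  qed
qed

lemma inv_list_subset: "set r \<subseteq> carrier G \<times> L \<Longrightarrow> set (inv_list r) \<subseteq> carrier G \<times> L"
  unfolding inv_list_def using L.N_conj by auto

lemma conj_list_subset: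
  "k \<in> carrier G \<Longrightarrow> set r \<subseteq> carrier G \<times> L \<Longrightarrow> set (conj_list k r) \<subseteq> carrier G \<times> L"
  unfolding conj_list_def using L.N_conj by auto

lemma rel_word_inv_list:
  assumes "set r \<subseteq> carrier G \<times> L"
  shows "rel_word G (inv_list r) n = inv (rel_word G r n)"
  using assms
proof (induction r)
  case Nil then show ?case by (simp add: inv_list_def)
next
  case (Cons p r)
  obtain g x where p: "p = (g, x)" by (cases p)
  have gx: "g \<in> carrier G" "x \<in> L" and r: "set r \<subseteq> carrier G \<times> L" using Cons.prems p by auto
  have xc: "x \<in> carrier G" using gx L.N_carrier by blast
  have cc: "commutator G g (x [^] n) \<in> carrier G"
    using gx by (rule commutator_pow_carrier)
  let ?q = "(inv g, g \<otimes> x \<otimes> inv g)"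
  have q: "set [?q] \<subseteq> carrier G \<times> L" using gx L.N_conj by auto
  have "inv_list (p # r) = inv_list r @ [?q]" unfolding inv_list_def p by simp
  then have "rel_word G (inv_list (p # r)) n = inv (rel_word G r n) \<otimes> rel_word G [?q] n"
    using rel_word_append[OF inv_list_subset[OF r] q] Cons.IH[OF r] by simp
  also have "rel_word G [?q] n = inv (commutator G g (x [^] n))"
    using gx xc L.inv_commutator[of g "x [^] n"] rel_word_carrier[OF q, of n]
    by (simp add: int_pow_conj commutator_def)
  finally show ?case using p cc rel_word_carrier[OF r] by (simp add: inv_mult_group)
qed

lemma rel_word_conj_list:
  assumes k: "k \<in> carrier G" and "set r \<subseteq> carrier G \<times> L"
  shows "rel_word G (conj_list k r) n = k \<otimes> rel_word G r n \<otimes> inv k"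
  using assms(2)
proof (induction r)
  case Nil then show ?case using k by (simp add: conj_list_def)
next
  case (Cons p r)
  obtain g x where p: "p = (g, x)" by (cases p)
  have gx: "g \<in> carrier G" "x \<in> L" and r: "set r \<subseteq> carrier G \<times> L" using Cons.prems p by auto
  have xc: "x \<in> carrier G" using gx L.N_carrier by blast
  have "rel_word G (conj_list k (p # r)) n
      = commutator G (k \<otimes> g \<otimes> inv k) (k \<otimes> x [^] n \<otimes> inv k) \<otimes> (k \<otimes> rel_word G r n \<otimes> inv k)"
    using Cons.IH[OF r] k xc unfolding conj_list_def p by (simp add: int_pow_conj)
  also have "\<dots> = k \<otimes> (commutator G g (x [^] n) \<otimes> rel_word G r n) \<otimes> inv k"
    using k gx xc rel_word_carrier[OF r, of n] unfolding commutator_def by (simp add: word_simps)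
  finally show ?case using p by simp
qed

lemma slope_inv_list:
  assumes \<nu>: "\<nu> \<in> QG G N" and r: "set r \<subseteq> carrier G \<times> L"
  shows "slope G \<nu> (inv_list r) = - slope G \<nu> r"
proof -
  obtain E where E: "\<And>n. \<bar>\<nu> (rel_word G r n) - real_of_int n * slope G \<nu> r\<bar> \<le> E"
    using has_slope[OF \<nu> r] unfolding has_slope_def by blast
  show ?thesis
  proof (intro slope_eq has_slopeI)
    fix n
    show "\<bar>\<nu> (rel_word G (inv_list r) n) - real_of_int n * - slope G \<nu> r\<bar> \<le> E"
      using E[of n] N.QG_inv[OF \<nu> rel_word_N[OF r]] by (simp add: rel_word_inv_list[OF r] abs_le_iff)
  qed
qed

lemma slope_conj_list:
  assumes \<nu>: "\<nu> \<in> QG G N" and r: "set r \<subseteq> carrier G \<times> L" and k: "k \<in> carrier G"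
  shows "slope G \<nu> (conj_list k r) = slope G \<nu> r"
proof -
  have "has_slope G \<nu> (conj_list k r) (slope G \<nu> r)"
    using has_slope[OF \<nu> r] QG_conj[OF \<nu> k rel_word_N[OF r]]
    unfolding has_slope_def rel_word_conj_list[OF k r] by simp
  then show ?thesis by (rule slope_eq)
qed

lemma exists_rel_word:
  assumes "y \<in> N"
  obtains r where "set r \<subseteq> carrier G \<times> L" "rel_word G r 1 = y"
proof -
  have "\<exists>r. set r \<subseteq> carrier G \<times> L \<and> rel_word G r 1 = y" if "y \<in> L.B k" for k y
    using that
  proof (induction k arbitrary: y)
    case 0 then show ?case by (intro exI[of _ "[]"]) simp
  next
    case (Suc k)
    then obtain c v where cv: "y = c \<otimes> v" "c \<in> simple_comms G (carrier G) L" "v \<in> L.B k" by auto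
    then obtain g x where gx: "g \<in> carrier G" "x \<in> L" "c = commutator G g x"
      unfolding simple_comms_def by blast
    obtain r where "set r \<subseteq> carrier G \<times> L" "rel_word G r 1 = v" using Suc.IH[OF cv(3)] by blast
    then show ?case using gx cv(1) L.N_carrier by (intro exI[of _ "(g, x) # r"]) auto
  qed
  then show ?thesis using assms L.GN_iff that by blast
qed

lemma H1G_QG:
  assumes "h \<in> H1G G N"
  shows "h \<in> QG G N" "defect_le G N 0 h"
proof -
  have add: "\<And>x y. \<lbrakk>x \<in> N; y \<in> N\<rbrakk> \<Longrightarrow> h (x \<otimes> y) = h x + h y"
    using assms unfolding H1G_def by blast
  then show d: "defect_le G N 0 h" unfolding defect_le_def by simp
  have "\<one> \<in> N" by simp
  then have "h \<one> = 0" using add[of \<one> \<one>] by simp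
  then have "h (x [^] n) = real n * h x" if "x \<in> N" for x and n :: nat
    using that by (induction n) (auto simp: add N.N_pow algebra_simps)
  then show "h \<in> QG G N"
    using assms d
    unfolding QG_def H1G_def quasimorphism_on_def homogeneous_on_def defect_le_def by blast
qed

theorem slope_zero_W_denom:
  assumes \<nu>: "\<nu> \<in> QG G N" and zero: "\<And>r. r \<in> relators G L \<Longrightarrow> slope G \<nu> r = 0"
  shows "\<nu> \<in> W_denom G L N"
proof -
  define h where "h y = (if y \<in> N then slope G \<nu> (SOME r. set r \<subseteq> carrier G \<times> L \<and> rel_word G r 1 = y) else 0)"
    for y
  have h_eq: "h (rel_word G r 1) = slope G \<nu> r" if r: "set r \<subseteq> carrier G \<times> L" for r
  proof -
    define s where "s = (SOME s. set s \<subseteq> carrier G \<times> L \<and> rel_word G s 1 = rel_word G r 1)"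
    have s: "set s \<subseteq> carrier G \<times> L" "rel_word G s 1 = rel_word G r 1"
      unfolding s_def using someI[of "\<lambda>s. set s \<subseteq> carrier G \<times> L \<and> rel_word G s 1 = rel_word G r 1" r] r
      by auto
    have i: "set (inv_list r) \<subseteq> carrier G \<times> L" by (rule inv_list_subset[OF r])
    have "rel_word G (s @ inv_list r) 1 = \<one>"
      using rel_word_append[OF s(1) i] s(2) rel_word_inv_list[OF r] rel_word_carrier[OF r] by simp
    \<comment> \<open>Two words for the same element differ by a relator, whose slope vanishes by
      assumption. Hence \<open>h\<close> does not depend on the word chosen.\<close>
    then have "s @ inv_list r \<in> relators G L" using s i unfolding relators_def by simp
    then have "slope G \<nu> s = slope G \<nu> r"
      using zero slope_append[OF \<nu> s(1) i] slope_inv_list[OF \<nu> r] by simp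
    then show ?thesis using rel_word_N[OF r] unfolding h_def s_def by simp
  qed
  have "h \<in> H1G G N"
    unfolding H1G_def supported_on_def G_invariant_on_def
  proof (intro CollectI conjI allI impI ballI)
    show "h x = 0" if "x \<notin> N" for x using that unfolding h_def by simp
    fix x assume x: "x \<in> N"
    then obtain r where r: "set r \<subseteq> carrier G \<times> L" "rel_word G r 1 = x" by (rule exists_rel_word)
    show "h (x \<otimes> y) = h x + h y" if y: "y \<in> N" for y
    proof -
      obtain s where s: "set s \<subseteq> carrier G \<times> L" "rel_word G s 1 = y" using y by (rule exists_rel_word)
      then show ?thesis
        using slope_append[OF \<nu> r(1) s(1)] rel_word_append[OF r(1) s(1)] h_eq[of "r @ s"] h_eq[OF r(1)] h_eq[OF s(1)] r by simp
    qed
    show "h (g \<otimes> x \<otimes> inv g) = h x" if g: "g \<in> carrier G" for g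
      using h_eq[OF conj_list_subset[OF g r(1)]] h_eq[OF r(1)] slope_conj_list[OF \<nu> r(1) g]
        rel_word_conj_list[OF g r(1)] r(2) by simp
  qed
  obtain D where D: "defect_le G N D \<nu>" using QG_defect[OF \<nu>] by blast
  define \<nu>' where "\<nu>' = (\<lambda>x. \<nu> x + (- 1) * h x)"
  have "\<nu>' \<in> QG G N"
    unfolding \<nu>'_def by (rule QG_add[OF \<nu> H1G_QG(1)[OF \<open>h \<in> H1G G N\<close>]])
  \<comment> \<open>\<open>slope_bound\<close> for a single pair at exponent 1: the slope equals the
    value of \<open>h\<close>, and the constant is 16 + 8.\<close>
  moreover have "\<nu>' (commutator G g x) \<le> 24 * D" if "g \<in> carrier G" "x \<in> L" for g x
  proof -
    have gx: "set [(g, x)] \<subseteq> carrier G \<times> L" using that by simp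
    have "rel_word G [(g, x)] 1 = commutator G g x"
      using that L.N_carrier N.N_carrier[OF commutator_N[OF that]] by simp
    then show ?thesis
      using slope_bound[OF \<nu> D gx, of 1] h_eq[OF gx] unfolding \<nu>'_def by (simp add: abs_le_iff)
  qed
  ultimately obtain \<psi> where \<psi>: "\<psi> \<in> QG G L" "\<And>x. x \<in> N \<Longrightarrow> \<psi> x = \<nu>' x"
    using L.extend_quasimorphism by metis
  have "\<nu> = (\<lambda>x. h x + restr N \<psi> x)"
    using \<psi>(2) QG_outside[OF \<nu>] unfolding restr_def \<nu>'_def h_def by auto
  then show ?thesis
    unfolding W_denom_def set_sum_def using \<open>h \<in> H1G G N\<close> \<psi>(1) by blast
qed

text \<open>An invariant homomorphism has defect 0, so it is exactly linear along a relator and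
  vanishes at exponent 1, hence everywhere. A quasimorphism on \<open>L\<close> is bounded along it,
  the number of commutators with elements of \<open>L\<close> being fixed.\<close>

lemma W_denom_slope_zero:
  assumes "\<nu> \<in> W_denom G L N" and r: "r \<in> relators G L"
  shows "has_slope G \<nu> r 0"
proof -
  obtain h \<psi> where h: "h \<in> H1G G N" and \<psi>: "\<psi> \<in> QG G L" and \<nu>: "\<nu> = (\<lambda>x. h x + restr N \<psi> x)"
    using assms(1) unfolding W_denom_def set_sum_def by blast
  have r': "set r \<subseteq> carrier G \<times> L" and one: "rel_word G r 1 = \<one>" using r unfolding relators_def by auto
  have hs: "h (rel_word G r n) = real_of_int n * slope G h r" for n
    using slope_bound[OF H1G_QG[OF h] r', of n] by simp
  have "slope G h r = 0" using hs[of 1] one N.QG_one[OF H1G_QG(1)[OF h]] by simp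
  then have h0: "h (rel_word G r n) = 0" for n using hs by simp
  obtain D where D: "defect_le G L D \<psi>" using QG_defect[OF \<psi>] by blast
  show ?thesis
  proof (rule has_slopeI)
    fix n
    show "\<bar>\<nu> (rel_word G r n) - real_of_int n * 0\<bar> \<le> 2 * real (length r) * D"
      using L.QG_B[OF \<psi> D rel_word_B[OF r']] h0 rel_word_N[OF r'] unfolding \<nu> restr_def by simp
  qed
qed

end

section \<open>Lattices dual to quasimorphisms\<close>

definition evals :: "('s \<times> real) list \<Rightarrow> ('s \<Rightarrow> real) \<Rightarrow> real" where
  "evals xs f = (\<Sum>p\<leftarrow>xs. snd p * f (fst p))"

lemma evals_Nil [simp]: "evals [] f = 0"
  and evals_Cons [simp]: "evals (p # xs) f = snd p * f (fst p) + evals xs f"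
  and evals_append [simp]: "evals (xs @ ys) f = evals xs f + evals ys f"
  unfolding evals_def by simp_all

lemma evals_scale: "evals (map (\<lambda>p. (fst p, a * snd p)) xs) f = a * evals xs f"
  by (induction xs) (simp_all add: algebra_simps)

lemma evals_cong: "fst ` set xs \<subseteq> S \<Longrightarrow> (\<And>s. s \<in> S \<Longrightarrow> f s = g s) \<Longrightarrow> evals xs f = evals xs g"
  by (induction xs) auto

lemma evals_sum: "evals xs (\<lambda>s. \<Sum>j\<in>J. b j * g j s) = (\<Sum>j\<in>J. b j * evals xs (g j))"
  by (induction xs) (simp_all add: sum_distrib_left sum.distrib algebra_simps)

lemma evals_zero [simp]: "evals xs (\<lambda>s. 0) = 0"
  by (induction xs) simp_all

lemma evals_diff: "evals xs (\<lambda>s. f s - a * g s) = evals xs f - a * evals xs g"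
  by (induction xs) (simp_all add: algebra_simps)

text \<open>Finite dimensional duality for functions on \<open>S\<close>: what is outside the span
  of finitely many functions is detected by a finite combination of evaluations annihilating them.
  Induction on the number of functions, as in Gaussian elimination.\<close>

lemma dual_evaluation:
  fixes f :: "'s \<Rightarrow> real"
  assumes "finite J" and "\<not> (\<exists>b. \<forall>s\<in>S. f s = (\<Sum>j\<in>J. b j * g j s))"
  shows "\<exists>xs. fst ` set xs \<subseteq> S \<and> (\<forall>j\<in>J. evals xs (g j) = 0) \<and> evals xs f = 1"
  using assms
proof (induction J arbitrary: f rule: finite_induct)
  case empty
  then obtain s where "s \<in> S" "f s \<noteq> 0" by auto
  then show ?case by (intro exI[of _ "[(s, 1 / f s)]"]) simp
next
  case (insert j J)
  have span: "\<not> (\<exists>b. \<forall>s\<in>S. f s - a * g j s = (\<Sum>j\<in>J. b j * g j s))" for a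
  proof
    assume "\<exists>b. \<forall>s\<in>S. f s - a * g j s = (\<Sum>j\<in>J. b j * g j s)"
    then obtain b where b: "\<And>s. s \<in> S \<Longrightarrow> f s - a * g j s = (\<Sum>j\<in>J. b j * g j s)" by blast
    have "f s = (\<Sum>i\<in>insert j J. (b(j := a)) i * g i s)" if "s \<in> S" for s
    proof -
      have "(\<Sum>i\<in>J. (b(j := a)) i * g i s) = (\<Sum>i\<in>J. b i * g i s)"
        using insert.hyps by (intro sum.cong) auto
      then show ?thesis using b[OF that] insert.hyps by (simp add: algebra_simps)
    qed
    with insert.prems show False by blast
  qed
  show ?case
  proof (cases "\<exists>b. \<forall>s\<in>S. g j s = (\<Sum>j\<in>J. b j * g j s)")
    case True
    then obtain b where b: "\<And>s. s \<in> S \<Longrightarrow> g j s = (\<Sum>j\<in>J. b j * g j s)" by blast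
    obtain xs where xs: "fst ` set xs \<subseteq> S" "\<forall>j\<in>J. evals xs (g j) = 0" "evals xs f = 1"
      using insert.IH[of f] span[of 0] by auto
    have "evals xs (g j) = (\<Sum>j\<in>J. b j * evals xs (g j))"
      using evals_cong[OF xs(1) b] by (simp add: evals_sum)
    then have "evals xs (g j) = 0" using xs(2) by simp
    with xs show ?thesis by blast
  next
    case False
    then obtain ys where ys: "fst ` set ys \<subseteq> S" "\<forall>j\<in>J. evals ys (g j) = 0" "evals ys (g j) = 1"
      using insert.IH[of "g j"] by blast
    \<comment> \<open>The multiple of \<open>g j\<close> is subtracted from \<open>f\<close> so that
      the later correction of \<open>xs\<close> by \<open>ys\<close>, which kills
      \<open>g j\<close>, restores the value 1 at \<open>f\<close>.\<close>
    obtain xs where xs: "fst ` set xs \<subseteq> S" "\<forall>j\<in>J. evals xs (g j) = 0"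
      "evals xs (\<lambda>s. f s - evals ys f * g j s) = 1"
      using insert.IH[OF span[of "evals ys f"]] by blast
    define b where "b = - evals xs (g j)"
    let ?zs = "xs @ map (\<lambda>p. (fst p, b * snd p)) ys"
    have zs: "evals ?zs h = evals xs h + b * evals ys h" for h
      by (simp add: evals_scale)
    have "fst ` set ?zs \<subseteq> S" using xs(1) ys(1) by force
    moreover have "\<forall>i\<in>insert j J. evals ?zs (g i) = 0"
      unfolding zs using xs(2) ys(2,3) by (simp add: b_def)
    moreover have "evals ?zs f = 1"
      unfolding zs using xs(3) by (simp add: evals_diff b_def mult.commute)
    ultimately show ?thesis by blast
  qed
qed

text \<open>An entry consists of a relator, its real coefficient and the coordinate of
  \<open>v\<close> that multiplies it. Rounding takes place separately in every factor.\<close>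

primrec word_map ::
  "('a,'b) monoid_scheme \<Rightarrow> (('a \<times> 'a) list \<times> real \<times> nat) list \<Rightarrow> (nat \<Rightarrow> int) \<Rightarrow> 'a" where
  "word_map G [] v = \<one>\<^bsub>G\<^esub>"
| "word_map G (e # es) v =
     rel_word G (fst e) \<lfloor>fst (snd e) * real_of_int (v (snd (snd e)))\<rfloor> \<otimes>\<^bsub>G\<^esub> word_map G es v"

text \<open>With \<open>f\<close> the slope of a quasimorphism, this is its value on
  \<open>word_map\<close> up to a bounded error, computed as if exponents were not rounded.\<close>

definition entry_sum :: "('r \<times> real \<times> nat) list \<Rightarrow> (nat \<Rightarrow> int) \<Rightarrow> ('r \<Rightarrow> real) \<Rightarrow> real" where
  "entry_sum es v f = (\<Sum>e\<leftarrow>es. fst (snd e) * real_of_int (v (snd (snd e))) * f (fst e))"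

lemma entry_sum_simps [simp]:
  "entry_sum [] v f = 0"
  "entry_sum (e # es) v f = fst (snd e) * real_of_int (v (snd (snd e))) * f (fst e) + entry_sum es v f"
  "entry_sum (es @ es') v f = entry_sum es v f + entry_sum es' v f"
  unfolding entry_sum_def by simp_all

lemma entry_sum_concat:
  "entry_sum (concat (map (\<lambda>k. map (\<lambda>p. (fst p, snd p, k)) (xs k)) [0..<t])) v f
     = (\<Sum>k<t. real_of_int (v k) * evals (xs k) f)"
proof (induction t)
  case (Suc t)
  have "entry_sum (map (\<lambda>p. (fst p, snd p, t)) ys) v f = real_of_int (v t) * evals ys f" for ys
    by (induction ys) (simp_all add: algebra_simps)
  with Suc show ?case by simp
qed simp

lemma l1_nonneg: "0 \<le> l1 t v"
  unfolding l1_def by (intro sum_nonneg) simp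

lemma abs_le_l1: "i < t \<Longrightarrow> \<bar>real_of_int (v i)\<bar> \<le> l1 t v"
  unfolding l1_def by (rule order_trans[OF _ member_le_sum[of i "{..<t}"]]) auto

text \<open>Control of \<open>\<Phi>\<close> would make the image of a bounded \<open>X\<close>
  bounded, but that image follows the first coordinate axis up to bounded distance.\<close>

lemma coarse_iso_unbounded:
  assumes "coarse_iso_Zt G N M X t" and "t > 0"
  shows "\<not> d_scl_bounded G N X"
proof
  assume "d_scl_bounded G N X"
  then obtain r where r: "\<And>x y. x \<in> X \<Longrightarrow> y \<in> X \<Longrightarrow> d_scl G N x y \<le> r"
    unfolding d_scl_bounded_def by blast
  have "\<exists>\<Psi> \<Phi>. \<Psi> ` Zt t = X
      \<and> (\<forall>r. \<exists>R. \<forall>x\<in>X. \<forall>y\<in>X. d_scl G N x y \<le> r \<longrightarrow> l1 t (vsub (\<Phi> x) (\<Phi> y)) \<le> R)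
      \<and> (\<exists>C. \<forall>v\<in>Zt t. l1 t (vsub (\<Phi> (\<Psi> v)) v) \<le> C)"
    using assms(1) unfolding coarse_iso_Zt_def
    by - (erule exE, erule exE, (erule conjE)+, rule exI, rule exI, intro conjI, assumption+)
  then obtain \<Psi> \<Phi> where X: "\<Psi> ` Zt t = X"
    and ctrl: "\<forall>r. \<exists>R. \<forall>x\<in>X. \<forall>y\<in>X. d_scl G N x y \<le> r \<longrightarrow> l1 t (vsub (\<Phi> x) (\<Phi> y)) \<le> R"
    and "\<exists>C. \<forall>v\<in>Zt t. l1 t (vsub (\<Phi> (\<Psi> v)) v) \<le> C"
    by blast
  then obtain C where C: "\<And>v. v \<in> Zt t \<Longrightarrow> l1 t (vsub (\<Phi> (\<Psi> v)) v) \<le> C" by blast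
  obtain R where R: "\<And>x y. x \<in> X \<Longrightarrow> y \<in> X \<Longrightarrow> l1 t (vsub (\<Phi> x) (\<Phi> y)) \<le> R"
    using spec[OF ctrl, of r] r by blast
  define v where "v n = (\<lambda>i::nat. if i = 0 then int n else 0)" for n :: nat
  have v: "v n \<in> Zt t" for n using assms(2) unfolding v_def Zt_def by simp
  have "real n \<le> R + C + C" for n
  proof -
    let ?x = "\<Psi> (v n)" and ?y = "\<Psi> (v 0)"
    have "\<bar>real_of_int (\<Phi> ?x 0 - \<Phi> ?y 0)\<bar> \<le> R"
      using abs_le_l1[OF assms(2), of "vsub (\<Phi> ?x) (\<Phi> ?y)"] R[of ?x ?y] X v
      unfolding vsub_def by fastforce
    moreover have "\<bar>real_of_int (\<Phi> (\<Psi> (v k)) 0 - int k)\<bar> \<le> C" for k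
      using abs_le_l1[OF assms(2), of "vsub (\<Phi> (\<Psi> (v k))) (v k)"] C[OF v[of k]]
      unfolding vsub_def v_def by simp
    from this[of n] this[of 0] have "\<bar>real_of_int (\<Phi> ?x 0) - real n\<bar> \<le> C"
      "\<bar>real_of_int (\<Phi> ?y 0)\<bar> \<le> C" by simp_all
    ultimately show ?thesis by simp
  qed
  then show False using reals_Archimedean2[of "R + C + C"] by (meson not_le)
qed

section \<open>Relator words and the coarse lattice\<close>

context commutator_pair
begin

lemma rel_word_zero: "set r \<subseteq> carrier G \<times> L \<Longrightarrow> rel_word G r 0 = \<one>"
  by (induction r) (auto simp: commutator_def)

lemma relators_subset: "r \<in> relators G L \<Longrightarrow> set r \<subseteq> carrier G \<times> L"
  unfolding relators_def by simp

lemma relator_one: "r \<in> relators G L \<Longrightarrow> rel_word G r 1 = \<one>"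
  unfolding relators_def by simp

text \<open>Raising the exponent by 1 multiplies by the trivial value at 1, up to
  \<open>2 * length r\<close> commutators. This puts the words into [G,N]. The summand 1 next to the
  absolute value pays for splitting exponent 0 when \<open>n\<close> is negative.\<close>

lemma relator_B:
  assumes r: "r \<in> relators G L"
  shows "rel_word G r n \<in> N.B (2 * length r * (nat \<bar>n\<bar> + 1))"
proof -
  note rs = relators_subset[OF r]
  let ?k = "2 * length r"
  have nat: "rel_word G r (int m) \<in> N.B (?k * m)" for m
  proof (induction m)
    case 0 then show ?case using rel_word_zero[OF rs] by simp
  next
    case (Suc m)
    have "N.apx ?k (rel_word G r (int m + 1)) (rel_word G r (int m) \<otimes> rel_word G r 1)"
      by (rule rel_word_add[OF rs])
    then have "N.apx ?k (rel_word G r (int m + 1)) (rel_word G r (int m))"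
      using relator_one[OF r] rel_word_carrier[OF rs] by simp
    moreover have "N.apx (?k * m) (rel_word G r (int m)) \<one>"
      using Suc N.apx_one_iff by blast
    ultimately have "N.apx (?k + ?k * m) (rel_word G r (int m + 1)) \<one>"
      by (rule N.apx_trans)
    then show ?case by (simp add: N.apx_one_iff add.commute)
  qed
  show ?thesis
  proof (cases n rule: int_cases2)
    case (nonneg m)
    then show ?thesis using N.B_mono[OF nat[of m]] by simp
  next
    case (nonpos m)
    have c: "rel_word G r n \<in> carrier G" "rel_word G r (int m) \<in> carrier G"
      using rel_word_carrier[OF rs] by auto
    have "N.apx ?k (rel_word G r (n + int m)) (rel_word G r n \<otimes> rel_word G r (int m))"
      by (rule rel_word_add[OF rs])
    then have "rel_word G r n \<otimes> rel_word G r (int m) \<in> N.B ?k"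
      using nonpos rel_word_zero[OF rs] N.apx_sym N.apx_one_iff by fastforce
    from N.B_mult[OF this N.B_inv[OF nat[of m]]]
    have "rel_word G r n \<in> N.B (?k + ?k * m)"
      using c by (simp add: m_assoc)
    then show ?thesis using nonpos by (simp add: algebra_simps)
  qed
qed

text \<open>The floor of a sum exceeds the sum of floors by 0 or 1, and for a relator a unit step of
  the exponent is a bounded error.\<close>

lemma relator_floor_add:
  assumes r: "r \<in> relators G L"
  shows "N.apx (4 * length r) (rel_word G r \<lfloor>a + b\<rfloor>) (rel_word G r \<lfloor>a\<rfloor> \<otimes> rel_word G r \<lfloor>b\<rfloor>)"
proof -
  note rs = relators_subset[OF r]
  let ?k = "2 * length r"
  have add: "N.apx ?k (rel_word G r (\<lfloor>a\<rfloor> + \<lfloor>b\<rfloor>)) (rel_word G r \<lfloor>a\<rfloor> \<otimes> rel_word G r \<lfloor>b\<rfloor>)"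
    by (rule rel_word_add[OF rs])
  consider "\<lfloor>a + b\<rfloor> = \<lfloor>a\<rfloor> + \<lfloor>b\<rfloor>" | "\<lfloor>a + b\<rfloor> = \<lfloor>a\<rfloor> + \<lfloor>b\<rfloor> + 1"
    by (cases "frac a + frac b < 1") (auto simp: floor_add)
  then show ?thesis
  proof cases
    case 1
    then show ?thesis using N.apx_mono[OF add, of "4 * length r"] by simp
  next
    case 2
    have "N.apx ?k (rel_word G r \<lfloor>a + b\<rfloor>) (rel_word G r (\<lfloor>a\<rfloor> + \<lfloor>b\<rfloor>))"
      using rel_word_add[OF rs, of "\<lfloor>a\<rfloor> + \<lfloor>b\<rfloor>" 1] relator_one[OF r] rel_word_carrier[OF rs]
      unfolding 2 by simp
    from N.apx_trans[OF this add] show ?thesis by simp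
  qed
qed

lemma word_map_GN: "fst ` set es \<subseteq> relators G L \<Longrightarrow> word_map G es v \<in> N.GN"
proof (induction es)
  case Nil then show ?case using N.B_GN[OF N.B_one[of 0]] by simp
next
  case (Cons e es)
  then have "rel_word G (fst e) n \<in> N.GN" for n using N.B_GN[OF relator_B] by simp
  with Cons show ?case by (simp add: subgroup.m_closed[OF N.GN_subgroup])
qed

lemma word_map_N: "fst ` set es \<subseteq> relators G L \<Longrightarrow> word_map G es v \<in> N"
  using word_map_GN N.GN_subset by blast

lemma word_map_B_L:
  "fst ` set es \<subseteq> relators G L \<Longrightarrow> word_map G es v \<in> L.B (\<Sum>e\<leftarrow>es. length (fst e))"
proof (induction es)
  case (Cons e es)
  then show ?case
    using L.B_mult[OF rel_word_B[OF relators_subset]] by simp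
qed simp

lemma word_map_add:
  assumes "fst ` set es \<subseteq> relators G L"
  shows "N.apx (\<Sum>e\<leftarrow>es. 4 * length (fst e) + 1) (word_map G es (vadd u v)) (word_map G es u \<otimes> word_map G es v)"
  using assms
proof (induction es)
  case Nil
  have "\<one> \<in> N" by simp
  then show ?case by (simp add: N.apx_refl)
next
  case (Cons e es)
  obtain r c k where e: "e = (r, c, k)" by (cases e)
  then have r: "r \<in> relators G L" and es: "fst ` set es \<subseteq> relators G L" using Cons.prems by auto
  let ?f = "\<lambda>v. rel_word G r \<lfloor>c * real_of_int (v k)\<rfloor>"
  have "c * real_of_int (vadd u v k) = c * real_of_int (u k) + c * real_of_int (v k)"
    unfolding vadd_def by (simp add: algebra_simps)
  then have f: "N.apx (4 * length r) (?f (vadd u v)) (?f u \<otimes> ?f v)"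
    using relator_floor_add[OF r] by simp
  have N: "?f w \<in> N" "word_map G es w \<in> N" for w
    using rel_word_N[OF relators_subset[OF r]] word_map_N[OF es] by auto
  have "N.apx (4 * length r + (\<Sum>e\<leftarrow>es. 4 * length (fst e) + 1) + 1)
      (?f (vadd u v) \<otimes> word_map G es (vadd u v))
      ((?f u \<otimes> word_map G es u) \<otimes> (?f v \<otimes> word_map G es v))"
    by (rule N.apx_trans[OF N.apx_mult[OF f Cons.IH[OF es]] N.apx_mult4]) (rule N)+
  then show ?case using e by (simp add: algebra_simps)
qed

lemma word_map_growth:
  assumes "fst ` set es \<subseteq> relators G L" "\<And>e. e \<in> set es \<Longrightarrow> snd (snd e) < t"
  shows "\<exists>C\<ge>0. \<forall>v. \<exists>k. word_map G es v \<in> N.B k \<and> real k \<le> C * (1 + l1 t v)"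
  using assms
proof (induction es)
  case Nil
  then show ?case using N.B_one[of 0] by (intro exI[of _ 0] conjI allI exI[of _ "0::nat"]) auto
next
  case (Cons e es)
  obtain r c i where e: "e = (r, c, i)" by (cases e)
  then have r: "r \<in> relators G L" and es: "fst ` set es \<subseteq> relators G L" and i: "i < t"
    using Cons.prems(1) Cons.prems(2)[of e] by auto
  obtain C where C: "C \<ge> 0" "\<And>v. \<exists>k. word_map G es v \<in> N.B k \<and> real k \<le> C * (1 + l1 t v)"
    using Cons.IH[OF es] Cons.prems(2) by auto
  \<comment> \<open>In \<open>\<bar>c\<bar> + 2\<close>, one unit pays for the rounding and one for
    the summand 1 in \<open>relator_B\<close>.\<close>
  define C' where "C' = 2 * real (length r) * (\<bar>c\<bar> + 2)"
  have "\<exists>k. word_map G (e # es) v \<in> N.B k \<and> real k \<le> (C' + C) * (1 + l1 t v)" for v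
  proof -
    let ?n = "\<lfloor>c * real_of_int (v i)\<rfloor>"
    obtain k where k: "word_map G es v \<in> N.B k" "real k \<le> C * (1 + l1 t v)" using C(2) by blast
    have "word_map G (e # es) v \<in> N.B (2 * length r * (nat \<bar>?n\<bar> + 1) + k)"
      using N.B_mult[OF relator_B[OF r] k(1)] e by simp
    moreover have "real (2 * length r * (nat \<bar>?n\<bar> + 1)) \<le> C' * (1 + l1 t v)"
    proof -
      have "\<bar>c * real_of_int (v i)\<bar> \<le> \<bar>c\<bar> * l1 t v"
        unfolding abs_mult using abs_le_l1[OF i] by (intro mult_left_mono) auto
      moreover have "\<bar>real_of_int ?n\<bar> \<le> \<bar>c * real_of_int (v i)\<bar> + 1" by linarith
      ultimately have "\<bar>real_of_int ?n\<bar> + 1 \<le> (\<bar>c\<bar> + 2) * (1 + l1 t v)"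
        using l1_nonneg[of t v] by (simp add: algebra_simps)
      from mult_left_mono[OF this, of "2 * real (length r)"] show ?thesis
        unfolding C'_def by (simp add: algebra_simps)
    qed
    ultimately show ?thesis
      using k(2) by (intro exI[of _ "2 * length r * (nat \<bar>?n\<bar> + 1) + k"]) (simp add: algebra_simps)
  qed
  moreover have "0 \<le> C' + C" using C(1) unfolding C'_def by simp
  ultimately show ?case by blast
qed

text \<open>Per factor: the error of \<open>slope_bound\<close>, an equal error from rounding the
  exponent, and one defect for the multiplication.\<close>

definition eval_error :: "(('a \<times> 'a) list \<times> real \<times> nat) list \<Rightarrow> real" where
  "eval_error es = (\<Sum>e\<leftarrow>es. 2 * (16 * real (length (fst e)) + 8) + 1)"

lemma word_map_QG:
  assumes \<nu>: "\<nu> \<in> QG G N" "defect_le G N D \<nu>" and "fst ` set es \<subseteq> relators G L"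
  shows "\<bar>\<nu> (word_map G es v) - entry_sum es v (slope G \<nu>)\<bar> \<le> eval_error es * D"
  using assms(3)
proof (induction es)
  case Nil
  then show ?case using N.QG_one[OF \<nu>(1)] by (simp add: eval_error_def)
next
  case (Cons e es)
  obtain r c i where e: "e = (r, c, i)" by (cases e)
  then have r: "r \<in> relators G L" and es: "fst ` set es \<subseteq> relators G L" using Cons.prems by auto
  let ?n = "\<lfloor>c * real_of_int (v i)\<rfloor>" and ?s = "slope G \<nu> r" and ?K = "16 * real (length r) + 8"
  note bound = slope_bound[OF \<nu> relators_subset[OF r]]
  \<comment> \<open>At exponent 1 the word is trivial, so \<open>slope_bound\<close> limits the
    slope itself; rounding changes the exponent by less than 1.\<close>
  have s: "\<bar>?s\<bar> \<le> ?K * D"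
    using bound[of 1] relator_one[OF r] N.QG_one[OF \<nu>(1)] by simp
  have "\<bar>(real_of_int ?n - c * real_of_int (v i)) * ?s\<bar> \<le> 1 * \<bar>?s\<bar>"
    unfolding abs_mult by (intro mult_right_mono) linarith+
  then have floor: "\<bar>real_of_int ?n * ?s - c * real_of_int (v i) * ?s\<bar> \<le> ?K * D"
    using s by (simp add: algebra_simps)
  have "\<bar>\<nu> (rel_word G r ?n \<otimes> word_map G es v) - \<nu> (rel_word G r ?n) - \<nu> (word_map G es v)\<bar> \<le> D"
    using \<nu>(2) rel_word_N[OF relators_subset[OF r]] word_map_N[OF es] unfolding defect_le_def by blast
  moreover have "eval_error (e # es) * D = 2 * (?K * D) + D + eval_error es * D"
    unfolding eval_error_def e by (simp add: algebra_simps)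
  ultimately show ?case
    using Cons.IH[OF es] bound[of ?n] floor unfolding e by simp
qed

theorem coarse_iso_word_map:
  assumes es: "fst ` set es \<subseteq> relators G L" "\<And>e. e \<in> set es \<Longrightarrow> snd (snd e) < t"
    and \<nu>: "\<And>i. i < t \<Longrightarrow> \<nu> i \<in> QG G N"
    and dual: "\<And>i v. i < t \<Longrightarrow> entry_sum es v (slope G (\<nu> i)) = real_of_int (v i)"
  shows "coarse_iso_Zt G N N.GN (word_map G es ` Zt t) t"
proof -
  let ?\<Psi> = "word_map G es"
  \<comment> \<open>Rounded dual quasimorphisms serve as coordinates on [G,N].\<close>
  define \<Phi> where "\<Phi> a = (\<lambda>i. if i < t then \<lfloor>\<nu> i a\<rfloor> else 0)" for a
  have "\<forall>i. \<exists>D. i < t \<longrightarrow> defect_le G N D (\<nu> i)" using \<nu> QG_defect by blast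
  then obtain D where D: "\<And>i. i < t \<Longrightarrow> defect_le G N (D i) (\<nu> i)" by metis
  obtain C where C: "C \<ge> 0" "\<And>v. \<exists>k. ?\<Psi> v \<in> N.B k \<and> real k \<le> C * (1 + l1 t v)"
    using word_map_growth[OF es] by blast
  define K where "K = (\<Sum>e\<leftarrow>es. 4 * length (fst e) + 1)"
  note add = word_map_add[OF es(1), folded K_def]
  have l1_le: "l1 t w \<le> (\<Sum>i<t. b i)" if "\<And>i. i < t \<Longrightarrow> \<bar>real_of_int (w i)\<bar> \<le> b i" for w b
    unfolding l1_def using that by (intro sum_mono) simp
  have controlled: "d_scl G N (?\<Psi> u) (?\<Psi> v) \<le> real K + C * (1 + r)"
    if "l1 t (vsub u v) \<le> r" for u v r
  proof -
    \<comment> \<open>Additivity reduces the distance of two images to the length of the word at the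
      difference, which is linear in its norm.\<close>
    have "vadd v (vsub u v) = u" unfolding vadd_def vsub_def by auto
    then have "N.apx K (?\<Psi> u) (?\<Psi> v \<otimes> ?\<Psi> (vsub u v))" using add[of v "vsub u v"] by simp
    moreover obtain k where k: "?\<Psi> (vsub u v) \<in> N.B k" "real k \<le> C * (1 + l1 t (vsub u v))"
      using C(2) by blast
    have "N.apx (0 + k) (?\<Psi> v \<otimes> ?\<Psi> (vsub u v)) (?\<Psi> v \<otimes> \<one>)"
      using k(1) word_map_N[OF es(1)] by (intro N.apx_mult N.apx_refl) (auto simp: N.apx_one_iff)
    ultimately have "N.apx (K + k) (?\<Psi> u) (?\<Psi> v)"
      using N.apx_trans N.N_carrier[OF word_map_N[OF es(1)]] by simp
    then have "d_scl G N (?\<Psi> u) (?\<Psi> v) \<le> real (K + k)" by (rule N.d_scl_le_apx)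
    moreover have "real k \<le> C * (1 + r)"
      using k(2) mult_left_mono[OF _ C(1), of "1 + l1 t (vsub u v)" "1 + r"] that by simp
    ultimately show ?thesis by simp
  qed
  have inverse: "l1 t (vsub (\<Phi> (?\<Psi> v)) v) \<le> (\<Sum>i<t. eval_error es * D i + 1)" for v
  proof (rule l1_le)
    fix i assume i: "i < t"
    have "\<bar>\<nu> i (?\<Psi> v) - real_of_int (v i)\<bar> \<le> eval_error es * D i"
      using word_map_QG[OF \<nu>[OF i] D[OF i] es(1), of v] dual[OF i] by simp
    then show "\<bar>real_of_int (vsub (\<Phi> (?\<Psi> v)) v i)\<bar> \<le> eval_error es * D i + 1"
      unfolding vsub_def \<Phi>_def using i by simp linarith
  qed
  show ?thesis
    unfolding coarse_iso_Zt_def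
  proof (intro exI[of _ ?\<Psi>] exI[of _ \<Phi>] conjI ballI allI impI)
    show "?\<Psi> v \<in> N.GN" for v by (rule word_map_GN[OF es(1)])
    show "\<exists>C. \<forall>u\<in>Zt t. \<forall>v\<in>Zt t. d_scl G N (?\<Psi> (vadd u v)) (?\<Psi> u \<otimes> ?\<Psi> v) \<le> C"
      using N.d_scl_le_apx[OF add] by blast
    show "\<exists>R. \<forall>u\<in>Zt t. \<forall>v\<in>Zt t. l1 t (vsub u v) \<le> r \<longrightarrow> d_scl G N (?\<Psi> u) (?\<Psi> v) \<le> R" for r
      using controlled by blast
    show "\<Phi> a \<in> Zt t" for a unfolding \<Phi>_def Zt_def by simp
    show "\<exists>C. \<forall>a\<in>N.GN. \<forall>b\<in>N.GN. l1 t (vsub (\<Phi> (a \<otimes> b)) (vadd (\<Phi> a) (\<Phi> b))) \<le> C"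
    proof (intro exI ballI)
      fix a b assume ab: "a \<in> N.GN" "b \<in> N.GN"
      \<comment> \<open>Each of the three floors contributes an error below 1.\<close>
      show "l1 t (vsub (\<Phi> (a \<otimes> b)) (vadd (\<Phi> a) (\<Phi> b))) \<le> (\<Sum>i<t. D i + 3)"
      proof (rule l1_le)
        fix i assume i: "i < t"
        have "\<bar>\<nu> i (a \<otimes> b) - \<nu> i a - \<nu> i b\<bar> \<le> D i"
          using D[OF i] ab N.GN_subset unfolding defect_le_def by blast
        then show "\<bar>real_of_int (vsub (\<Phi> (a \<otimes> b)) (vadd (\<Phi> a) (\<Phi> b)) i)\<bar> \<le> D i + 3"
          unfolding vsub_def vadd_def \<Phi>_def using i by simp linarith
      qed
    qed
    show "\<exists>R. \<forall>x\<in>?\<Psi> ` Zt t. \<forall>y\<in>?\<Psi> ` Zt t. d_scl G N x y \<le> r \<longrightarrow> l1 t (vsub (\<Phi> x) (\<Phi> y)) \<le> R"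
      for r
    proof (intro exI ballI impI)
      fix x y assume "x \<in> ?\<Psi> ` Zt t" "y \<in> ?\<Psi> ` Zt t" and r: "d_scl G N x y \<le> r"
      then have xy: "x \<in> N.GN" "y \<in> N.GN" using word_map_GN[OF es(1)] by auto
      show "l1 t (vsub (\<Phi> x) (\<Phi> y)) \<le> (\<Sum>i<t. 2 * D i * r + D i + 1)"
      proof (rule l1_le)
        fix i assume i: "i < t"
        have "\<bar>\<nu> i x - \<nu> i y\<bar> \<le> 2 * D i * d_scl G N x y + D i"
          by (rule N.QG_diff_le_d_scl[OF \<nu>[OF i] D[OF i] xy])
        also have "\<dots> \<le> 2 * D i * r + D i"
          using r N.defect_nonneg[OF D[OF i]] by (intro add_right_mono mult_left_mono) auto
        finally show "\<bar>real_of_int (vsub (\<Phi> x) (\<Phi> y) i)\<bar> \<le> 2 * D i * r + D i + 1"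
          unfolding vsub_def \<Phi>_def using i by simp linarith
      qed
    qed
    show "\<exists>C. \<forall>v\<in>Zt t. l1 t (vsub (\<Phi> (?\<Psi> v)) v) \<le> C" using inverse by blast
    show "\<exists>C. \<forall>x\<in>?\<Psi> ` Zt t. d_scl G N (?\<Psi> (\<Phi> x)) x \<le> C"
      \<comment> \<open>For \<open>x\<close> the image of \<open>v\<close>, the point
        \<open>\<Phi> x\<close> is within bounded distance of \<open>v\<close>, and the map from the
        lattice is controlled.\<close>
      using controlled[OF inverse] by blast
  qed simp
qed

lemma word_map_d_scl_bounded:
  assumes es: "fst ` set es \<subseteq> relators G L"
  shows "d_scl_bounded G L (word_map G es ` V)"
proof -
  let ?k = "\<Sum>e\<leftarrow>es. length (fst e)"
  have "d_scl G L (word_map G es u) (word_map G es v) \<le> real (?k + ?k)" for u v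
    using L.scl_le_B[OF L.B_mult[OF L.B_inv[OF word_map_B_L[OF es]] word_map_B_L[OF es]]]
    unfolding d_scl_def .
  then show ?thesis unfolding d_scl_bounded_def by blast
qed

text \<open>By Bavard duality, \<open>scl\<close> is bounded on a set on which all quasimorphisms of defect at
  most 1 are uniformly bounded.\<close>

lemma word_map_d_scl_bounded_N:
  assumes es: "fst ` set es \<subseteq> relators G L"
    and zero: "\<And>\<nu> v. \<nu> \<in> QG G N \<Longrightarrow> entry_sum es v (slope G \<nu>) = 0"
  shows "d_scl_bounded G N (word_map G es ` V)"
proof -
  have "d_scl G N (word_map G es u) (word_map G es v) \<le> 2 * eval_error es + 1" for u v
  proof -
    let ?x = "word_map G es u" and ?y = "word_map G es v"
    have GN: "?x \<in> N.GN" "?y \<in> N.GN" by (rule word_map_GN[OF es])+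
    have N: "?x \<in> N" "?y \<in> N" by (rule word_map_N[OF es])+
    then have "inv ?x \<in> N" by simp
    have "inv ?x \<otimes> ?y \<in> N.GN"
      using GN N.GN_subgroup by (simp add: subgroup.m_closed subgroup.m_inv_closed)
    then obtain \<psi> where \<psi>: "\<psi> \<in> QG G N" "defect_le G N 1 \<psi>" "scl G N (inv ?x \<otimes> ?y) \<le> \<psi> (inv ?x \<otimes> ?y)"
      by (rule N.bavard)
    have "\<bar>\<psi> (inv ?x \<otimes> ?y) - \<psi> (inv ?x) - \<psi> ?y\<bar> \<le> 1"
      using \<psi>(2) N \<open>inv ?x \<in> N\<close> unfolding defect_le_def by blast
    moreover have "\<bar>\<psi> (word_map G es w)\<bar> \<le> eval_error es" for w
      using word_map_QG[OF \<psi>(1,2) es, of w] zero[OF \<psi>(1)] by simp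
    from this[of u] this[of v] have "\<bar>\<psi> ?x\<bar> \<le> eval_error es" "\<bar>\<psi> ?y\<bar> \<le> eval_error es" .
    ultimately show ?thesis
      using \<psi>(3) N.QG_inv[OF \<psi>(1) N(1)] unfolding d_scl_def by simp
  qed
  then show ?thesis unfolding d_scl_bounded_def by blast
qed

end

section \<open>Functoriality and the main theorem\<close>

lemma set_sumI: "u \<in> U \<Longrightarrow> v \<in> V \<Longrightarrow> (\<lambda>x. u x + v x) \<in> set_sum U V"
  unfolding set_sum_def by blast

lemma H1G_lincomb:
  assumes F: "\<And>s. s \<in> F \<Longrightarrow> f s \<in> H1G G N"
  shows "(\<lambda>x. \<Sum>s\<in>F. c s * f s x) \<in> H1G G N"
proof -
  have "(\<Sum>s\<in>F. c s * f s x) = 0" if "x \<notin> N" for x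
    using F that unfolding H1G_def supported_on_def by (intro sum.neutral) auto
  moreover have "(\<Sum>s\<in>F. c s * f s (x \<otimes>\<^bsub>G\<^esub> y)) = (\<Sum>s\<in>F. c s * f s x) + (\<Sum>s\<in>F. c s * f s y)"
    if "x \<in> N" "y \<in> N" for x y
    unfolding sum.distrib[symmetric] distrib_left[symmetric]
    using F that unfolding H1G_def by (intro sum.cong refl) auto
  moreover have "(\<Sum>s\<in>F. c s * f s (g \<otimes>\<^bsub>G\<^esub> x \<otimes>\<^bsub>G\<^esub> inv\<^bsub>G\<^esub> g)) = (\<Sum>s\<in>F. c s * f s x)"
    if "g \<in> carrier G" "x \<in> N" for g x
    using F that unfolding H1G_def G_invariant_on_def by (intro sum.cong refl) auto
  ultimately show ?thesis
    unfolding H1G_def supported_on_def G_invariant_on_def by blast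
qed

locale commutator_pair_hom =
  G: commutator_pair L G + H: commutator_pair M H
  for L and G (structure) and M and H (structure) +
  fixes \<phi>
  assumes hom: "\<phi> \<in> hom G H" and maps: "x \<in> L \<Longrightarrow> \<phi> x \<in> M"
begin

section \<open>Transport of words and slopes along the homomorphism\<close>

sublocale group_hom G H \<phi>
  by unfold_locales (rule hom)

abbreviation "map_rel \<equiv> map (map_prod \<phi> \<phi>)"
abbreviation "pull \<nu> \<equiv> restr G.N (\<nu> \<circ> \<phi>)"

lemma map_commutator:
  "g \<in> carrier G \<Longrightarrow> x \<in> carrier G \<Longrightarrow> \<phi> (commutator G g x) = commutator H (\<phi> g) (\<phi> x)"
  unfolding commutator_def by simp

lemma rel_word_map_rel:
  "set r \<subseteq> carrier G \<times> L \<Longrightarrow> \<phi> (rel_word G r n) = rel_word H (map_rel r) n"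
proof (induction r)
  case (Cons p r)
  then have p: "fst p \<in> carrier G" "snd p \<in> L" and r: "set r \<subseteq> carrier G \<times> L" by auto
  have "snd p \<in> carrier G" using p G.L.N_carrier by blast
  moreover have "commutator G (fst p) (snd p [^]\<^bsub>G\<^esub> n) \<in> carrier G"
    using p by (rule G.commutator_pow_carrier)
  ultimately show ?case
    using Cons.IH[OF r] p G.rel_word_carrier[OF r] by (simp add: map_commutator hom_int_pow)
qed simp

lemma map_rel_subset: "set r \<subseteq> carrier G \<times> L \<Longrightarrow> set (map_rel r) \<subseteq> carrier H \<times> M"
  using maps by auto

lemma map_rel_relators: "r \<in> relators G L \<Longrightarrow> map_rel r \<in> relators H M"
  using map_rel_subset rel_word_map_rel[of r 1] unfolding relators_def by auto

lemma maps_N: "x \<in> G.N \<Longrightarrow> \<phi> x \<in> H.N"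
proof -
  assume "x \<in> G.N"
  then obtain r where r: "set r \<subseteq> carrier G \<times> L" "rel_word G r 1 = x" by (rule G.exists_rel_word)
  then show ?thesis using rel_word_map_rel[OF r(1), of 1] H.rel_word_N[OF map_rel_subset[OF r(1)]] by simp
qed

lemma pull_QG:
  assumes \<nu>: "\<nu> \<in> QG H H.N"
  shows "pull \<nu> \<in> QG G G.N"
proof -
  obtain D where D: "defect_le H H.N D \<nu>" using QG_defect[OF \<nu>] by blast
  have c: "x \<in> carrier G" if "x \<in> G.N" for x using that by (rule G.N.N_carrier)
  have "\<bar>pull \<nu> (x \<otimes>\<^bsub>G\<^esub> y) - pull \<nu> x - pull \<nu> y\<bar> \<le> D" if xy: "x \<in> G.N" "y \<in> G.N" for x y
    using D maps_N[OF xy(1)] maps_N[OF xy(2)] xy c unfolding defect_le_def restr_def by simp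
  moreover have "pull \<nu> (x [^]\<^bsub>G\<^esub> n) = real n * pull \<nu> x" if x: "x \<in> G.N" for x and n :: nat
    using QG_pow[OF \<nu> maps_N[OF x]] x c[OF x] G.N.N_pow[OF x]
    unfolding restr_def by (simp add: hom_nat_pow)
  moreover have "pull \<nu> (g \<otimes>\<^bsub>G\<^esub> x \<otimes>\<^bsub>G\<^esub> inv\<^bsub>G\<^esub> g) = pull \<nu> x" if g: "g \<in> carrier G" and x: "x \<in> G.N" for g x
    using QG_conj[OF \<nu> hom_closed[OF g] maps_N[OF x]] g x c[OF x] G.N.N_conj[OF g x]
    unfolding restr_def by simp
  moreover have "pull \<nu> x = 0" if "x \<notin> G.N" for x using that unfolding restr_def by simp
  ultimately show ?thesis
    unfolding QG_def supported_on_def quasimorphism_on_def homogeneous_on_def G_invariant_on_def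
    by (intro CollectI conjI exI[of _ D] allI impI ballI) assumption+
qed

text \<open>As an equivalence for arbitrary \<open>c\<close> and \<open>\<nu>\<close> it identifies
  the two definite descriptions in \<open>slope_pull\<close> without asking whether a slope
  exists.\<close>

lemma has_slope_pull:
  assumes "set r \<subseteq> carrier G \<times> L"
  shows "has_slope G (pull \<nu>) r c \<longleftrightarrow> has_slope H \<nu> (map_rel r) c"
  using G.rel_word_N[OF assms] rel_word_map_rel[OF assms] unfolding has_slope_def restr_def by simp

lemma slope_pull:
  assumes "set r \<subseteq> carrier G \<times> L"
  shows "slope G (pull \<nu>) r = slope H \<nu> (map_rel r)"
  unfolding slope_def has_slope_pull[OF assms] ..

lemma word_map_map_rel:
  "fst ` set es \<subseteq> relators G L \<Longrightarrow> \<phi> (word_map G es v) = word_map H (map (apfst map_rel) es) v"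
proof (induction es)
  case (Cons e es)
  then have e: "set (fst e) \<subseteq> carrier G \<times> L" and es: "fst ` set es \<subseteq> relators G L"
    using G.relators_subset by auto
  show ?case
    using Cons.IH[OF es] rel_word_map_rel[OF e] G.rel_word_carrier[OF e]
      G.N.N_carrier[OF G.word_map_N[OF es]] by simp
qed simp

lemma entry_sum_map_rel:
  "fst ` set es \<subseteq> relators G L \<Longrightarrow>
     entry_sum (map (apfst map_rel) es) v (slope H \<nu>) = entry_sum es v (slope G (pull \<nu>))"
  using G.relators_subset by (induction es) (auto simp: slope_pull)

text \<open>If the slopes of \<open>b\<close> on relators were combinations of those of the other
  elements of \<open>B\<close> and of the pullbacks from \<open>B'\<close>, the difference would
  have all slopes zero and lie in \<open>W_denom\<close>, against independence modulo the cokernel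
  denominator. Killing the pullbacks of the finite set \<open>B'\<close> kills all pullbacks, since
  elements of \<open>W_denom\<close> over \<open>H\<close> have slope zero on image
  relators.\<close>

lemma dual_relators:
  assumes B: "finite B" "B \<subseteq> QG G G.N"
    and indep: "\<And>c. (\<lambda>x. \<Sum>b\<in>B. c b * b x) \<in> set_sum (W_denom G L G.N) (pull ` QG H H.N) \<Longrightarrow> \<forall>b\<in>B. c b = 0"
    and B': "finite B'" "B' \<subseteq> QG H H.N" "QG H H.N \<subseteq> rspan (B' \<union> W_denom H M H.N)"
    and b: "b \<in> B"
  shows "\<exists>xs. fst ` set xs \<subseteq> relators G L \<and> evals xs (slope G b) = 1
    \<and> (\<forall>b'\<in>B - {b}. evals xs (slope G b') = 0) \<and> (\<forall>\<nu>\<in>QG H H.N. evals xs (slope G (pull \<nu>)) = 0)"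
proof -
  define f where "f = (\<lambda>j. case j of Inl b' \<Rightarrow> b' | Inr s \<Rightarrow> pull s)"
  \<comment> \<open>A disjoint sum, because a pullback may coincide with an element of
    \<open>B\<close>.\<close>
  let ?J = "(B - {b}) <+> B'"
  have J: "finite ?J" using B(1) B'(1) by simp
  have fQ: "f j \<in> QG G G.N" if "j \<in> ?J" for j
    using that B(2) B'(2) pull_QG unfolding f_def by auto
  have bQ: "b \<in> QG G G.N" using b B(2) by blast
  have "\<not> (\<exists>\<beta>. \<forall>r\<in>relators G L. slope G b r = (\<Sum>j\<in>?J. \<beta> j * slope G (f j) r))"
  proof
    assume "\<exists>\<beta>. \<forall>r\<in>relators G L. slope G b r = (\<Sum>j\<in>?J. \<beta> j * slope G (f j) r)"
    then obtain \<beta> where \<beta>: "\<And>r. r \<in> relators G L \<Longrightarrow> slope G b r = (\<Sum>j\<in>?J. \<beta> j * slope G (f j) r)" by blast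
    define \<mu> where "\<mu> = (\<lambda>x. b x + (- 1) * (\<Sum>j\<in>?J. \<beta> j * f j x))"
    have "\<mu> \<in> W_denom G L G.N"
    proof (rule G.slope_zero_W_denom)
      show "\<mu> \<in> QG G G.N" unfolding \<mu>_def by (intro QG_add bQ QG_lincomb fQ)
      fix r assume r: "r \<in> relators G L"
      have "has_slope G \<mu> r (slope G b r + (- 1) * (\<Sum>j\<in>?J. \<beta> j * slope G (f j) r))"
        unfolding \<mu>_def
        by (intro has_slope_add has_slope_sum G.has_slope bQ fQ G.relators_subset[OF r])
      then show "slope G \<mu> r = 0" using \<beta>[OF r] slope_eq by fastforce
    qed
    moreover define \<nu> where "\<nu> = (\<lambda>y. \<Sum>s\<in>B'. \<beta> (Inr s) * s y)"
    have "\<nu> \<in> QG H H.N" unfolding \<nu>_def using B'(2) by (intro QG_lincomb) blast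
    \<comment> \<open>The pullbacks are collected in a single one and moved to the other side,
      leaving a combination of \<open>B\<close> alone with coefficient 1 at
      \<open>b\<close>.\<close>
    moreover define c where "c b' = (if b' = b then 1 else - \<beta> (Inl b'))" for b'
    have "(\<Sum>b'\<in>B. c b' * b' x) = \<mu> x + pull \<nu> x" for x
    proof -
      have "(\<Sum>j\<in>?J. \<beta> j * f j x) = (\<Sum>b'\<in>B - {b}. \<beta> (Inl b') * b' x) + (\<Sum>s\<in>B'. \<beta> (Inr s) * pull s x)"
        using B(1) B'(1) by (subst sum.Plus) (auto simp: f_def)
      moreover have "(\<Sum>s\<in>B'. \<beta> (Inr s) * pull s x) = pull \<nu> x"
        unfolding \<nu>_def restr_def by simp
      moreover have "(\<Sum>b'\<in>B. c b' * b' x) = c b * b x + (\<Sum>b'\<in>B - {b}. c b' * b' x)"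
        using B(1) b by (rule sum.remove)
      moreover have "(\<Sum>b'\<in>B - {b}. c b' * b' x) = - (\<Sum>b'\<in>B - {b}. \<beta> (Inl b') * b' x)"
        unfolding sum_negf[symmetric] c_def by (intro sum.cong) auto
      ultimately show ?thesis unfolding \<mu>_def c_def by simp
    qed
    ultimately have "(\<lambda>x. \<Sum>b'\<in>B. c b' * b' x) \<in> set_sum (W_denom G L G.N) (pull ` QG H H.N)"
      unfolding set_sum_def by blast
    then have "c b = 0" using indep b by blast
    then show False unfolding c_def by simp
  qed
  from dual_evaluation[OF J this] obtain xs
    where xs: "fst ` set xs \<subseteq> relators G L" "evals xs (slope G b) = 1"
      and zero: "\<And>j. j \<in> ?J \<Longrightarrow> evals xs (slope G (f j)) = 0" by metis
  have "evals xs (slope G b') = 0" if "b' \<in> B - {b}" for b'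
    using zero[of "Inl b'"] that unfolding f_def by auto
  moreover have "evals xs (slope G (pull \<nu>)) = 0" if \<nu>: "\<nu> \<in> QG H H.N" for \<nu>
  proof -
    obtain F c where F: "finite F" "F \<subseteq> B' \<union> W_denom H M H.N" and \<nu>_eq: "\<nu> = (\<lambda>y. \<Sum>s\<in>F. c s * s y)"
      using B'(3) \<nu> unfolding rspan_def by blast
    define m where "m s r = (if s \<in> W_denom H M H.N then 0 else slope H s (map_rel r))" for s r
    have slope_eq_sum: "slope G (pull \<nu>) r = (\<Sum>s\<in>F. c s * m s r)" if r: "r \<in> relators G L" for r
    proof -
      have "has_slope H s (map_rel r) (m s r)" if "s \<in> F" for s
      proof (cases "s \<in> W_denom H M H.N")
        case True
        then show ?thesis using H.W_denom_slope_zero[OF True map_rel_relators[OF r]] by (simp add: m_def)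
      next
        case False
        then have "s \<in> QG H H.N" using that F(2) B'(2) by blast
        then show ?thesis
          using False H.has_slope[OF _ H.relators_subset[OF map_rel_relators[OF r]]] by (simp add: m_def)
      qed
      then have "has_slope H \<nu> (map_rel r) (\<Sum>s\<in>F. c s * m s r)"
        unfolding \<nu>_eq by (rule has_slope_sum)
      then show ?thesis using slope_pull[OF G.relators_subset[OF r]] slope_eq by simp
    qed
    have "evals xs (slope G (pull \<nu>)) = (\<Sum>s\<in>F. c s * evals xs (m s))"
      unfolding evals_sum[symmetric] by (rule evals_cong[OF xs(1) slope_eq_sum])
    moreover have "evals xs (m s) = 0" if "s \<in> F" for s
    proof (cases "s \<in> W_denom H M H.N")
      case True
      then have "m s = (\<lambda>r. 0)" unfolding m_def by auto
      then show ?thesis by simp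
    next
      case False
      then have "s \<in> B'" using that F(2) by blast
      have "evals xs (m s) = evals xs (slope G (pull s))"
        by (rule evals_cong[OF xs(1)]) (use False slope_pull G.relators_subset in \<open>simp add: m_def\<close>)
      also have "\<dots> = 0" using zero[of "Inr s"] \<open>s \<in> B'\<close> unfolding f_def by auto
      finally show ?thesis .
    qed
    ultimately show ?thesis by simp
  qed
  ultimately show ?thesis by (intro exI[of _ xs] conjI ballI xs)
qed

text \<open>Dimension 0 of the cokernel only places every quasimorphism in the span of the
  denominator; closure under combinations turns this into surjectivity.\<close>

lemma rspan_coker_denom:
  "rspan (set_sum (W_denom G L G.N) (pull ` QG H H.N)) \<subseteq> set_sum (W_denom G L G.N) (pull ` QG H H.N)"
proof
  let ?U = "set_sum (W_denom G L G.N) (pull ` QG H H.N)"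
  fix \<nu> assume "\<nu> \<in> rspan ?U"
  then obtain F c where F: "F \<subseteq> ?U" and \<nu>: "\<nu> = (\<lambda>x. \<Sum>s\<in>F. c s * s x)"
    unfolding rspan_def by blast
  have "\<forall>s\<in>F. \<exists>h \<psi> \<mu>. h \<in> H1G G G.N \<and> \<psi> \<in> QG G L \<and> \<mu> \<in> QG H H.N
      \<and> s = (\<lambda>x. h x + restr G.N \<psi> x + pull \<mu> x)"
  proof
    fix s assume "s \<in> F"
    then obtain w p where "w \<in> W_denom G L G.N" "p \<in> pull ` QG H H.N" "s = (\<lambda>x. w x + p x)"
      using F unfolding set_sum_def by blast
    then show "\<exists>h \<psi> \<mu>. h \<in> H1G G G.N \<and> \<psi> \<in> QG G L \<and> \<mu> \<in> QG H H.N
        \<and> s = (\<lambda>x. h x + restr G.N \<psi> x + pull \<mu> x)"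
      unfolding W_denom_def set_sum_def by blast
  qed
  then obtain h where "\<forall>s\<in>F. \<exists>\<psi> \<mu>. h s \<in> H1G G G.N \<and> \<psi> \<in> QG G L \<and> \<mu> \<in> QG H H.N
      \<and> s = (\<lambda>x. h s x + restr G.N \<psi> x + pull \<mu> x)"
    unfolding bchoice_iff by blast
  then obtain \<psi> where "\<forall>s\<in>F. \<exists>\<mu>. h s \<in> H1G G G.N \<and> \<psi> s \<in> QG G L \<and> \<mu> \<in> QG H H.N
      \<and> s = (\<lambda>x. h s x + restr G.N (\<psi> s) x + pull \<mu> x)"
    unfolding bchoice_iff by blast
  then obtain \<mu> where "\<forall>s\<in>F. h s \<in> H1G G G.N \<and> \<psi> s \<in> QG G L \<and> \<mu> s \<in> QG H H.N
      \<and> s = (\<lambda>x. h s x + restr G.N (\<psi> s) x + pull (\<mu> s) x)"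
    unfolding bchoice_iff by blast
  then have parts: "\<And>s. s \<in> F \<Longrightarrow> h s \<in> H1G G G.N" "\<And>s. s \<in> F \<Longrightarrow> \<psi> s \<in> QG G L"
    "\<And>s. s \<in> F \<Longrightarrow> \<mu> s \<in> QG H H.N"
    and s_eq: "\<And>s. s \<in> F \<Longrightarrow> s = (\<lambda>x. h s x + restr G.N (\<psi> s) x + pull (\<mu> s) x)"
    by blast+
  let ?h = "\<lambda>x. \<Sum>s\<in>F. c s * h s x" and ?\<psi> = "\<lambda>x. \<Sum>s\<in>F. c s * \<psi> s x"
    and ?\<mu> = "\<lambda>y. \<Sum>s\<in>F. c s * \<mu> s y"
  have "\<nu> = (\<lambda>x. ?h x + restr G.N ?\<psi> x + pull ?\<mu> x)"
  proof
    fix x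
    have "\<nu> x = (\<Sum>s\<in>F. c s * (h s x + restr G.N (\<psi> s) x + pull (\<mu> s) x))"
      unfolding \<nu> using s_eq by (intro sum.cong refl) metis
    then show "\<nu> x = ?h x + restr G.N ?\<psi> x + pull ?\<mu> x"
      by (simp add: restr_def distrib_left sum.distrib)
  qed
  moreover have "?h \<in> H1G G G.N" using parts(1) by (rule H1G_lincomb)
  moreover have "?\<psi> \<in> QG G L" "?\<mu> \<in> QG H H.N" using parts by (auto intro: QG_lincomb)
  ultimately show "\<nu> \<in> ?U" unfolding W_denom_def by (simp only:) (intro set_sumI imageI)
qed

theorem coarse_lattice:
  assumes B: "finite B" "card B = t" "B \<subseteq> QG G G.N"
    and indep: "\<And>c. (\<lambda>x. \<Sum>b\<in>B. c b * b x) \<in> set_sum (W_denom G L G.N) (pull ` QG H H.N) \<Longrightarrow> \<forall>b\<in>B. c b = 0"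
    and B': "finite B'" "B' \<subseteq> QG H H.N" "QG H H.N \<subseteq> rspan (B' \<union> W_denom H M H.N)"
  shows "\<exists>X\<subseteq>G.N.GN. coarse_iso_Zt G G.N G.N.GN X t \<and> d_scl_bounded G L X
    \<and> d_scl_bounded H H.N (\<phi> ` X)"
proof -
  obtain \<nu> where \<nu>: "bij_betw \<nu> {..<t} B"
    using ex_bij_betw_nat_finite[OF B(1)] B(2) by (auto simp: atLeast0LessThan)
  have \<nu>B: "\<nu> i \<in> B" if "i < t" for i using \<nu> that by (auto simp: bij_betw_def)
  have inj: "\<nu> i \<noteq> \<nu> k" if "i < t" "k < t" "i \<noteq> k" for i k
    using \<nu> that by (auto simp: bij_betw_def inj_on_def)
  have "\<forall>k. \<exists>xs. k < t \<longrightarrow> fst ` set xs \<subseteq> relators G L \<and> evals xs (slope G (\<nu> k)) = 1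
    \<and> (\<forall>b'\<in>B - {\<nu> k}. evals xs (slope G b') = 0) \<and> (\<forall>\<nu>\<in>QG H H.N. evals xs (slope G (pull \<nu>)) = 0)"
    using dual_relators[OF B(1,3) indep B'] \<nu>B by blast
  then obtain xs where xs: "\<And>k. k < t \<Longrightarrow> fst ` set (xs k) \<subseteq> relators G L"
    "\<And>k. k < t \<Longrightarrow> evals (xs k) (slope G (\<nu> k)) = 1"
    "\<And>k b'. k < t \<Longrightarrow> b' \<in> B - {\<nu> k} \<Longrightarrow> evals (xs k) (slope G b') = 0"
    "\<And>k \<mu>. k < t \<Longrightarrow> \<mu> \<in> QG H H.N \<Longrightarrow> evals (xs k) (slope G (pull \<mu>)) = 0" by metis
  \<comment> \<open>The list dual to \<open>\<nu> k\<close> is tagged with coordinate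
    \<open>k\<close>, so that the slope sum of \<open>\<nu> i\<close> returns the
    \<open>i\<close>-th coordinate.\<close>
  define es where "es = concat (map (\<lambda>k. map (\<lambda>p. (fst p, snd p, k)) (xs k)) [0..<t])"
  have es: "fst ` set es \<subseteq> relators G L" using xs(1) unfolding es_def by fastforce
  have es_t: "snd (snd e) < t" if "e \<in> set es" for e using that unfolding es_def by auto
  have dual: "entry_sum es v (slope G (\<nu> i)) = real_of_int (v i)" if i: "i < t" for i v
  proof -
    have "entry_sum es v (slope G (\<nu> i)) = (\<Sum>k<t. if k = i then real_of_int (v k) else 0)"
      unfolding es_def entry_sum_concat
    proof (intro sum.cong refl)
      fix k assume "k \<in> {..<t}"
      then show "real_of_int (v k) * evals (xs k) (slope G (\<nu> i)) = (if k = i then real_of_int (v k) else 0)"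
        using xs(2)[of k] xs(3)[of k "\<nu> i"] \<nu>B[OF i] inj[OF i, of k] by auto
    qed
    then show ?thesis using i by simp
  qed
  \<comment> \<open>A slope in \<open>H\<close> along image relators is the slope of a pullback,
    which every dual list annihilates.\<close>
  have zero: "entry_sum (map (apfst map_rel) es) v (slope H \<mu>) = 0" if "\<mu> \<in> QG H H.N" for \<mu> v
    unfolding entry_sum_map_rel[OF es] unfolding es_def entry_sum_concat
    by (intro sum.neutral) (simp add: xs(4)[OF _ that])
  have es_H: "fst ` set (map (apfst map_rel) es) \<subseteq> relators H M"
    using es map_rel_relators by auto
  let ?X = "word_map G es ` Zt t"
  have "\<phi> ` ?X = word_map H (map (apfst map_rel) es) ` Zt t"
    unfolding image_image word_map_map_rel[OF es] ..
  then have "d_scl_bounded H H.N (\<phi> ` ?X)"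
    using H.word_map_d_scl_bounded_N[OF es_H zero] by simp
  moreover have "coarse_iso_Zt G G.N G.N.GN ?X t"
    using es es_t B(3) \<nu>B dual by (intro G.coarse_iso_word_map[where \<nu> = \<nu>]) blast+
  moreover have "?X \<subseteq> G.N.GN" using G.word_map_GN[OF es] by blast
  ultimately show ?thesis using G.word_map_d_scl_bounded[OF es] by blast
qed

end

section \<open>Specialization to the lower central series\<close>

lemma lcs_normal:
  assumes "group G"
  shows "lcs G k \<lhd> G"
proof (induction k)
  case 0
  then show ?case
    using group.normal_inv_iff[OF assms] group.subgroup_self[OF assms] assms
    by (simp add: group.is_monoid monoid.m_closed group.inv_closed)
next
  case (Suc k)
  then interpret normal_words "lcs G k" G unfolding normal_words_def .
  show ?case using GN_normal by simp
qed

lemma commutator_pair_lcs: "group G \<Longrightarrow> commutator_pair (lcs G k) G"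
  using lcs_normal[of G k] unfolding commutator_pair_def normal_words_def by blast

lemma commutator_pair_hom_lcs:
  assumes "group G" "group H" "\<phi> \<in> hom G H"
  shows "commutator_pair_hom (lcs G k) G (lcs H k) H \<phi>"
proof (induction k)
  case 0
  show ?case
    using assms commutator_pair_lcs[of G 0] commutator_pair_lcs[of H 0]
    by (auto simp: commutator_pair_hom_def commutator_pair_hom_axioms_def dest: hom_in_carrier)
next
  case (Suc k)
  then interpret commutator_pair_hom "lcs G k" G "lcs H k" H \<phi> .
  show ?case
    using assms commutator_pair_lcs[of G "Suc k"] commutator_pair_lcs[of H "Suc k"] maps_N
    by (simp add: commutator_pair_hom_def commutator_pair_hom_axioms_def)
qed

text \<open>With q = k + 2 the index shift in \<open>gamma\<close> makes \<open>lcs G k\<close> the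
  subgroup \<open>L\<close> of the locale.\<close>

lemma gamma_Suc_Suc:
  "gamma G (Suc (Suc k) - 1) = lcs G k"
  "gamma G (Suc (Suc k)) = comm_subgroup G (carrier G) (lcs G k)"
  "gamma G (Suc (Suc (Suc k))) = comm_subgroup G (carrier G) (comm_subgroup G (carrier G) (lcs G k))"
  unfolding gamma_def by simp_all

theorem theorem12p6:
  fixes G :: "('a,'b) monoid_scheme" and H :: "('c,'d) monoid_scheme"
    and \<phi> :: "'a \<Rightarrow> 'c" and q t :: nat
  assumes "group G" and "group H" and "q \<ge> 2"
    and "W_fin_dim G (gamma G (q - 1)) (gamma G q)"
    and "W_fin_dim H (gamma H (q - 1)) (gamma H q)"
    and "\<phi> \<in> hom G H"
    and "\<not> T_surjective G H \<phi> q"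
    and "dim_coker_T G H \<phi> q t"
  shows "\<exists>X \<subseteq> gamma G (Suc q).
           coarse_iso_Zt G (gamma G q) (gamma G (Suc q)) X t
         \<and> \<not> d_scl_bounded G (gamma G q) X
         \<and> d_scl_bounded G (gamma G (q - 1)) X
         \<and> d_scl_bounded H (gamma H q) (\<phi> ` X)"
proof -
  obtain k where q: "q = Suc (Suc k)" using le_Suc_ex[OF assms(3)] by auto
  note gamma = gamma_Suc_Suc[where k = k, folded q]
  interpret commutator_pair_hom "lcs G k" G "lcs H k" H \<phi>
    using assms by (intro commutator_pair_hom_lcs)
  let ?U = "set_sum (W_denom G (lcs G k) G.N) (pull ` QG H H.N)"
  have coker: "coker_denom G H \<phi> q = ?U"
    unfolding coker_denom_def T_image_reps_def gamma by (rule arg_cong[where f = "set_sum _"]) auto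
  obtain B where B: "finite B" "card B = t" "B \<subseteq> QG G G.N" "QG G G.N \<subseteq> rspan (B \<union> ?U)"
    and "\<forall>c. (\<lambda>x. \<Sum>b\<in>B. c b * b x) \<in> ?U \<longrightarrow> (\<forall>b\<in>B. c b = 0)"
    using assms(8) unfolding dim_coker_T_def quot_dim_def coker gamma by (elim exE conjE)
  then have indep: "(\<lambda>x. \<Sum>b\<in>B. c b * b x) \<in> ?U \<Longrightarrow> \<forall>b\<in>B. c b = 0" for c by blast
  obtain B' where B': "finite B'" "B' \<subseteq> QG H H.N" "QG H H.N \<subseteq> rspan (B' \<union> W_denom H (lcs H k) H.N)"
    using assms(5) unfolding W_fin_dim_def quot_fin_dim_def quot_dim_def gamma by blast
  \<comment> \<open>With an empty basis, \<open>T\<close> would be surjective. Positivity is what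
    makes \<open>X\<close> unbounded.\<close>
  have "t > 0"
  proof (rule ccontr)
    assume "\<not> t > 0"
    then have "QG G G.N \<subseteq> rspan ?U" using B by simp
    then have "T_surjective G H \<phi> q"
      using rspan_coker_denom unfolding T_surjective_def coker gamma by blast
    with assms(7) show False by blast
  qed
  moreover have "\<exists>X\<subseteq>G.N.GN. coarse_iso_Zt G G.N G.N.GN X t \<and> d_scl_bounded G (lcs G k) X
      \<and> d_scl_bounded H H.N (\<phi> ` X)"
    by (rule coarse_lattice[OF B(1-3) _ B']) (rule indep)
  then obtain X where "X \<subseteq> G.N.GN" "coarse_iso_Zt G G.N G.N.GN X t" "d_scl_bounded G (lcs G k) X"
    "d_scl_bounded H H.N (\<phi> ` X)" by (elim exE conjE)
  ultimately show ?thesis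
    unfolding gamma by (intro exI[of _ X] conjI coarse_iso_unbounded)
qed

end
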